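(* Let $n \in \mathbb{N}$ with $n \geq 3$, let $k \in \{1,\dotsc,n-2\}$, and let $p \geq 3$ be a prime number. If $L_1,\ldots,L_s$ are representatives of the $\mathbb{Z}_p\mathfrak{S}_n$-isomorphism classes of $\mathbb{Z}_p$-forms of $S^{(n-1,1)}_{\mathbb{Q}_p}$, then $\bigwedge^k(L_1),\ldots,\bigwedge^k(L_s)$ are representatives of the $\mathbb{Z}_p\mathfrak{S}_n$-isomorphism classes of $\mathbb{Z}_p$-forms of $S^{(n-k,1^k)}_{\mathbb{Q}_p}$; in particular, the number of isomorphism classes of $\mathbb{Z}_p$-forms of $S^{(n-1,1)}_{\mathbb{Q}_p}$ and the number of isomorphism classes of $\mathbb{Z}_p$-forms of $S^{(n-k,1^k)}_{\mathbb{Q}_p}$ coincide.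
   Context: $\mathfrak{S}_n$ is the symmetric group of degree $n$. A $\mathbb{Z}_p\mathfrak{S}_n$-lattice is a left $\mathbb{Z}_p\mathfrak{S}_n$-module that is finitely generated and free over $\mathbb{Z}_p$; a $\mathbb{Z}_p$-form of a $\mathbb{Q}_p\mathfrak{S}_n$-module $V$ is a $\mathbb{Z}_p\mathfrak{S}_n$-lattice $M$ with $\mathbb{Q}_p\otimes_{\mathbb{Z}_p}M\cong V$. A list of representatives contains exactly one lattice from each isomorphism class. For a principal ideal domain $R$, the natural Specht $R\mathfrak{S}_n$-lattice is $S^{(n-1,1)}_R=\{\sum_i a_i\mathbf{i}:\sum_i a_i=0\}$ inside the natural permutation lattice with basis $\mathbf{1},\ldots,\mathbf{n}$, and the Specht $R\mathfrak{S}_n$-lattice $S^{(n-k,1^k)}_R$ labelled by the hook partition $(n-k,1^k)$ is identified with the exterior power $\bigwedge^k(S^{(n-1,1)}_R)$ (diagonal action). For a lattice $L$, $\bigwedge^k(L)$ is the $k$-th exterior power over $\mathbb{Z}_p$ with group action $g(m_1\wedge\cdots\wedge m_k)=gm_1\wedge\cdots\wedge gm_k$. *)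

theory Defs
  imports
    "HOL-Algebra.Sym_Groups"
    "HOL-Algebra.Group_Action"
    "HOL-Algebra.Module"
    "HOL-Computational_Algebra.Fraction_Field"
    "HOL-Decision_Procs.Algebra_Aux"
    "Berlekamp_Zassenhaus.Finite_Field"
begin

section \<open>The $p$-adic integers and the $p$-adic numbers\<close>

text \<open>The prime is the cardinality of a type of class \<open>prime_card\<close>. A $p$-adic integer is a
  compatible system of residues, that is, an element of the inverse limit of the rings
  of integers modulo $p^i$; the residue modulo $p^i$ is represented in $\{0,\dots,p^i-1\}$.\<close>

typedef ('p::prime_card) padic_int =
  "{x :: nat \<Rightarrow> int. \<forall>i. x (Suc i) mod int CARD('p) ^ i = x i}"
  by (rule exI[of _ "\<lambda>_. 0"]) simp

setup_lifting type_definition_padic_int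

lemma padic_mod_mod: "(a mod q ^ Suc i) mod q ^ i = a mod q ^ i" for a q :: int
  by (simp add: mod_mod_cancel)

lemma padic_mod_self:
  fixes x :: "nat \<Rightarrow> int"
  assumes "\<And>i. x (Suc i) mod q ^ i = x i"
  shows "x i mod q ^ i = x i"
  by (metis assms mod_mod_trivial)

instantiation padic_int :: (prime_card) comm_ring_1
begin

lift_definition zero_padic_int :: "'a padic_int" is "\<lambda>_. 0" by simp

lift_definition one_padic_int :: "'a padic_int" is "\<lambda>i. 1 mod int CARD('a) ^ i"
  by (simp only: padic_mod_mod)

lift_definition plus_padic_int :: "'a padic_int \<Rightarrow> 'a padic_int \<Rightarrow> 'a padic_int" is
  "\<lambda>x y i. (x i + y i) mod int CARD('a) ^ i"
  by (simp only: padic_mod_mod) (metis mod_add_eq)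

lift_definition uminus_padic_int :: "'a padic_int \<Rightarrow> 'a padic_int" is
  "\<lambda>x i. (- x i) mod int CARD('a) ^ i"
  by (simp only: padic_mod_mod) (metis mod_minus_eq)

lift_definition minus_padic_int :: "'a padic_int \<Rightarrow> 'a padic_int \<Rightarrow> 'a padic_int" is
  "\<lambda>x y i. (x i - y i) mod int CARD('a) ^ i"
  by (simp only: padic_mod_mod) (metis mod_diff_eq)

lift_definition times_padic_int :: "'a padic_int \<Rightarrow> 'a padic_int \<Rightarrow> 'a padic_int" is
  "\<lambda>x y i. (x i * y i) mod int CARD('a) ^ i"
  by (simp only: padic_mod_mod) (metis mod_mult_eq)

instance
proof
  fix a b c :: "'a padic_int"
  show "a * b * c = a * (b * c)"
    by transfer (auto simp: mod_simps mult.assoc)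
  show "a * b = b * a"
    by transfer (auto simp: mult.commute)
  show "1 * a = a"
    by transfer (auto simp: mod_simps padic_mod_self fun_eq_iff)
  show "a + b + c = a + (b + c)"
    by transfer (auto simp: mod_simps add.assoc)
  show "a + b = b + a"
    by transfer (auto simp: add.commute)
  show "0 + a = a"
    by transfer (auto simp: padic_mod_self)
  show "- a + a = 0"
    by transfer (auto simp: mod_simps)
  show "a - b = a + - b"
    by transfer (auto simp: mod_simps)
  show "(a + b) * c = a * c + b * c"
    by transfer (auto simp: mod_simps algebra_simps)
  show "(0 :: 'a padic_int) \<noteq> 1"
  proof transfer
    have "int CARD('a) > 1"
      using prime_card_int[where 'a = 'a] prime_gt_1_int by blast
    then have "(1 :: int) mod int CARD('a) ^ 1 = 1" by simp
    then show "(\<lambda>_. 0) \<noteq> (\<lambda>i. 1 mod int CARD('a) ^ i)"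
      by (auto dest: fun_cong[where x = 1])
  qed
qed

end

lemma padic_nonzeroD:
  fixes x :: "nat \<Rightarrow> int"
  assumes x: "\<And>i. x (Suc i) mod q ^ i = x i" and nz: "x i \<noteq> 0" and ij: "i \<le> j"
  shows "\<not> q ^ i dvd x j"
proof -
  have "x j mod q ^ i = x i"
    using ij
  proof (induction rule: dec_induct)
    case base
    show ?case using padic_mod_self[of x q] x by blast
  next
    case (step m)
    have "x (Suc m) mod q ^ i = (x (Suc m) mod q ^ m) mod q ^ i"
      using step by (simp add: mod_mod_cancel le_imp_power_dvd)
    also have "\<dots> = x m mod q ^ i" using x[of m] by simp
    finally show ?case using step by simp
  qed
  with nz show ?thesis by (auto simp: dvd_eq_mod_eq_0)
qed

instance padic_int :: (prime_card) idom
proof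
  fix a b :: "'a padic_int"
  assume "a \<noteq> 0" "b \<noteq> 0"
  then show "a * b \<noteq> 0"
  proof transfer
    fix a b :: "nat \<Rightarrow> int"
    let ?p = "int CARD('a)"
    assume a: "\<forall>i. a (Suc i) mod ?p ^ i = a i" and b: "\<forall>i. b (Suc i) mod ?p ^ i = b i"
      and nz: "a \<noteq> (\<lambda>_. 0)" "b \<noteq> (\<lambda>_. 0)"
    obtain i j where ij: "a i \<noteq> 0" "b j \<noteq> 0" using nz by blast
    have p: "prime ?p" by (rule prime_card_int)
    have "\<not> ?p ^ i dvd a (i + j)" "\<not> ?p ^ j dvd b (i + j)"
      using padic_nonzeroD[of a ?p i "i + j"] padic_nonzeroD[of b ?p j "i + j"] a b ij
      by simp_all
    moreover from this have "a (i + j) \<noteq> 0" "b (i + j) \<noteq> 0" by auto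
    moreover have u: "\<not> is_unit ?p" using p not_prime_unit by blast
    ultimately have "multiplicity ?p (a (i + j)) < i" "multiplicity ?p (b (i + j)) < j"
      by (simp_all only: multiplicity_lessI not_False_eq_True)
    then have "multiplicity ?p (a (i + j) * b (i + j)) < i + j"
      using p \<open>a (i + j) \<noteq> 0\<close> \<open>b (i + j) \<noteq> 0\<close>
      by (simp add: prime_elem_multiplicity_mult_distrib)
    then have "\<not> ?p ^ (i + j) dvd a (i + j) * b (i + j)"
      using u \<open>a (i + j) \<noteq> 0\<close> \<open>b (i + j) \<noteq> 0\<close>
      by (subst power_dvd_iff_le_multiplicity) auto
    then show "(\<lambda>i. a i * b i mod ?p ^ i) \<noteq> (\<lambda>_. 0)"
      by (auto dest: fun_cong[where x = "i + j"] simp: dvd_eq_mod_eq_0)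
  qed
qed

abbreviation Zp :: "'p::prime_card padic_int ring"
  where "Zp \<equiv> cring_class_ops"

abbreviation Qp :: "'p::prime_card padic_int fract ring"
  where "Qp \<equiv> cring_class_ops"

definition Zp_to_Qp :: "'p::prime_card padic_int \<Rightarrow> 'p padic_int fract"
  where "Zp_to_Qp a = Fraction_Field.Fract a 1"

section \<open>Modules over a group ring\<close>

text \<open>A left module over the group ring $RG$ is an $R$-module together with a left action of $G$
  by $R$-linear maps. The fields \<open>mult\<close> and \<open>one\<close>, which the record type \<open>module\<close> inherits
  from \<open>ring\<close>, play no role; the locale \<open>group_action\<close> forces \<open>act M g\<close> to be extensional
  on \<open>carrier M\<close>.\<close>

record ('r, 'm, 'g) gmodule = "('r, 'm) module" +
  act :: "'g \<Rightarrow> 'm \<Rightarrow> 'm"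

locale gmodule = Module.module R M + group_action G "carrier M" "act M"
  for R :: "'r ring" and G :: "'g monoid" and M :: "('r, 'm, 'g) gmodule" +
  assumes act_add: "\<lbrakk>g \<in> carrier G; x \<in> carrier M; y \<in> carrier M\<rbrakk> \<Longrightarrow>
      act M g (x \<oplus>\<^bsub>M\<^esub> y) = act M g x \<oplus>\<^bsub>M\<^esub> act M g y"
    and act_smult: "\<lbrakk>g \<in> carrier G; a \<in> carrier R; x \<in> carrier M\<rbrakk> \<Longrightarrow>
      act M g (a \<odot>\<^bsub>M\<^esub> x) = a \<odot>\<^bsub>M\<^esub> act M g x"

definition gmodule_iso ::
    "'r ring \<Rightarrow> 'g monoid \<Rightarrow> ('r, 'm, 'g) gmodule \<Rightarrow> ('r, 'n, 'g) gmodule \<Rightarrow> bool"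
  where "gmodule_iso R G M N \<longleftrightarrow>
    (\<exists>f. bij_betw f (carrier M) (carrier N) \<and>
      (\<forall>x\<in>carrier M. \<forall>y\<in>carrier M. f (x \<oplus>\<^bsub>M\<^esub> y) = f x \<oplus>\<^bsub>N\<^esub> f y) \<and>
      (\<forall>a\<in>carrier R. \<forall>x\<in>carrier M. f (a \<odot>\<^bsub>M\<^esub> x) = a \<odot>\<^bsub>N\<^esub> f x) \<and>
      (\<forall>g\<in>carrier G. \<forall>x\<in>carrier M. f (act M g x) = act N g (f x)))"

definition finite_basis :: "'r ring \<Rightarrow> ('r, 'm, 'g) gmodule \<Rightarrow> 'm set \<Rightarrow> bool"
  where "finite_basis R M B \<longleftrightarrow> finite B \<and> B \<subseteq> carrier M \<and>
    (\<forall>x\<in>carrier M. \<exists>!c. c \<in> B \<rightarrow>\<^sub>E carrier R \<and> x = (\<Oplus>\<^bsub>M\<^esub>b\<in>B. c b \<odot>\<^bsub>M\<^esub> b))"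

definition lattice_module :: "'r ring \<Rightarrow> 'g monoid \<Rightarrow> ('r, 'm, 'g) gmodule \<Rightarrow> bool"
  where "lattice_module R G M \<longleftrightarrow> gmodule R G M \<and> (\<exists>B. finite_basis R M B)"

lemma lattice_transport:
  fixes M :: "('r, 'm, 'g) gmodule" and \<phi> :: "'m \<Rightarrow> 'n"
  assumes L: "lattice_module R G M" and inj: "inj_on \<phi> (carrier M)"
  shows "\<exists>M' :: ('r, 'n, 'g) gmodule. lattice_module R G M' \<and> gmodule_iso R G M M'"
proof -
  interpret gmodule R G M using L by (simp add: lattice_module_def)
  define \<psi> where "\<psi> = the_inv_into (carrier M) \<phi>"
  have \<psi>\<phi> [simp]: "\<psi> (\<phi> x) = x" if "x \<in> carrier M" for x
    using inj that by (simp add: \<psi>_def the_inv_into_f_f)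
  have bij: "bij_betw \<phi> (carrier M) (\<phi> ` carrier M)"
    using inj by (simp add: bij_betw_def)
  have bij': "bij_betw \<psi> (\<phi> ` carrier M) (carrier M)"
    using bij unfolding \<psi>_def by (rule bij_betw_the_inv_into)
  define N :: "('r, 'n, 'g) gmodule" where "N =
    \<lparr>carrier = \<phi> ` carrier M, mult = (\<lambda>x y. x), one = \<phi> \<zero>\<^bsub>M\<^esub>, zero = \<phi> \<zero>\<^bsub>M\<^esub>,
     add = (\<lambda>x y. \<phi> (\<psi> x \<oplus>\<^bsub>M\<^esub> \<psi> y)), module.smult = (\<lambda>a x. \<phi> (a \<odot>\<^bsub>M\<^esub> \<psi> x)),
     act = (\<lambda>g. \<lambda>x\<in>\<phi> ` carrier M. \<phi> (act M g (\<psi> x)))\<rparr>"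
  have act_closed: "act M g x \<in> carrier M" if "g \<in> carrier G" "x \<in> carrier M" for g x
    using that element_image by blast
  have N [simp]: "carrier N = \<phi> ` carrier M" "\<zero>\<^bsub>N\<^esub> = \<phi> \<zero>\<^bsub>M\<^esub>"
    by (simp_all add: N_def)
  have hadd: "\<phi> (x \<oplus>\<^bsub>M\<^esub> y) = \<phi> x \<oplus>\<^bsub>N\<^esub> \<phi> y" if "x \<in> carrier M" "y \<in> carrier M" for x y
    using that by (simp add: N_def)
  have hsmult: "\<phi> (a \<odot>\<^bsub>M\<^esub> x) = a \<odot>\<^bsub>N\<^esub> \<phi> x" if "x \<in> carrier M" for a x
    using that by (simp add: N_def)
  have closedN: "a \<odot>\<^bsub>N\<^esub> \<phi> x \<in> \<phi> ` carrier M" if "a \<in> carrier R" "x \<in> carrier M" for a x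
    using that by (simp flip: hsmult)
  have hact: "\<phi> (act M g x) = act N g (\<phi> x)" if "x \<in> carrier M" for g x
    using that by (simp add: N_def)
  have ab: "abelian_group N"
  proof (rule abelian_groupI)
    fix x assume "x \<in> carrier N"
    then obtain u where u: "u \<in> carrier M" "x = \<phi> u" by auto
    show "\<exists>y\<in>carrier N. y \<oplus>\<^bsub>N\<^esub> x = \<zero>\<^bsub>N\<^esub>"
      using u by (intro bexI[of _ "\<phi> (\<ominus>\<^bsub>M\<^esub> u)"]) (simp_all flip: hadd add: M.l_neg)
  qed (auto simp flip: hadd simp: M.a_ac)
  have mod: "Module.module R N"
    by (rule moduleI[OF R.is_cring ab])
      (auto simp flip: hadd hsmult simp: smult_l_distr smult_r_distr smult_assoc1)
  have ga: "group_action G (carrier N) (act N)"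
  proof (intro group_action.intro group_hom.intro group_hom_axioms.intro homI)
    show "group G" using group_hom by (simp add: group_hom_def)
    show "group (BijGroup (carrier N))" by (rule group_BijGroup)
    have B: "act N g \<in> Bij (carrier N)" if g: "g \<in> carrier G" for g
    proof -
      have "bij_betw (act M g) (carrier M) (carrier M)"
        using bij_prop0[OF g] by (simp add: Bij_def)
      then have "bij_betw (\<phi> \<circ> (act M g \<circ> \<psi>)) (\<phi> ` carrier M) (\<phi> ` carrier M)"
        using bij bij' by (blast intro: bij_betw_trans)
      then have "bij_betw (act N g) (\<phi> ` carrier M) (\<phi> ` carrier M)"
        by (rule bij_betw_cong[THEN iffD1, rotated]) (simp add: N_def)
      then show ?thesis by (simp add: Bij_def) (simp add: N_def)
    qed
    then show "act N g \<in> carrier (BijGroup (carrier N))" if "g \<in> carrier G" for g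
      using that by (simp add: BijGroup_def)
    fix g h assume gh: "g \<in> carrier G" "h \<in> carrier G"
    have "act M (g \<otimes>\<^bsub>G\<^esub> h) x = act M g (act M h x)" if "x \<in> carrier M" for x
      using composition_rule[OF that gh] .
    then have "act N (g \<otimes>\<^bsub>G\<^esub> h) (\<phi> x) = act N g (act N h (\<phi> x))" if "x \<in> carrier M" for x
      using gh that act_closed by (simp flip: hact)
    then have "act N (g \<otimes>\<^bsub>G\<^esub> h) = compose (carrier N) (act N g) (act N h)"
    proof (intro extensionalityI[of _ "carrier N"])
      show "act N (g \<otimes>\<^bsub>G\<^esub> h) \<in> extensional (carrier N)" by (simp add: N_def)
    qed (auto simp: compose_def)
    then show "act N (g \<otimes>\<^bsub>G\<^esub> h) = act N g \<otimes>\<^bsub>BijGroup (carrier N)\<^esub> act N h"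
      using B gh by (simp add: BijGroup_def)
  qed
  have gm: "gmodule R G N"
    by (rule gmodule.intro[OF mod ga], unfold_locales)
      (auto simp flip: hadd hsmult hact simp: act_closed act_add act_smult)
  interpret N: Module.module R N by (rule mod)
  have sum: "\<phi> (finsum M f A) = finsum N (\<lambda>b. \<phi> (f b)) A"
    if "finite A" "f \<in> A \<rightarrow> carrier M" for f :: "'m \<Rightarrow> 'm" and A
    using that by (induction rule: finite_induct) (simp_all add: hadd Pi_iff)
  obtain B where B: "finite_basis R M B" using L by (auto simp: lattice_module_def)
  then have fin: "finite B" and BM: "B \<subseteq> carrier M"
    and ex: "\<And>x. x \<in> carrier M \<Longrightarrow>
      \<exists>!c. c \<in> B \<rightarrow>\<^sub>E carrier R \<and> x = (\<Oplus>\<^bsub>M\<^esub>b\<in>B. c b \<odot>\<^bsub>M\<^esub> b)"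
    by (auto simp: finite_basis_def)
  have injB: "inj_on \<phi> B" using inj BM by (rule inj_on_subset)
  have sumN: "(\<Oplus>\<^bsub>N\<^esub>b\<in>\<phi> ` B. c b \<odot>\<^bsub>N\<^esub> b) = \<phi> (\<Oplus>\<^bsub>M\<^esub>b\<in>B. c (\<phi> b) \<odot>\<^bsub>M\<^esub> b)"
    if "c \<in> \<phi> ` B \<rightarrow> carrier R" for c
  proof -
    have "(\<Oplus>\<^bsub>N\<^esub>b\<in>\<phi> ` B. c b \<odot>\<^bsub>N\<^esub> b) = (\<Oplus>\<^bsub>N\<^esub>b\<in>B. c (\<phi> b) \<odot>\<^bsub>N\<^esub> \<phi> b)"
      using that BM injB by (intro N.add.finprod_reindex) (auto intro!: closedN)
    also have "\<dots> = (\<Oplus>\<^bsub>N\<^esub>b\<in>B. \<phi> (c (\<phi> b) \<odot>\<^bsub>M\<^esub> b))"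
      using that BM by (intro N.add.finprod_cong') (auto simp: hsmult[symmetric] subset_iff)
    also have "\<dots> = \<phi> (\<Oplus>\<^bsub>M\<^esub>b\<in>B. c (\<phi> b) \<odot>\<^bsub>M\<^esub> b)"
      using that BM by (intro sum[symmetric] fin) auto
    finally show ?thesis .
  qed
  have "finite_basis R N (\<phi> ` B)"
    unfolding finite_basis_def
  proof (intro conjI ballI)
    show "finite (\<phi> ` B)" using fin by simp
    show "\<phi> ` B \<subseteq> carrier N" using BM by auto
    fix y assume "y \<in> carrier N"
    then obtain x where x: "x \<in> carrier M" "y = \<phi> x" by auto
    from ex[OF x(1)] obtain c where c: "c \<in> B \<rightarrow>\<^sub>E carrier R" "x = (\<Oplus>\<^bsub>M\<^esub>b\<in>B. c b \<odot>\<^bsub>M\<^esub> b)"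
      and u: "\<And>d. d \<in> B \<rightarrow>\<^sub>E carrier R \<Longrightarrow> x = (\<Oplus>\<^bsub>M\<^esub>b\<in>B. d b \<odot>\<^bsub>M\<^esub> b) \<Longrightarrow> d = c"
      by (elim ex1E) blast
    show "\<exists>!d. d \<in> \<phi> ` B \<rightarrow>\<^sub>E carrier R \<and> y = (\<Oplus>\<^bsub>N\<^esub>b\<in>\<phi> ` B. d b \<odot>\<^bsub>N\<^esub> b)"
    proof (rule ex1I[of _ "\<lambda>b\<in>\<phi> ` B. c (\<psi> b)"], intro conjI)
      show 1: "(\<lambda>b\<in>\<phi> ` B. c (\<psi> b)) \<in> \<phi> ` B \<rightarrow>\<^sub>E carrier R"
        using c(1) BM by (auto simp: subset_iff)
      have "(\<Oplus>\<^bsub>M\<^esub>b\<in>B. (\<lambda>b\<in>\<phi> ` B. c (\<psi> b)) (\<phi> b) \<odot>\<^bsub>M\<^esub> b) = x"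
        unfolding c(2) using c(1) BM by (intro M.add.finprod_cong') (auto simp: subset_iff)
      then show "y = (\<Oplus>\<^bsub>N\<^esub>b\<in>\<phi> ` B. (\<lambda>b\<in>\<phi> ` B. c (\<psi> b)) b \<odot>\<^bsub>N\<^esub> b)"
        using 1 x(2) by (subst sumN) auto
    next
      fix d assume d: "d \<in> \<phi> ` B \<rightarrow>\<^sub>E carrier R \<and> y = (\<Oplus>\<^bsub>N\<^esub>b\<in>\<phi> ` B. d b \<odot>\<^bsub>N\<^esub> b)"
      let ?d = "\<lambda>b\<in>B. d (\<phi> b)"
      have d1: "?d \<in> B \<rightarrow>\<^sub>E carrier R" using d by auto
      have "(\<Oplus>\<^bsub>M\<^esub>b\<in>B. ?d b \<odot>\<^bsub>M\<^esub> b) = (\<Oplus>\<^bsub>M\<^esub>b\<in>B. d (\<phi> b) \<odot>\<^bsub>M\<^esub> b)"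
        using d BM by (intro M.add.finprod_cong') (auto simp: subset_iff)
      moreover have "\<phi> x = \<phi> (\<Oplus>\<^bsub>M\<^esub>b\<in>B. d (\<phi> b) \<odot>\<^bsub>M\<^esub> b)"
      proof -
        have "y = (\<Oplus>\<^bsub>N\<^esub>b\<in>\<phi> ` B. d b \<odot>\<^bsub>N\<^esub> b)" using d by blast
        also have "\<dots> = \<phi> (\<Oplus>\<^bsub>M\<^esub>b\<in>B. d (\<phi> b) \<odot>\<^bsub>M\<^esub> b)" using d by (intro sumN) auto
        finally show ?thesis using x by simp
      qed
      then have "x = (\<Oplus>\<^bsub>M\<^esub>b\<in>B. d (\<phi> b) \<odot>\<^bsub>M\<^esub> b)"
        using x(1) d BM by (intro inj_onD[OF inj]) (auto intro!: M.finsum_closed smult_closed)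
      ultimately have "?d = c" using d1 by (intro u) auto
      then have "d (\<phi> b) = c b" if "b \<in> B" for b using that by (metis restrict_apply')
      then show "d = (\<lambda>b\<in>\<phi> ` B. c (\<psi> b))"
      proof (intro extensionalityI[of _ "\<phi> ` B"])
        show "d \<in> extensional (\<phi> ` B)" using d PiE_def by blast
      qed (use BM in \<open>auto simp: subset_iff\<close>)
    qed
  qed
  then have "lattice_module R G N" using gm by (auto simp: lattice_module_def)
  moreover have "gmodule_iso R G M N"
    unfolding gmodule_iso_def using bij hadd hsmult hact
    by (intro exI[of _ \<phi>]) simp
  ultimately show ?thesis by blast
qed

lemma lattice_coordinate_copy:
  fixes M :: "('r, 'm, 'g) gmodule"
  assumes L: "lattice_module R G M"
  shows "\<exists>M' :: ('r, nat \<Rightarrow> 'r, 'g) gmodule. lattice_module R G M' \<and> gmodule_iso R G M M'"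
proof -
  obtain B where B: "finite_basis R M B" using L by (auto simp: lattice_module_def)
  then have "finite B" unfolding finite_basis_def by blast
  then obtain h :: "nat \<Rightarrow> 'm" where h: "bij_betw h {0..<card B} B"
    using ex_bij_betw_nat_finite by blast
  have ex: "\<forall>x\<in>carrier M. \<exists>!c. c \<in> B \<rightarrow>\<^sub>E carrier R \<and> x = (\<Oplus>\<^bsub>M\<^esub>b\<in>B. c b \<odot>\<^bsub>M\<^esub> b)"
    using B unfolding finite_basis_def by (elim conjE)
  define c where "c x = (THE c. c \<in> B \<rightarrow>\<^sub>E carrier R \<and> x = (\<Oplus>\<^bsub>M\<^esub>b\<in>B. c b \<odot>\<^bsub>M\<^esub> b))" for x
  have c: "c x \<in> B \<rightarrow>\<^sub>E carrier R \<and> x = (\<Oplus>\<^bsub>M\<^esub>b\<in>B. c x b \<odot>\<^bsub>M\<^esub> b)" if "x \<in> carrier M" for x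
    unfolding c_def by (fact theI'[OF bspec[OF ex that]])
  have "inj_on (\<lambda>x. c x \<circ> h) (carrier M)"
  proof (rule inj_onI)
    fix x y assume xy: "x \<in> carrier M" "y \<in> carrier M" and eq: "c x \<circ> h = c y \<circ> h"
    have "c x = c y"
    proof (rule extensionalityI[of _ B])
      fix b assume "b \<in> B"
      then obtain i where "b = h i" using h by (auto simp: bij_betw_def)
      then show "c x b = c y b" using fun_cong[OF eq, of i] by simp
    qed (use c[OF xy(1), THEN conjunct1] c[OF xy(2), THEN conjunct1] in \<open>simp_all add: PiE_def\<close>)
    have "x = (\<Oplus>\<^bsub>M\<^esub>b\<in>B. c x b \<odot>\<^bsub>M\<^esub> b)" by (rule c[OF xy(1), THEN conjunct2])
    also have "\<dots> = (\<Oplus>\<^bsub>M\<^esub>b\<in>B. c y b \<odot>\<^bsub>M\<^esub> b)" unfolding \<open>c x = c y\<close> by (rule refl)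
    also have "\<dots> = y" by (rule c[OF xy(2), THEN conjunct2, symmetric])
    finally show "x = y" .
  qed
  with L show ?thesis by (rule lattice_transport)
qed

section \<open>Modules given by generators and relations\<close>

definition free_module :: "'r ring \<Rightarrow> 'x set \<Rightarrow> ('r, 'x \<Rightarrow> 'r) module"
  where "free_module R X =
    \<lparr>carrier = {f. (\<forall>x. f x \<in> carrier R) \<and> finite {x. f x \<noteq> \<zero>\<^bsub>R\<^esub>} \<and> {x. f x \<noteq> \<zero>\<^bsub>R\<^esub>} \<subseteq> X},
     mult = (\<lambda>f g x. f x \<otimes>\<^bsub>R\<^esub> g x), one = (\<lambda>x. \<zero>\<^bsub>R\<^esub>),
     zero = (\<lambda>x. \<zero>\<^bsub>R\<^esub>), add = (\<lambda>f g x. f x \<oplus>\<^bsub>R\<^esub> g x),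
     module.smult = (\<lambda>a f x. a \<otimes>\<^bsub>R\<^esub> f x)\<rparr>"

definition free_gen :: "'r ring \<Rightarrow> 'x \<Rightarrow> 'x \<Rightarrow> 'r"
  where "free_gen R x = (\<lambda>y. if y = x then \<one>\<^bsub>R\<^esub> else \<zero>\<^bsub>R\<^esub>)"

text \<open>The linear map of free modules that sends the generator \<open>x\<close> to the generator \<open>h x\<close>.\<close>

definition push :: "'r ring \<Rightarrow> ('x \<Rightarrow> 'y) \<Rightarrow> ('x \<Rightarrow> 'r) \<Rightarrow> 'y \<Rightarrow> 'r"
  where "push R h f = (\<lambda>y. \<Oplus>\<^bsub>R\<^esub>x\<in>{x. f x \<noteq> \<zero>\<^bsub>R\<^esub> \<and> h x = y}. f x)"

definition generated_submodule :: "'r ring \<Rightarrow> ('r, 'm) module \<Rightarrow> 'm set \<Rightarrow> 'm set"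
  where "generated_submodule R M S = \<Inter>{N. submodule N R M \<and> S \<subseteq> N}"

text \<open>The quotient of the free module on \<open>X\<close> by the submodule generated by \<open>S\<close>, where the group
  element \<open>g\<close> sends the class of the generator \<open>x\<close> to the class of the generator \<open>h g x\<close>.
  The elements are additive cosets, and the image of a coset under the automorphism of the free
  module induced by \<open>h g\<close> is again a coset when this automorphism preserves the submodule.\<close>

definition presented_gmodule ::
    "'r ring \<Rightarrow> 'x set \<Rightarrow> ('x \<Rightarrow> 'r) set \<Rightarrow> ('g \<Rightarrow> 'x \<Rightarrow> 'x) \<Rightarrow> ('r, ('x \<Rightarrow> 'r) set, 'g) gmodule"
  where "presented_gmodule R X S h =
    (let F = free_module R X; N = generated_submodule R F S
     in \<lparr>carrier = a_rcosets\<^bsub>F\<^esub> N, mult = (\<lambda>C D. N), one = N,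
         zero = N, add = (\<lambda>C D. C <+>\<^bsub>F\<^esub> D),
         module.smult = (\<lambda>a C. \<Union>f\<in>C. N +>\<^bsub>F\<^esub> (a \<odot>\<^bsub>F\<^esub> f)),
         act = (\<lambda>g. \<lambda>C\<in>a_rcosets\<^bsub>F\<^esub> N. push R (h g) ` C)\<rparr>)"

section \<open>Exterior powers\<close>

definition tuples :: "('r, 'm, 'g) gmodule \<Rightarrow> nat \<Rightarrow> 'm list set"
  where "tuples M k = {ms. length ms = k \<and> set ms \<subseteq> carrier M}"

text \<open>The generator given by the list \<open>[m\<^sub>1, \<dots>, m\<^sub>k]\<close> stands for the wedge of
  its entries. The three sets of relations make the wedge additive and homogeneous in each entry,
  and alternating.\<close>

definition exterior_relations ::
    "'r ring \<Rightarrow> nat \<Rightarrow> ('r, 'm, 'g) gmodule \<Rightarrow> ('m list \<Rightarrow> 'r) set"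
  where "exterior_relations R k M =
    (let F = free_module R (tuples M k); e = free_gen R
     in {e (ms[i := x \<oplus>\<^bsub>M\<^esub> y]) \<ominus>\<^bsub>F\<^esub> (e (ms[i := x]) \<oplus>\<^bsub>F\<^esub> e (ms[i := y])) | ms i x y.
          ms \<in> tuples M k \<and> i < k \<and> x \<in> carrier M \<and> y \<in> carrier M} \<union>
        {e (ms[i := a \<odot>\<^bsub>M\<^esub> x]) \<ominus>\<^bsub>F\<^esub> a \<odot>\<^bsub>F\<^esub> e (ms[i := x]) | ms i a x.
          ms \<in> tuples M k \<and> i < k \<and> a \<in> carrier R \<and> x \<in> carrier M} \<union>
        {e ms | ms. ms \<in> tuples M k \<and> \<not> distinct ms})"

definition exterior_power ::
    "'r ring \<Rightarrow> nat \<Rightarrow> ('r, 'm, 'g) gmodule \<Rightarrow> ('r, ('m list \<Rightarrow> 'r) set, 'g) gmodule"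
  where "exterior_power R k M =
    presented_gmodule R (tuples M k) (exterior_relations R k M) (\<lambda>g. map (act M g))"

section \<open>Extension of scalars\<close>

text \<open>The tensor product of \<open>K\<close> and \<open>M\<close> over \<open>R\<close> along a homomorphism \<open>\<phi>\<close> from \<open>R\<close> to \<open>K\<close>,
  as a \<open>K\<close>-module: the generator \<open>(c, x)\<close> stands for the pure tensor of \<open>c\<close> and \<open>x\<close>. The
  relations are additivity in both arguments, balancedness over \<open>R\<close>, and the rule for the
  multiplication of a pure tensor by an element of \<open>K\<close>.\<close>

definition tensor_relations ::
    "'r ring \<Rightarrow> 'k ring \<Rightarrow> ('r \<Rightarrow> 'k) \<Rightarrow> ('r, 'm, 'g) gmodule \<Rightarrow> ('k \<times> 'm \<Rightarrow> 'k) set"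
  where "tensor_relations R K \<phi> M =
    (let F = free_module K (carrier K \<times> carrier M); e = free_gen K
     in {e (c \<oplus>\<^bsub>K\<^esub> d, x) \<ominus>\<^bsub>F\<^esub> (e (c, x) \<oplus>\<^bsub>F\<^esub> e (d, x)) | c d x.
          c \<in> carrier K \<and> d \<in> carrier K \<and> x \<in> carrier M} \<union>
        {e (c, x \<oplus>\<^bsub>M\<^esub> y) \<ominus>\<^bsub>F\<^esub> (e (c, x) \<oplus>\<^bsub>F\<^esub> e (c, y)) | c x y.
          c \<in> carrier K \<and> x \<in> carrier M \<and> y \<in> carrier M} \<union>
        {e (c \<otimes>\<^bsub>K\<^esub> \<phi> a, x) \<ominus>\<^bsub>F\<^esub> e (c, a \<odot>\<^bsub>M\<^esub> x) | c a x.
          c \<in> carrier K \<and> a \<in> carrier R \<and> x \<in> carrier M} \<union>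
        {e (d \<otimes>\<^bsub>K\<^esub> c, x) \<ominus>\<^bsub>F\<^esub> d \<odot>\<^bsub>F\<^esub> e (c, x) | c d x.
          c \<in> carrier K \<and> d \<in> carrier K \<and> x \<in> carrier M})"

definition extend_scalars ::
    "'r ring \<Rightarrow> 'k ring \<Rightarrow> ('r \<Rightarrow> 'k) \<Rightarrow> ('r, 'm, 'g) gmodule \<Rightarrow>
      ('k, ('k \<times> 'm \<Rightarrow> 'k) set, 'g) gmodule"
  where "extend_scalars R K \<phi> M =
    presented_gmodule K (carrier K \<times> carrier M) (tensor_relations R K \<phi> M)
      (\<lambda>g. map_prod id (act M g))"

section \<open>Hook Specht lattices\<close>

text \<open>In the permutation lattice, the coefficient vector \<open>a\<close> stands for the sum of the
  \<open>a i\<close> times the \<open>i\<close>-th basis vector, and \<open>\<sigma>\<close> sends the \<open>i\<close>-th basis vector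
  to the \<open>\<sigma> i\<close>-th one.\<close>

definition natural_specht :: "'r ring \<Rightarrow> nat \<Rightarrow> ('r, nat \<Rightarrow> 'r, nat \<Rightarrow> nat) gmodule"
  where "natural_specht R n =
    (let P = free_module R {1..n}; S = {a \<in> carrier P. (\<Oplus>\<^bsub>R\<^esub>i\<in>{1..n}. a i) = \<zero>\<^bsub>R\<^esub>}
     in \<lparr>carrier = S, mult = monoid.mult P, one = monoid.one P, zero = ring.zero P,
         add = ring.add P, module.smult = module.smult P,
         act = (\<lambda>\<sigma>. \<lambda>a\<in>S. push R \<sigma> a)\<rparr>)"

definition hook_specht ::
    "'r ring \<Rightarrow> nat \<Rightarrow> nat \<Rightarrow> ('r, ((nat \<Rightarrow> 'r) list \<Rightarrow> 'r) set, nat \<Rightarrow> nat) gmodule"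
  where "hook_specht R n k = exterior_power R k (natural_specht R n)"

section \<open>Forms and their isomorphism classes\<close>

definition is_form ::
    "nat \<Rightarrow> ('p::prime_card padic_int fract, 'v, nat \<Rightarrow> nat) gmodule \<Rightarrow>
      ('p padic_int, 'm, nat \<Rightarrow> nat) gmodule \<Rightarrow> bool"
  where "is_form n V M \<longleftrightarrow> lattice_module Zp (sym_group n) M \<and>
    gmodule_iso Qp (sym_group n) (extend_scalars Zp Qp Zp_to_Qp M) V"

text \<open>The list \<open>Ls\<close> contains exactly one lattice from each isomorphism class of forms of \<open>V\<close>.
  Lattices with elements of any type may be isomorphic, but the quantification over all forms
  has to range over forms with elements of one type, which is passed as an argument. The type
  of functions from \<open>nat\<close> to the $p$-adic integers is universal: by lemma
  \<open>lattice_coordinate_copy\<close>, every lattice has an isomorphic copy there.\<close>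

definition form_representatives ::
    "'b itself \<Rightarrow> nat \<Rightarrow> ('p::prime_card padic_int fract, 'v, nat \<Rightarrow> nat) gmodule \<Rightarrow>
      ('p padic_int, 'm, nat \<Rightarrow> nat) gmodule list \<Rightarrow> bool"
  where "form_representatives (_ :: 'b itself) n V Ls \<longleftrightarrow>
    (\<forall>L\<in>set Ls. is_form n V L) \<and>
    (\<forall>i<length Ls. \<forall>j<length Ls. gmodule_iso Zp (sym_group n) (Ls ! i) (Ls ! j) \<longrightarrow> i = j) \<and>
    (\<forall>M :: ('p padic_int, 'b, nat \<Rightarrow> nat) gmodule. is_form n V M \<longrightarrow>
      (\<exists>L\<in>set Ls. gmodule_iso Zp (sym_group n) M L))"

text \<open>The isomorphism classes of forms of \<open>V\<close>, counted in the same universal type.\<close>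

definition form_classes ::
    "nat \<Rightarrow> ('p::prime_card padic_int fract, 'v, nat \<Rightarrow> nat) gmodule \<Rightarrow>
      ('p padic_int, nat \<Rightarrow> 'p padic_int, nat \<Rightarrow> nat) gmodule set set"
  where "form_classes n V =
    {M. is_form n V M} // {(M, N). is_form n V M \<and> is_form n V N \<and>
      gmodule_iso Zp (sym_group n) M N}"

end

theory Submission
  imports Defs "HOL-Library.Function_Algebras"
begin

text \<open>Let $f_0 = (1,\dots,1,1-n)$ and $f_i = e_i - e_n$ for $1 \le i \le n-2$, a basis of the natural
  Specht lattice. A transposition acts on an exterior power as $1 - \alpha \wedge \iota_{\alpha}$
  with a root $\alpha = e_a - e_b$. Since $2$ is invertible, the operators
  $\alpha \wedge \iota_{\beta}$ for any two roots $\alpha$ and $\beta$ lie in the algebra generated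
  by the transpositions, and hence so do $f_i \wedge \iota_j$, $f_0 \wedge \iota_j$ and
  $n f_i \wedge \iota_0$ for $i, j \ge 1$, where $\iota_j$ is the contraction with the dual basis
  vector. These operators show that an invariant lattice in the $k$-th exterior power is, up to a
  scalar, spanned by the products of basis vectors, those without the factor $f_0$ multiplied by
  $p^j$, where $0 \le j \le v_p(n)$. Up to a scalar it is therefore the $k$-th exterior power
  of the lattice spanned by $f_0$ and $p^j f_1, \dots, p^j f_{n-2}$. Isomorphisms commute with the
  same operators, which makes $j$ an isomorphism invariant. So for each $k$ the isomorphism
  classes correspond to the numbers $j$, compatibly with taking exterior powers.\<close>

section \<open>Arithmetic of the $p$-adic integers\<close>

text \<open>What lets the operators pin down a lattice is that the diagonal ones, f_i \<and>
  \<iota>_i with i \<ge> 1, are the projections onto the products containing f_i. In a fixed degree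
  they also decide whether f_0 occurs, by counting factors. So every coordinate projection lies in
  the integral algebra, and a stable lattice is the direct sum of one fractional ideal per index
  set. Exchanging nonzero indices makes the ideals of all sets on the same side of 0 equal. Of the
  two ideals left, f_0 \<and> \<iota>_j maps one into the other and n f_i \<and> \<iota>_0 leads
  back, so their ratio divides n. The range of k ensures that index sets of both kinds exist. The
  formal obstacle is that tensor products and exterior powers consist of cosets, over ever new
  types. Each presentation is therefore paired with a linear map into a function space whose kernel
  is shown to be the span of the relations. From then on all lattices are compared as subsets of one
  Fock space over the p-adic numbers.\<close>

lemma padic_eqI: "(\<And>i. Rep_padic_int x i = Rep_padic_int y i) \<Longrightarrow> x = y"
  by (metis Rep_padic_int_inject ext)

lemma padic_Suc_mod: "Rep_padic_int (x :: 'p::prime_card padic_int) (Suc i) mod int CARD('p) ^ i = Rep_padic_int x i"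
  using Rep_padic_int[of x] by simp

lemma padic_mod_le:
  assumes "i \<le> j"
  shows "Rep_padic_int (x :: 'p::prime_card padic_int) j mod int CARD('p) ^ i = Rep_padic_int x i"
  using assms
proof (induction rule: dec_induct)
  case base
  show ?case by (rule padic_mod_self) (rule padic_Suc_mod)
next
  case (step m)
  have "Rep_padic_int x (Suc m) mod int CARD('p) ^ i =
      (Rep_padic_int x (Suc m) mod int CARD('p) ^ m) mod int CARD('p) ^ i"
    using step by (simp add: mod_mod_cancel le_imp_power_dvd)
  then show ?case using step padic_Suc_mod[of x m] by simp
qed

lemma Rep_padic_of_nat: "Rep_padic_int (of_nat m :: 'p::prime_card padic_int) i = int m mod int CARD('p) ^ i"
  by (induction m) (simp_all add: zero_padic_int.rep_eq one_padic_int.rep_eq plus_padic_int.rep_eq mod_simps)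

text \<open>A nonzero residue modulo p makes every residue of \<open>x\<close> invertible modulo
  p^i. Inverses modulo p^i are unique once reduced, so the reduced ones, \<open>y\<close>, are
  automatically compatible and form a p-adic integer.\<close>

lemma padic_unit:
  fixes x :: "'p::prime_card padic_int"
  assumes x: "Rep_padic_int x 1 \<noteq> 0"
  shows "x dvd 1"
proof -
  let ?p = "int CARD('p)"
  have p: "prime ?p" by (rule prime_card_int)
  have cop: "coprime (Rep_padic_int x i) (?p ^ i)" for i
  proof (cases i)
    case (Suc j)
    have "Rep_padic_int x i mod ?p = Rep_padic_int x 1"
      using padic_mod_le[of 1 i x] Suc by simp
    then have "\<not> ?p dvd Rep_padic_int x i" using x by (auto simp: dvd_eq_mod_eq_0)
    then show ?thesis
      using p by (meson coprime_commute coprime_power_left_iff prime_imp_coprime)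
  qed simp
  have "\<exists>b. Rep_padic_int x i * b mod ?p ^ i = 1 mod ?p ^ i" for i
    using cong_solve_coprime_int[OF cop[of i]] by (auto simp: cong_def)
  then obtain b where b: "\<And>i. Rep_padic_int x i * b i mod ?p ^ i = 1 mod ?p ^ i" by metis
  define y where "y i = b i mod ?p ^ i" for i
  have y: "Rep_padic_int x i * y i mod ?p ^ i = 1 mod ?p ^ i" for i
    using b[of i] by (simp add: y_def mod_simps)
  have "y (Suc i) mod ?p ^ i = y i" for i
  proof -
    have "Rep_padic_int x (Suc i) * y (Suc i) mod ?p ^ i = 1 mod ?p ^ i"
      using y[of "Suc i"] by (metis padic_mod_mod)
    then have "Rep_padic_int x i * y (Suc i) mod ?p ^ i = 1 mod ?p ^ i"
      by (metis padic_Suc_mod mod_mult_left_eq)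
    then have "[Rep_padic_int x i * y (Suc i) = Rep_padic_int x i * y i] (mod ?p ^ i)"
      using y[of i] by (simp add: cong_def)
    then have "[y (Suc i) = y i] (mod ?p ^ i)"
      using cop[of i] by (simp add: cong_mult_lcancel)
    then show ?thesis by (simp add: cong_def y_def)
  qed
  then have R: "Rep_padic_int (Abs_padic_int y :: 'p padic_int) = y"
    by (intro Abs_padic_int_inverse) auto
  have "x * Abs_padic_int y = 1"
    by (rule padic_eqI) (simp add: times_padic_int.rep_eq one_padic_int.rep_eq R y)
  then show ?thesis by (metis dvd_triv_left)
qed

text \<open>Division by p shifts the residues by one place. The last two conclusions expose this
  shift, from which \<open>padic_factor\<close> sees that a nonzero residue moves one index
  down.\<close>

lemma padic_divide_prime:
  fixes x :: "'p::prime_card padic_int"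
  assumes x: "Rep_padic_int x 1 = 0"
  obtains y where "x = of_nat CARD('p) * y" "\<And>i. Rep_padic_int y i = Rep_padic_int x (Suc i) div int CARD('p)"
    "\<And>i. int CARD('p) dvd Rep_padic_int x (Suc i)"
proof -
  let ?p = "int CARD('p)"
  have p0: "?p > 0" by simp
  define y where "y i = Rep_padic_int x (Suc i) div ?p" for i
  have d: "?p dvd Rep_padic_int x (Suc i)" for i
    using padic_mod_le[of 1 "Suc i" x] x by (simp add: dvd_eq_mod_eq_0)
  have "y (Suc i) mod ?p ^ i = y i" for i
  proof -
    have "Rep_padic_int x (Suc (Suc i)) mod (?p * ?p ^ i) = Rep_padic_int x (Suc i)"
      using padic_Suc_mod[of x "Suc i"] by simp
    moreover have "Rep_padic_int x (Suc (Suc i)) = ?p * y (Suc i)" "Rep_padic_int x (Suc i) = ?p * y i"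
      using d by (simp_all add: y_def)
    ultimately have "?p * (y (Suc i) mod ?p ^ i) = ?p * y i"
      by (metis mult_mod_right)
    then show ?thesis using p0 by simp
  qed
  then have R: "Rep_padic_int (Abs_padic_int y :: 'p padic_int) = y"
    by (intro Abs_padic_int_inverse) auto
  have "x = of_nat CARD('p) * Abs_padic_int y"
  proof (rule padic_eqI)
    fix i
    have "Rep_padic_int (of_nat CARD('p) * Abs_padic_int y :: 'p padic_int) i = (?p * y i) mod ?p ^ i"
      by (simp add: times_padic_int.rep_eq Rep_padic_of_nat R mod_simps)
    also have "?p * y i = Rep_padic_int x (Suc i)" using d by (simp add: y_def)
    finally show "Rep_padic_int x i = Rep_padic_int (of_nat CARD('p) * Abs_padic_int y :: 'p padic_int) i"
      by (simp add: padic_Suc_mod)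
  qed
  then show ?thesis using that[of "Abs_padic_int y"] R d by (simp add: y_def)
qed

text \<open>Divide by p until the residue modulo p is nonzero; then \<open>padic_unit\<close>
  supplies the unit. Each division lowers the index of a known nonzero residue, so the process
  stops.\<close>

lemma padic_factor:
  fixes x :: "'p::prime_card padic_int"
  assumes "x \<noteq> 0"
  obtains u k where "u dvd 1" "x = u * of_nat CARD('p) ^ k"
proof -
  \<comment> \<open>The index is a successor because the residue with index 0 is always 0; thus m =
    0 is the case of a unit.\<close>
  have step: "\<exists>u k. u dvd 1 \<and> x = u * of_nat CARD('p) ^ k" if "Rep_padic_int x (Suc m) \<noteq> 0"
    for m and x :: "'p padic_int"
    using that
  proof (induction m arbitrary: x)
    case 0
    then show ?case using padic_unit[of x] by (intro exI[of _ x] exI[of _ 0]) simp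
  next
    case (Suc m)
    show ?case
    proof (cases "Rep_padic_int x 1 = 0")
      case True
      obtain y where y: "x = of_nat CARD('p) * y"
        "\<And>i. Rep_padic_int y i = Rep_padic_int x (Suc i) div int CARD('p)"
        "\<And>i. int CARD('p) dvd Rep_padic_int x (Suc i)"
        using padic_divide_prime[OF True] by metis
      have "Rep_padic_int y (Suc m) \<noteq> 0"
        using Suc.prems y(2)[of "Suc m"] y(3)[of "Suc m"] by auto
      then obtain u k where "u dvd 1" "y = u * of_nat CARD('p) ^ k" using Suc.IH by blast
      then show ?thesis using y(1) by (intro exI[of _ u] exI[of _ "Suc k"]) (simp add: ac_simps)
    next
      case False
      then show ?thesis using padic_unit[of x] by (intro exI[of _ x] exI[of _ 0]) simp
    qed
  qed
  obtain i where i: "Rep_padic_int x i \<noteq> 0"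
    using assms padic_eqI[of x 0] by (auto simp: zero_padic_int.rep_eq)
  then have "Rep_padic_int x (Suc i) \<noteq> 0" using padic_Suc_mod[of x i] by auto
  then show ?thesis using step[of x i] that by blast
qed

lemma padic_prime_not_unit: "\<not> (of_nat CARD('p) :: 'p::prime_card padic_int) dvd 1"
proof
  assume "(of_nat CARD('p) :: 'p padic_int) dvd 1"
  then obtain y where y: "1 = of_nat CARD('p) * (y :: 'p padic_int)" by (auto elim: dvdE)
  have "Rep_padic_int (1 :: 'p padic_int) 1 = 1"
    using prime_card_int[where 'a = 'p] prime_gt_1_int by (fastforce simp: one_padic_int.rep_eq)
  moreover have "Rep_padic_int (1 :: 'p padic_int) 1 = 0"
    by (subst y) (simp add: times_padic_int.rep_eq Rep_padic_of_nat)
  ultimately show False by simp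
qed

text \<open>Since p^m exceeds m, the residue of m modulo p^m is m itself.\<close>

lemma padic_of_nat_nonzero:
  assumes "m > 0"
  shows "(of_nat m :: 'p::prime_card padic_int) \<noteq> 0"
proof -
  have "CARD('p) > 1" using prime_card[where 'a = 'p] prime_gt_1_nat by blast
  then have "m < CARD('p) ^ m" by (intro power_gt_expt) simp
  then have "int m < int CARD('p) ^ m" by (simp flip: of_nat_power)
  then have "Rep_padic_int (of_nat m :: 'p padic_int) m = int m" by (simp add: Rep_padic_of_nat)
  then show ?thesis using assms by (auto simp: zero_padic_int.rep_eq)
qed

text \<open>This is where p \<ge> 3 enters the proof: the residue of 2 modulo p is then 2 and not
  0.\<close>

lemma padic_two_unit:
  assumes "CARD('p::prime_card) \<ge> 3"
  shows "(2 :: 'p padic_int) dvd 1"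
proof (rule padic_unit)
  have "Rep_padic_int (of_nat 2 :: 'p padic_int) 1 = 2"
    unfolding Rep_padic_of_nat using assms by simp
  then show "Rep_padic_int (2 :: 'p padic_int) 1 \<noteq> 0" by simp
qed

lemma padic_power_dvd:
  assumes "u dvd 1"
    and "(of_nat CARD('p) :: 'p::prime_card padic_int) ^ a dvd u * of_nat CARD('p) ^ b"
  shows "a \<le> b"
proof (rule ccontr)
  let ?q = "of_nat CARD('p) :: 'p padic_int"
  assume "\<not> a \<le> b"
  then have "Suc b \<le> a" by simp
  then have "?q ^ Suc b dvd ?q ^ a" by (rule le_imp_power_dvd)
  then have "?q * ?q ^ b dvd u * ?q ^ b" using assms(2) by (simp only: power_Suc) (rule dvd_trans)
  moreover have "?q \<noteq> 0" by (simp add: padic_of_nat_nonzero)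
  ultimately have "?q dvd u" by simp
  then show False using assms(1) padic_prime_not_unit dvd_trans by blast
qed

text \<open>Applied to n = u p^v, it turns the ratio of ideals found in
  \<open>stable_lattice\<close> into a power of p, up to a unit.\<close>

lemma padic_divisor:
  fixes t :: "'p::prime_card padic_int"
  assumes "u dvd 1" "t dvd u * of_nat CARD('p) ^ v"
  obtains w j where "w dvd 1" "j \<le> v" "t = w * of_nat CARD('p) ^ j"
proof -
  have "u \<noteq> 0" using assms(1) by auto
  then have "u * of_nat CARD('p) ^ v \<noteq> 0" by (simp add: padic_of_nat_nonzero)
  then have "t \<noteq> 0" using assms(2) by auto
  then obtain w j where w: "w dvd 1" "t = w * of_nat CARD('p) ^ j" using padic_factor by blast
  moreover have "j \<le> v" using padic_power_dvd[OF assms(1), of j v] assms(2) w(2) dvd_mult_right by blast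
  ultimately show ?thesis using that by blast
qed

section \<open>The embedding of the p-adic integers and fractional ideals\<close>

lemma Zp_to_Qp_simps [simp]:
  "Zp_to_Qp 0 = 0" "Zp_to_Qp 1 = 1" "Zp_to_Qp (a + b) = Zp_to_Qp a + Zp_to_Qp b"
  "Zp_to_Qp (a * b) = Zp_to_Qp a * Zp_to_Qp b" "Zp_to_Qp (- a) = - Zp_to_Qp a"
  "Zp_to_Qp (a - b) = Zp_to_Qp a - Zp_to_Qp b"
  by (simp_all add: Zp_to_Qp_def One_fract_def Zero_fract_def)

lemma Zp_to_Qp_eq_iff [simp]: "Zp_to_Qp a = Zp_to_Qp b \<longleftrightarrow> a = b"
  by (simp add: Zp_to_Qp_def eq_fract)

lemma Zp_to_Qp_eq_0_iff [simp]: "Zp_to_Qp a = 0 \<longleftrightarrow> a = 0"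
  using Zp_to_Qp_eq_iff[of a 0] by (simp del: Zp_to_Qp_eq_iff)

lemma Zp_to_Qp_of_nat [simp]: "Zp_to_Qp (of_nat m) = of_nat m"
  by (induction m) simp_all

lemma Zp_to_Qp_power [simp]: "Zp_to_Qp (a ^ m) = Zp_to_Qp a ^ m"
  by (induction m) simp_all

lemma Zp_to_Qp_sum: "Zp_to_Qp (sum f A) = (\<Sum>i\<in>A. Zp_to_Qp (f i))"
  by (induction A rule: infinite_finite_induct) simp_all

lemma Qp_fraction:
  obtains a b where "b \<noteq> 0" "c = Zp_to_Qp a / Zp_to_Qp b"
proof (cases c)
  case (Fract a b)
  then show ?thesis using that[of b a] by (simp add: Zp_to_Qp_def)
qed

text \<open>An element of least valuation generates. The bound \<open>a\<close> clears all
  denominators at once, so that valuations can be read off as the exponents collected in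
  \<open>A\<close>.\<close>

lemma fractional_ideal_principal:
  fixes J :: "'p::prime_card padic_int fract set"
  assumes add: "\<And>x y. x \<in> J \<Longrightarrow> y \<in> J \<Longrightarrow> x + y \<in> J"
    and mult: "\<And>r x. x \<in> J \<Longrightarrow> Zp_to_Qp r * x \<in> J"
    and nz: "x0 \<in> J" "x0 \<noteq> 0"
    and bnd: "a \<noteq> 0" "\<And>x. x \<in> J \<Longrightarrow> \<exists>r. Zp_to_Qp a * x = Zp_to_Qp r"
  obtains c where "c \<noteq> 0" "J = range (\<lambda>r. c * Zp_to_Qp r)"
proof -
  let ?q = "of_nat CARD('p) :: 'p padic_int"
  define A where "A = {k. \<exists>x\<in>J. \<exists>u. u dvd 1 \<and> Zp_to_Qp a * x = Zp_to_Qp (u * ?q ^ k)}"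
  have ex: "\<exists>u k. u dvd 1 \<and> Zp_to_Qp a * x = Zp_to_Qp (u * ?q ^ k) \<and> k \<in> A"
    if x: "x \<in> J" "x \<noteq> 0" for x
  proof -
    obtain r where r: "Zp_to_Qp a * x = Zp_to_Qp r" using bnd(2) x(1) by blast
    then have "r \<noteq> 0" using bnd(1) x(2) by (metis Zp_to_Qp_eq_0_iff mult_eq_0_iff)
    then obtain u k where u: "u dvd 1" "r = u * ?q ^ k" using padic_factor by blast
    then have "k \<in> A" unfolding A_def using x(1) r by blast
    then show ?thesis using u r by blast
  qed
  define k where "k = (LEAST k. k \<in> A)"
  have "k \<in> A" using ex[OF nz] unfolding k_def by (metis LeastI)
  then obtain x u where x: "x \<in> J" "u dvd 1" "Zp_to_Qp a * x = Zp_to_Qp (u * ?q ^ k)"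
    unfolding A_def by blast
  then obtain u' where u': "u' * u = 1" by (metis dvd_def mult.commute)
  \<comment> \<open>With the unit removed, a * c is exactly p^k, and the quotient of any other
    element by \<open>c\<close> has exponent l - k.\<close>
  define c where "c = Zp_to_Qp u' * x"
  have ac: "Zp_to_Qp a * c = Zp_to_Qp (?q ^ k)"
  proof -
    have "Zp_to_Qp a * c = Zp_to_Qp u' * (Zp_to_Qp a * x)" by (simp add: c_def)
    also have "\<dots> = Zp_to_Qp ((u' * u) * ?q ^ k)" by (simp only: x(3) Zp_to_Qp_simps mult.assoc)
    finally show ?thesis by (simp add: u')
  qed
  have cJ: "c \<in> J" unfolding c_def by (rule mult[OF x(1)])
  have "?q \<noteq> 0" by (simp add: padic_of_nat_nonzero)
  then have "c \<noteq> 0" using ac by (metis Zp_to_Qp_eq_0_iff mult_zero_right power_not_zero)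
  moreover have "J = range (\<lambda>r. c * Zp_to_Qp r)"
  proof (intro equalityI subsetI)
    fix y assume y: "y \<in> J"
    show "y \<in> range (\<lambda>r. c * Zp_to_Qp r)"
    proof (cases "y = 0")
      case True
      then show ?thesis by (intro range_eqI[of _ _ 0]) simp
    next
      case False
      then obtain w l where w: "Zp_to_Qp a * y = Zp_to_Qp (w * ?q ^ l)" "l \<in> A"
        using ex[OF y] by blast
      then have "k \<le> l" unfolding k_def by (simp add: Least_le)
      then have "?q ^ l = ?q ^ k * ?q ^ (l - k)" by (simp flip: power_add)
      then have "Zp_to_Qp a * y = Zp_to_Qp a * (c * Zp_to_Qp (w * ?q ^ (l - k)))"
        using w(1) ac by (simp add: ac_simps)
      then have "y = c * Zp_to_Qp (w * ?q ^ (l - k))"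
        using bnd(1) by (metis Zp_to_Qp_eq_0_iff mult_left_cancel)
      then show ?thesis by blast
    qed
  next
    fix y assume "y \<in> range (\<lambda>r. c * Zp_to_Qp r)"
    then show "y \<in> J" using mult[OF cJ] by (auto simp: mult.commute)
  qed
  ultimately show ?thesis using that by blast
qed

section \<open>Fermionic Fock space\<close>

text \<open>A function \<open>x\<close> on sets stands for the sum of the \<open>x I\<close> times the wedge product of the
  basis vectors $f_i$ with $i \in I$ in increasing order. The operators \<open>creation i\<close> and
  \<open>annih i\<close> are the multiplication by $f_i$ from the left and the contraction with the
  $i$-th dual basis vector; \<open>ext_mult\<close> and \<open>contract\<close> extend them linearly to all vectors and
  functionals.\<close>

declare plus_fun_apply [simp del] zero_fun_apply [simp del] minus_apply [simp del] uminus_apply [simp del]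

definition sc :: "'a::comm_ring_1 \<Rightarrow> ('z \<Rightarrow> 'a) \<Rightarrow> 'z \<Rightarrow> 'a"
  where "sc c x = (\<lambda>z. c * x z)"

lemma sc_apply: "sc c x z = c * x z"
  by (simp add: sc_def)

lemmas fun_algebra = fun_eq_iff plus_fun_apply zero_fun_apply minus_apply uminus_apply sc_apply

lemma sc_simps [simp]:
  "sc 1 x = x" "sc 0 x = 0" "sc c 0 = 0" "sc c (sc e x) = sc (c * e) x" "sc (- c) x = - sc c x"
  "sc c (- x) = - sc c x"
  by (auto simp: fun_algebra mult.assoc)

lemma sc_add_right: "sc c (x + y) = sc c x + sc c y"
  and sc_diff_right: "sc c (x - y) = sc c x - sc c y"
  and sc_add_left: "sc (c + e) x = sc c x + sc e x"
  and sc_diff_left: "sc (c - e) x = sc c x - sc e x"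
  by (auto simp: fun_algebra algebra_simps)

lemma sum_fun_apply: "(\<Sum>i\<in>A. f i) z = (\<Sum>i\<in>A. (f i z :: 'a::comm_monoid_add))"
  by (induction A rule: infinite_finite_induct) (auto simp: fun_algebra)

lemma sc_sum_right: "sc c (\<Sum>i\<in>A. f i) = (\<Sum>i\<in>A. sc c (f i))"
  by (simp add: fun_algebra sum_fun_apply sum_distrib_left)

lemma sc_sum_left: "sc (\<Sum>i\<in>A. f i) x = (\<Sum>i\<in>A. sc (f i) x)"
  by (simp add: fun_algebra sum_fun_apply sum_distrib_right)

text \<open>One indicator function in three roles: basis product of an index set, unit coordinate
  vector (or dual functional) of a number, and generator of a free module.\<close>

definition bs :: "'z \<Rightarrow> 'z \<Rightarrow> 'a::comm_ring_1"
  where "bs I = (\<lambda>K. if K = I then 1 else 0)"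

text \<open>The sign that arises when f_i moves past the factors of smaller index to its place in
  the increasing product.\<close>

definition sg :: "nat \<Rightarrow> nat set \<Rightarrow> 'a::comm_ring_1"
  where "sg i I = (- 1) ^ card {j \<in> I. j < i}"

definition creation :: "nat \<Rightarrow> (nat set \<Rightarrow> 'a::comm_ring_1) \<Rightarrow> nat set \<Rightarrow> 'a"
  where "creation i x = (\<lambda>I. if i \<in> I then sg i I * x (I - {i}) else 0)"

definition annih :: "nat \<Rightarrow> (nat set \<Rightarrow> 'a::comm_ring_1) \<Rightarrow> nat set \<Rightarrow> 'a"
  where "annih i x = (\<lambda>I. if i \<in> I then 0 else sg i I * x (insert i I))"

lemma sg_insert:
  assumes "j \<notin> I"
  shows "sg i (insert j I) = (if j < i then - sg i I else sg i I)"
proof -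
  have "{l \<in> insert j I. l < i} = (if j < i then insert j {l \<in> I. l < i} else {l \<in> I. l < i})"
    by auto
  then show ?thesis using assms by (simp add: sg_def)
qed

lemma sg_remove:
  fixes i :: nat
  assumes "j \<in> I"
  shows "sg i (I - {j}) = (if j < i then - sg i I else sg i I :: 'a::comm_ring_1)"
  using sg_insert[of j "I - {j}" i, where ?'a = 'a] assms by (simp add: insert_absorb)

lemma sg_square [simp]:
  fixes c :: "'a::comm_ring_1"
  shows "sg i I * sg i I = (1 :: 'a)" "sg i I * (sg i I * c) = c"
proof -
  show "sg i I * sg i I = (1 :: 'a)"
    by (simp add: sg_def flip: power_add)
  then show "sg i I * (sg i I * c) = c" by (simp only: mult.assoc[symmetric] mult_1_left)
qed

lemma sg_cases: "sg i I = 1 \<or> sg i I = - 1"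
  by (simp add: sg_def minus_one_power_iff)

lemma creation_linear [simp]: "creation i (x + y) = creation i x + creation i y" "creation i (x - y) = creation i x - creation i y"
  "creation i (sc c x) = sc c (creation i x)" "creation i 0 = 0" "creation i (- x) = - creation i x"
  by (auto simp: creation_def fun_algebra algebra_simps)

lemma annih_linear [simp]: "annih i (x + y) = annih i x + annih i y" "annih i (x - y) = annih i x - annih i y"
  "annih i (sc c x) = sc c (annih i x)" "annih i 0 = 0" "annih i (- x) = - annih i x"
  by (auto simp: annih_def fun_algebra algebra_simps)

lemma creation_sum: "creation i (\<Sum>j\<in>A. f j) = (\<Sum>j\<in>A. creation i (f j))"
  by (induction A rule: infinite_finite_induct) simp_all

lemma annih_sum: "annih i (\<Sum>j\<in>A. f j) = (\<Sum>j\<in>A. annih i (f j))"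
  by (induction A rule: infinite_finite_induct) simp_all

lemma creation_creation_same [simp]: "creation i (creation i x) = 0"
  by (auto simp: creation_def fun_algebra)

lemma annih_annih_same [simp]: "annih i (annih i x) = 0"
  by (auto simp: annih_def fun_algebra)

lemma creation_anticomm: "creation i (creation j x) = - creation j (creation i x)"
proof (cases "i = j")
  case False
  have "I - {i} - {j} = I - {j} - {i}" for I :: "nat set" by auto
  then show ?thesis using False
    by (auto simp: creation_def fun_algebra sg_remove)
qed simp

lemma annih_anticomm: "annih i (annih j x) = - annih j (annih i x)"
proof (cases "i = j")
  case False
  then show ?thesis
    by (auto simp: annih_def fun_algebra sg_insert insert_commute)
qed simp

text \<open>Together with the two preceding lemmas, these are the canonical anticommutation
  relations. For distinct indices, inserting or removing one of them changes only the sign attached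
  to the larger one, whence the minus.\<close>

lemma annih_creation: "annih i (creation j x) = (if i = j then x else 0) - creation j (annih i x)"
proof (cases "i = j")
  case True
  then show ?thesis
    by (auto simp: annih_def creation_def fun_algebra sg_insert sg_remove insert_absorb)
next
  case False
  have "insert i I - {j} = insert i (I - {j})" for I using False by auto
  then show ?thesis using False
    by (auto simp: annih_def creation_def fun_algebra sg_insert sg_remove)
qed

lemma creation_bs: "creation i (bs I) = (if i \<in> I then 0 else sc (sg i I) (bs (insert i I)))"
  by (auto simp: creation_def bs_def fun_algebra sg_insert)

lemma annih_bs: "annih i (bs I) = (if i \<in> I then sc (sg i I) (bs (I - {i})) else 0)"
  by (auto simp: annih_def bs_def fun_algebra sg_remove)

section \<open>Multiplication by vectors and contraction with functionals\<close>

definition ext_mult :: "nat \<Rightarrow> (nat \<Rightarrow> 'a::comm_ring_1) \<Rightarrow> (nat set \<Rightarrow> 'a) \<Rightarrow> nat set \<Rightarrow> 'a"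
  where "ext_mult d v x = (\<Sum>i<d. sc (v i) (creation i x))"

definition contract :: "nat \<Rightarrow> (nat \<Rightarrow> 'a::comm_ring_1) \<Rightarrow> (nat set \<Rightarrow> 'a) \<Rightarrow> nat set \<Rightarrow> 'a"
  where "contract d \<phi> x = (\<Sum>i<d. sc (\<phi> i) (annih i x))"

definition dot :: "nat \<Rightarrow> (nat \<Rightarrow> 'a::comm_ring_1) \<Rightarrow> (nat \<Rightarrow> 'a) \<Rightarrow> 'a"
  where "dot d \<phi> v = (\<Sum>i<d. \<phi> i * v i)"

lemma ext_mult_linear_right [simp]:
  "ext_mult d v (x + y) = ext_mult d v x + ext_mult d v y" "ext_mult d v (x - y) = ext_mult d v x - ext_mult d v y"
  "ext_mult d v (sc c x) = sc c (ext_mult d v x)" "ext_mult d v 0 = 0" "ext_mult d v (- x) = - ext_mult d v x"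
  by (simp_all add: ext_mult_def sc_add_right sc_diff_right sum.distrib sum_subtractf sc_sum_right
      mult.commute sum_negf)

lemma contract_linear_right [simp]:
  "contract d v (x + y) = contract d v x + contract d v y" "contract d v (x - y) = contract d v x - contract d v y"
  "contract d v (sc c x) = sc c (contract d v x)" "contract d v 0 = 0" "contract d v (- x) = - contract d v x"
  by (simp_all add: contract_def sc_add_right sc_diff_right sum.distrib sum_subtractf sc_sum_right
      mult.commute sum_negf)

lemma ext_mult_linear_left:
  "ext_mult d (v + w) x = ext_mult d v x + ext_mult d w x" "ext_mult d (v - w) x = ext_mult d v x - ext_mult d w x"
  "ext_mult d (sc c v) x = sc c (ext_mult d v x)"
  by (simp_all add: ext_mult_def sc_add_left sc_diff_left sum.distrib sum_subtractf sc_sum_right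
      plus_fun_apply minus_apply sc_apply)

lemma contract_linear_left:
  "contract d (v + w) x = contract d v x + contract d w x" "contract d (v - w) x = contract d v x - contract d w x"
  "contract d (sc c v) x = sc c (contract d v x)"
  by (simp_all add: contract_def sc_add_left sc_diff_left sum.distrib sum_subtractf sc_sum_right
      plus_fun_apply minus_apply sc_apply)

lemma ext_mult_sum: "ext_mult d v (\<Sum>i\<in>A. f i) = (\<Sum>i\<in>A. ext_mult d v (f i))"
  by (induction A rule: infinite_finite_induct) simp_all

lemma creation_ext_mult: "creation i (ext_mult d v x) = - ext_mult d v (creation i x)"
proof -
  have "creation i (ext_mult d v x) = (\<Sum>j<d. sc (v j) (creation i (creation j x)))" by (simp add: ext_mult_def creation_sum)
  also have "\<dots> = (\<Sum>j<d. - sc (v j) (creation j (creation i x)))"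
    by (intro sum.cong refl) (subst creation_anticomm, simp)
  finally show ?thesis by (simp add: ext_mult_def sum_negf)
qed

lemma ext_mult_anticomm: "ext_mult d v (ext_mult e w x) = - ext_mult e w (ext_mult d v x)"
proof -
  have "ext_mult d v (ext_mult e w x) = (\<Sum>i<d. sc (v i) (- ext_mult e w (creation i x)))"
    unfolding ext_mult_def[of d] by (simp only: creation_ext_mult)
  also have "\<dots> = - (\<Sum>i<d. ext_mult e w (sc (v i) (creation i x)))"
    by (simp add: sum_negf)
  also have "(\<Sum>i<d. ext_mult e w (sc (v i) (creation i x))) = ext_mult e w (\<Sum>i<d. sc (v i) (creation i x))"
    by (induction d) simp_all
  finally show ?thesis by (simp add: ext_mult_def[of d])
qed

text \<open>Anticommutation alone gives only that twice this vector is 0, and the coefficient ring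
  is arbitrary. Induction on \<open>d\<close> reduces the claim to a single creation operator
  instead.\<close>

lemma ext_mult_ext_mult_same [simp]: "ext_mult d v (ext_mult d v x) = 0"
proof (induction d)
  case (Suc d)
  have S: "ext_mult (Suc d) v y = ext_mult d v y + sc (v d) (creation d y)" for y :: "nat set \<Rightarrow> 'a"
    by (simp add: ext_mult_def)
  show ?case by (simp add: S Suc creation_ext_mult)
qed (simp add: ext_mult_def)

lemma annih_contract: "annih i (contract d v x) = - contract d v (annih i x)"
proof -
  have "annih i (contract d v x) = (\<Sum>j<d. sc (v j) (annih i (annih j x)))" by (simp add: contract_def annih_sum)
  also have "\<dots> = (\<Sum>j<d. - sc (v j) (annih j (annih i x)))"
    by (intro sum.cong refl) (subst annih_anticomm, simp)
  finally show ?thesis by (simp add: contract_def sum_negf)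
qed

lemma contract_contract_same [simp]: "contract d v (contract d v x) = 0"
proof (induction d)
  case (Suc d)
  have S: "contract (Suc d) v y = contract d v y + sc (v d) (annih d y)" for y :: "nat set \<Rightarrow> 'a"
    by (simp add: contract_def)
  show ?case by (simp add: S Suc annih_contract)
qed (simp add: contract_def)

lemma contract_anticomm: "contract d v (contract e w x) = - contract e w (contract d v x)"
proof -
  have "contract d v (contract e w x) = (\<Sum>i<d. sc (v i) (- contract e w (annih i x)))"
    unfolding contract_def[of d] by (simp only: annih_contract)
  also have "\<dots> = - (\<Sum>i<d. contract e w (sc (v i) (annih i x)))"
    by (simp add: sum_negf)
  also have "(\<Sum>i<d. contract e w (sc (v i) (annih i x))) = contract e w (\<Sum>i<d. sc (v i) (annih i x))"
    by (induction d) simp_all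
  finally show ?thesis by (simp add: contract_def[of d])
qed

lemma annih_ext_mult:
  assumes "i < d"
  shows "annih i (ext_mult d v x) = sc (v i) x - ext_mult d v (annih i x)"
proof -
  have "annih i (ext_mult d v x) = (\<Sum>j<d. sc (v j) ((if i = j then x else 0) - creation j (annih i x)))"
    unfolding ext_mult_def by (simp only: annih_sum annih_linear annih_creation)
  also have "\<dots> = (\<Sum>j<d. sc (v j) (if i = j then x else 0)) - ext_mult d v (annih i x)"
    by (simp add: ext_mult_def sc_diff_right sum_subtractf)
  also have "(\<Sum>j<d. sc (v j) (if i = j then x else 0)) = (\<Sum>j<d. if i = j then sc (v j) x else 0)"
    by (intro sum.cong) auto
  also have "\<dots> = sc (v i) x" using assms by simp
  finally show ?thesis .
qed

text \<open>Contraction is an antiderivation of the exterior algebra. The later identities between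
  reflection operators result from moving contractions to the right by this rule.\<close>

lemma contract_ext_mult: "contract d \<phi> (ext_mult d v x) = sc (dot d \<phi> v) x - ext_mult d v (contract d \<phi> x)"
proof -
  have "contract d \<phi> (ext_mult d v x) = (\<Sum>i<d. sc (\<phi> i) (sc (v i) x - ext_mult d v (annih i x)))"
    unfolding contract_def by (intro sum.cong refl) (simp add: annih_ext_mult)
  also have "\<dots> = sc (dot d \<phi> v) x - (\<Sum>i<d. ext_mult d v (sc (\<phi> i) (annih i x)))"
    by (simp add: sc_diff_right sum_subtractf dot_def sc_sum_left)
  also have "(\<Sum>i<d. ext_mult d v (sc (\<phi> i) (annih i x))) = ext_mult d v (contract d \<phi> x)"
    unfolding contract_def by (rule ext_mult_sum[symmetric])
  finally show ?thesis .
qed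

lemma ext_mult_bs:
  assumes "i < d"
  shows "ext_mult d (bs i) x = creation i x"
proof -
  have "ext_mult d (bs i) x = (\<Sum>j<d. if j = i then creation j x else 0)"
    unfolding ext_mult_def by (intro sum.cong) (auto simp: bs_def)
  then show ?thesis using assms by simp
qed

lemma contract_bs:
  assumes "i < d"
  shows "contract d (bs i) x = annih i x"
proof -
  have "contract d (bs i) x = (\<Sum>j<d. if j = i then annih j x else 0)"
    unfolding contract_def by (intro sum.cong) (auto simp: bs_def)
  then show ?thesis using assms by simp
qed

section \<open>Homogeneous components and decomposable products\<close>

definition W :: "nat \<Rightarrow> nat \<Rightarrow> (nat set \<Rightarrow> 'a::comm_ring_1) set"
  where "W d k = {x. \<forall>I. x I \<noteq> 0 \<longrightarrow> I \<subseteq> {..<d} \<and> card I = k}"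

lemma W_D: "x \<in> W d k \<Longrightarrow> x I \<noteq> 0 \<Longrightarrow> I \<subseteq> {..<d} \<and> card I = k"
  by (simp add: W_def)

lemma W_zero [simp]: "0 \<in> W d k"
  by (simp add: W_def zero_fun_apply)

lemma W_add:
  assumes "x \<in> W d k" "y \<in> W d k"
  shows "x + y \<in> W d k"
  unfolding W_def
proof (intro CollectI allI impI)
  fix I assume "(x + y) I \<noteq> 0"
  then have "x I \<noteq> 0 \<or> y I \<noteq> 0" by (auto simp: plus_fun_apply)
  then show "I \<subseteq> {..<d} \<and> card I = k" using W_D[OF assms(1)] W_D[OF assms(2)] by blast
qed

lemma W_sc:
  assumes "x \<in> W d k"
  shows "sc c x \<in> W d k"
  unfolding W_def
proof (intro CollectI allI impI)
  fix I assume "sc c x I \<noteq> 0"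
  then have "x I \<noteq> 0" by (auto simp: sc_apply)
  then show "I \<subseteq> {..<d} \<and> card I = k" using W_D[OF assms] by blast
qed

lemma W_sum: "(\<And>i. i \<in> A \<Longrightarrow> f i \<in> W d k) \<Longrightarrow> (\<Sum>i\<in>A. f i) \<in> W d k"
  by (induction A rule: infinite_finite_induct) (auto intro: W_add)

lemma W_creation:
  assumes "x \<in> W d k" "i < d"
  shows "creation i x \<in> W d (Suc k)"
  unfolding W_def
proof (intro CollectI allI impI)
  fix I assume "creation i x I \<noteq> 0"
  then have i: "i \<in> I" and "x (I - {i}) \<noteq> 0" by (auto simp: creation_def split: if_splits)
  then have I: "I - {i} \<subseteq> {..<d}" "card (I - {i}) = k" using W_D[OF assms(1)] by blast+
  then have "finite I" using finite_subset by fastforce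
  then show "I \<subseteq> {..<d} \<and> card I = Suc k"
    using I i assms(2) card_Suc_Diff1[of I i] by auto
qed

lemma W_ext_mult: "x \<in> W d k \<Longrightarrow> ext_mult d v x \<in> W d (Suc k)"
  unfolding ext_mult_def by (intro W_sum W_sc W_creation) auto

lemma bs_in_W: "I \<subseteq> {..<d} \<Longrightarrow> card I = k \<Longrightarrow> bs I \<in> W d k"
  by (simp add: W_def bs_def)

definition wedge :: "nat \<Rightarrow> (nat \<Rightarrow> 'a::comm_ring_1) list \<Rightarrow> nat set \<Rightarrow> 'a"
  where "wedge d vs = foldr (ext_mult d) vs (bs {})"

lemma wedge_simps [simp]: "wedge d [] = bs {}" "wedge d (v # vs) = ext_mult d v (wedge d vs)"
  by (simp_all add: wedge_def)

lemma wedge_in_W: "wedge d vs \<in> W d (length vs)"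
  by (induction vs) (auto intro: bs_in_W W_ext_mult)

lemma wedge_add:
  "i < length vs \<Longrightarrow> wedge d (vs[i := v + w]) = wedge d (vs[i := v]) + wedge d (vs[i := w])"
  by (induction vs arbitrary: i) (auto simp: ext_mult_linear_left split: nat.split)

lemma wedge_sc: "i < length vs \<Longrightarrow> wedge d (vs[i := sc c v]) = sc c (wedge d (vs[i := v]))"
  by (induction vs arbitrary: i) (auto simp: ext_mult_linear_left split: nat.split)

text \<open>The left copy of a repeated vector is moved, factor by factor, next to the right copy,
  where \<open>ext_mult_ext_mult_same\<close> applies.\<close>

lemma wedge_eq_0:
  assumes "\<not> distinct vs"
  shows "wedge d vs = 0"
proof -
  have *: "ext_mult d v (wedge d (ys @ v # zs)) = 0" for v :: "nat \<Rightarrow> 'a" and ys zs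
  proof (induction ys)
    case (Cons y ys)
    then show ?case using ext_mult_anticomm[of d v d y] by simp
  qed simp
  have "wedge d (xs @ ys) = 0" if "wedge d ys = 0" for xs ys :: "(nat \<Rightarrow> 'a) list"
    using that by (induction xs) simp_all
  moreover obtain xs ys zs v where "vs = xs @ [v] @ ys @ [v] @ zs"
    using assms not_distinct_decomp by blast
  ultimately show ?thesis using * by simp
qed

lemma wedge_bs:
  assumes "sorted_wrt (<) is" "set is \<subseteq> {..<d}"
  shows "wedge d (map bs is) = bs (set is)"
  using assms
proof (induction "is")
  case (Cons i "is")
  have "i \<notin> set is" using Cons.prems by auto
  moreover have e: "{j \<in> set is. j < i} = {}" using Cons.prems by auto
  have "sg i (set is) = (1 :: 'a)" unfolding sg_def e by simp
  ultimately show ?case using Cons by (simp add: ext_mult_bs creation_bs)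
qed simp

text \<open>No terms of higher order appear because two factors \<alpha> wedge to zero. So a
  reflection acts by the same formula in every degree.\<close>

lemma wedge_reflection:
  "wedge d (map (\<lambda>v. v - sc (dot d \<phi> v) \<alpha>) vs) = wedge d vs - ext_mult d \<alpha> (contract d \<phi> (wedge d vs))"
proof (induction vs)
  case Nil
  have "annih i (bs {}) = (0 :: nat set \<Rightarrow> 'a)" for i by (simp add: annih_bs)
  then have "contract d \<phi> (bs {}) = 0" by (simp add: contract_def)
  then show ?case by simp
next
  case (Cons v vs)
  have "ext_mult d v (ext_mult d \<alpha> x) = - ext_mult d \<alpha> (ext_mult d v x)" for x by (rule ext_mult_anticomm)
  then show ?case using Cons
    by (simp add: ext_mult_linear_left contract_ext_mult sc_diff_right)
qed

text \<open>The coordinates of a wedge product are polynomials with integer coefficients in the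
  entries of the vectors. This is used for \<open>Zp_to_Qp\<close>.\<close>

lemma wedge_hom:
  assumes h: "h 0 = 0" "h 1 = 1" "\<And>a b. h (a + b) = h a + h b" "\<And>a b. h (a * b) = h a * h b"
    "\<And>a. h (- a) = - h a"
  shows "(\<lambda>I. h (wedge d vs I)) = wedge d (map (\<lambda>v i. h (v i)) vs)"
proof (induction vs)
  case Nil
  show ?case by (auto simp: bs_def h)
next
  case (Cons v vs)
  have hs: "h (sg i I) = sg i I" for i I using sg_cases[of i I, where ?'a = 'b]
    by (simp add: sg_def minus_one_power_iff h)
  have s: "h (\<Sum>i\<in>A. f i) = (\<Sum>i\<in>A. h (f i))" for f and A :: "nat set"
    by (induction A rule: infinite_finite_induct) (auto simp: h)
  have "(\<lambda>I. h (ext_mult d v x I)) = ext_mult d (\<lambda>i. h (v i)) (\<lambda>I. h (x I))" for x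
    by (auto simp: ext_mult_def sum_fun_apply s h hs creation_def fun_algebra intro!: sum.cong)
  then show ?case using Cons by simp
qed

text \<open>The map that the diagonal matrix with entries \<open>l\<close> induces on the exterior
  algebra, as \<open>wedge_dilate\<close> confirms.\<close>

definition dilate :: "(nat \<Rightarrow> 'a::comm_ring_1) \<Rightarrow> (nat set \<Rightarrow> 'a) \<Rightarrow> nat set \<Rightarrow> 'a"
  where "dilate l x = (\<lambda>I. (\<Prod>i\<in>I. l i) * x I)"

lemma wedge_dilate: "wedge d (map (\<lambda>v i. l i * v i) vs) = dilate l (wedge d vs)"
proof (induction vs)
  case Nil
  show ?case by (auto simp: bs_def dilate_def)
next
  case (Cons v vs)
  have "ext_mult d (\<lambda>i. l i * v i) (dilate l x) I = dilate l (ext_mult d v x) I" if x: "x \<in> W d k" for x k I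
  proof (cases "finite I")
    case True
    then show ?thesis
      by (auto simp: ext_mult_def sum_fun_apply sc_apply dilate_def creation_def sum_distrib_left prod.remove ac_simps intro!: sum.cong)
  next
    \<comment> \<open>The product over an infinite set is 1 by convention, but both vectors vanish
      there since their support consists of finite sets.\<close>
    case False
    have z: "y I = 0" if "y \<in> W d m" for y :: "nat set \<Rightarrow> 'a" and m
      using W_D[OF that, of I] False finite_subset by blast
    have "x K \<noteq> 0" if "dilate l x K \<noteq> 0" for K using that by (auto simp: dilate_def)
    then have "dilate l x \<in> W d k" using W_D[OF x] unfolding W_def by blast
    then have "ext_mult d (\<lambda>i. l i * v i) (dilate l x) I = 0" "ext_mult d v x I = 0" using z[OF W_ext_mult] x by blast+
    then show ?thesis by (simp add: dilate_def)
  qed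
  then have "ext_mult d (\<lambda>i. l i * v i) (dilate l (wedge d vs)) = dilate l (ext_mult d v (wedge d vs))"
    using wedge_in_W by blast
  then show ?case using Cons by simp
qed

lemma W_expand:
  assumes "x \<in> W d k"
  shows "x = (\<Sum>I\<in>{I. I \<subseteq> {..<d} \<and> card I = k}. sc (x I) (bs I))"
proof
  fix K
  have "(\<Sum>I\<in>{I. I \<subseteq> {..<d} \<and> card I = k}. sc (x I) (bs I) K) =
      (\<Sum>I\<in>{I. I \<subseteq> {..<d} \<and> card I = k}. if I = K then x K else 0)"
    by (intro sum.cong) (auto simp: bs_def sc_apply)
  also have "\<dots> = x K"
    using W_D[OF assms, of K] by (subst sum.delta) auto
  finally show "x K = (\<Sum>I\<in>{I. I \<subseteq> {..<d} \<and> card I = k}. sc (x I) (bs I)) K"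
    by (simp add: sum_fun_apply)
qed

section \<open>Reflections and the operators they generate\<close>

text \<open>Here $n = d + 1$, with the basis $f_0, \dots, f_{d-1}$ from above: \<open>cv d a\<close> holds the
  coordinates of $e_a - e_n$, and \<open>lf d a\<close> the coefficients of the functional \<open>v \<mapsto> v a\<close>.
  In these terms the transposition of \<open>a\<close> and \<open>b\<close> acts on the Fock space as
  \<open>x \<mapsto> x - Q d (rvec d a b) (rform d a b) x\<close>.\<close>

definition cv :: "nat \<Rightarrow> nat \<Rightarrow> nat \<Rightarrow> 'a::comm_ring_1"
  where "cv d a = (\<lambda>i. if a = Suc d then 0
    else if a = d then (if i = 0 then 1 else if i < d then - 1 else 0)
    else if i = a then 1 else 0)"

definition lf :: "nat \<Rightarrow> nat \<Rightarrow> nat \<Rightarrow> 'a::comm_ring_1"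
  where "lf d a = (\<lambda>i. if a = Suc d then (if i = 0 then - of_nat d else if i < d then - 1 else 0)
    else if a = d then (if i = 0 then 1 else 0)
    else if i = 0 \<or> i = a then 1 else 0)"

text \<open>With n = d + 1, the right-hand side is the a-th entry of e_b - e_n. Only b = d needs a
  genuine sum, because e_d - e_n = f_0 - f_1 - ... - f_(d-1) involves all basis vectors.\<close>

lemma dot_lf_cv:
  assumes d: "d \<ge> 2" and ab: "a \<in> {1..Suc d}" "b \<in> {1..Suc d}"
  shows "dot d (lf d a) (cv d b) =
    ((if a = b then 1 else 0) - (if a = Suc d then 1 else 0) :: 'a::comm_ring_1)"
proof -
  consider "b = Suc d" | "b = d" | "1 \<le> b" "b < d" using ab by force
  then show ?thesis
  proof cases
    case 1
    then show ?thesis by (simp add: dot_def cv_def zero_fun_apply)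
  next
    case 3
    then have "dot d (lf d a) (cv d b) = (\<Sum>i<d. if i = b then lf d a b else 0 :: 'a)"
      unfolding dot_def by (intro sum.cong) (auto simp: cv_def)
    then show ?thesis using 3 d ab by (auto simp: lf_def)
  next
    case 2
    have e: "{..<d} = insert 0 {1..<d}" using d by auto
    have "dot d (lf d a) (cv d b) = (lf d a 0 :: 'a) + (\<Sum>i\<in>{1..<d}. - lf d a i)"
      unfolding dot_def e using 2 d by (auto simp: cv_def intro!: sum.cong)
    also have "(\<Sum>i\<in>{1..<d}. - lf d a i :: 'a) =
        (if a = Suc d then of_nat (d - 1) else if a = d then 0 else - 1)"
    proof -
      consider "a = Suc d" | "a = d" | "1 \<le> a" "a < d" using ab by force
      then show ?thesis
      proof cases
        case 1
        then have "(\<Sum>i\<in>{1..<d}. - lf d a i :: 'a) = (\<Sum>i\<in>{1..<d}. 1)"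
          by (intro sum.cong) (auto simp: lf_def)
        then show ?thesis using 1 by simp
      next
        case 2
        then have "(\<Sum>i\<in>{1..<d}. - lf d a i :: 'a) = (\<Sum>i\<in>{1..<d}. 0)"
          by (intro sum.cong) (auto simp: lf_def)
        then show ?thesis using 2 by simp
      next
        case 3
        then have "(\<Sum>i\<in>{1..<d}. - lf d a i :: 'a) = (\<Sum>i\<in>{1..<d}. if i = a then - 1 else 0)"
          by (intro sum.cong) (auto simp: lf_def)
        then show ?thesis using 3 by auto
      qed
    qed
    also have "(lf d a 0 :: 'a) + \<dots> = (if a = b then 1 else 0) - (if a = Suc d then 1 else 0)"
      using 2 d ab by (auto simp: lf_def of_nat_diff)
    finally show ?thesis .
  qed
qed

definition rvec :: "nat \<Rightarrow> nat \<Rightarrow> nat \<Rightarrow> nat \<Rightarrow> 'a::comm_ring_1"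
  where "rvec d a b = cv d a - cv d b"

definition rform :: "nat \<Rightarrow> nat \<Rightarrow> nat \<Rightarrow> nat \<Rightarrow> 'a::comm_ring_1"
  where "rform d a b = lf d a - lf d b"

lemma dot_diff: "dot d \<phi> (v - w) = dot d \<phi> v - dot d \<phi> w" "dot d (\<phi> - \<psi>) v = dot d \<phi> v - dot d \<psi> v"
  by (simp_all add: dot_def minus_apply algebra_simps sum_subtractf)

text \<open>These are the inner products of roots of type A: 2 for equal roots, 1 or -1 for roots
  sharing one index, 0 for disjoint ones. The three values drive the case distinction in
  \<open>ops_roots\<close>.\<close>

lemma dot_rform_rvec:
  assumes "d \<ge> 2" "a \<in> {1..Suc d}" "b \<in> {1..Suc d}" "c \<in> {1..Suc d}" "e \<in> {1..Suc d}"
  shows "dot d (rform d a b) (rvec d c e) =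
    ((if a = c then 1 else 0) - (if a = e then 1 else 0) - (if b = c then 1 else 0)
      + (if b = e then 1 else 0) :: 'a::comm_ring_1)"
  unfolding rform_def rvec_def dot_diff dot_lf_cv[OF assms(1,2,4)] dot_lf_cv[OF assms(1,2,5)]
    dot_lf_cv[OF assms(1,3,4)] dot_lf_cv[OF assms(1,3,5)]
  by simp

lemma ext_mult_zero_left: "ext_mult d 0 x = 0" and contract_zero_left: "contract d 0 x = 0"
  by (simp_all add: ext_mult_def contract_def zero_fun_apply)

text \<open>The derivation of the exterior algebra that extends the map v \<mapsto> \<phi>(v)
  \<alpha> of rank one.\<close>

definition Q :: "nat \<Rightarrow> (nat \<Rightarrow> 'a::comm_ring_1) \<Rightarrow> (nat \<Rightarrow> 'a) \<Rightarrow> (nat set \<Rightarrow> 'a) \<Rightarrow> nat set \<Rightarrow> 'a"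
  where "Q d \<alpha> \<phi> = (\<lambda>x. ext_mult d \<alpha> (contract d \<phi> x))"

inductive_set ops :: "nat \<Rightarrow> ((nat set \<Rightarrow> 'p::prime_card padic_int fract) \<Rightarrow> nat set \<Rightarrow> 'p padic_int fract) set"
  for d :: nat where
  ops_reflection: "a \<in> {1..Suc d} \<Longrightarrow> b \<in> {1..Suc d} \<Longrightarrow> a \<noteq> b \<Longrightarrow> Q d (rvec d a b) (rform d a b) \<in> ops d"
| ops_id: "(\<lambda>x. x) \<in> ops d"
| ops_comp: "A \<in> ops d \<Longrightarrow> B \<in> ops d \<Longrightarrow> (\<lambda>x. A (B x)) \<in> ops d"
| ops_add: "A \<in> ops d \<Longrightarrow> B \<in> ops d \<Longrightarrow> (\<lambda>x. A x + B x) \<in> ops d"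
| ops_sc: "A \<in> ops d \<Longrightarrow> (\<lambda>x. sc (Zp_to_Qp r) (A x)) \<in> ops d"

lemma ops_neg: "A \<in> ops d \<Longrightarrow> (\<lambda>x. - A x) \<in> ops d"
  using ops_sc[of A d "- 1"] by simp

lemma ops_diff: "A \<in> ops d \<Longrightarrow> B \<in> ops d \<Longrightarrow> (\<lambda>x. A x - B x) \<in> ops d"
  using ops_add[OF _ ops_neg] by fastforce

lemma ops_half:
  assumes "(2 :: 'p::prime_card padic_int) dvd 1" and "(\<lambda>x. sc 2 (A x :: nat set \<Rightarrow> 'p padic_int fract)) \<in> ops d"
  shows "A \<in> ops d"
proof -
  obtain h :: "'p padic_int" where h: "1 = 2 * h" using assms(1) by (auto elim: dvdE)
  have "Zp_to_Qp (2 :: 'p padic_int) = 2" using Zp_to_Qp_of_nat[of 2, where 'a = 'p] by simp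
  then have "Zp_to_Qp h * 2 = 1" using h by (metis Zp_to_Qp_simps(2,4) mult.commute)
  then have "(\<lambda>x. sc (Zp_to_Qp h) (sc 2 (A x))) = A" by simp
  then show ?thesis using ops_sc[OF assms(2), of h] by simp
qed

text \<open>Moving the contractions to the right leaves two terms, since \<alpha> \<and> \<alpha>
  and a repeated contraction with \<open>\<alpha>'\<close> vanish. The coefficient c * c collects
  the two mixed pairings; it is 1 for roots sharing one index.\<close>

lemma reflection_triple:
  assumes "dot d \<alpha>' \<alpha> = 2" "dot d \<alpha>' \<beta> = c" "dot d \<beta>' \<alpha> = c"
  shows "Q d \<alpha> \<alpha>' (Q d \<beta> \<beta>' (Q d \<alpha> \<alpha>' x)) =
    sc (c * c) (Q d \<alpha> \<alpha>' x) - sc 2 (ext_mult d \<alpha> (ext_mult d \<beta> (contract d \<alpha>' (contract d \<beta>' x))))"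
proof -
  define u where "u = contract d \<alpha>' x"
  have u: "contract d \<alpha>' u = 0" by (simp add: u_def)
  have u2: "contract d \<alpha>' (contract d \<beta>' u) = 0" using contract_anticomm[of d \<alpha>' d \<beta>' u] u by simp
  have u3: "contract d \<alpha>' (contract d \<beta>' x) = - contract d \<beta>' u" using contract_anticomm[of d \<alpha>' d \<beta>' x] by (simp add: u_def)
  show ?thesis
    unfolding Q_def u3
    by (simp add: contract_ext_mult assms u u2 sc_diff_right flip: u_def)
qed

text \<open>Writing $T_\alpha = \alpha \wedge \iota_\alpha$, the operator
  $2\,\alpha \wedge \beta \wedge \iota_\alpha \iota_\beta = T_\alpha - T_\alpha T_\beta T_\alpha$ can be
  halved, and its half corrects $T_\alpha T_\beta$ to a multiple of $\alpha \wedge \iota_\beta$.\<close>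

lemma ops_adjacent:
  fixes \<alpha> \<alpha>' \<beta> \<beta>' :: "nat \<Rightarrow> 'p::prime_card padic_int fract"
  assumes two: "(2 :: 'p padic_int) dvd 1"
    and ops: "Q d \<alpha> \<alpha>' \<in> ops d" "Q d \<beta> \<beta>' \<in> ops d"
    and dt: "dot d \<alpha>' \<alpha> = 2" "dot d \<alpha>' \<beta> = c" "dot d \<beta>' \<alpha> = c" and c: "c = 1 \<or> c = - 1"
  shows "Q d \<alpha> \<beta>' \<in> ops d"
proof -
  define P where "P x = ext_mult d \<alpha> (ext_mult d \<beta> (contract d \<alpha>' (contract d \<beta>' x)))" for x
  have cc: "c * c = 1" using c by auto
  have "(\<lambda>x. Q d \<alpha> \<alpha>' x - Q d \<alpha> \<alpha>' (Q d \<beta> \<beta>' (Q d \<alpha> \<alpha>' x))) \<in> ops d"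
    by (rule ops_diff[OF ops(1) ops_comp[OF ops(1) ops_comp[OF ops(2) ops(1)]]])
  then have "(\<lambda>x. sc 2 (P x)) \<in> ops d"
    by (simp add: reflection_triple[OF dt] cc P_def)
  then have P: "P \<in> ops d" by (rule ops_half[OF two])
  have "(\<lambda>x. Q d \<alpha> \<alpha>' (Q d \<beta> \<beta>' x) + P x) \<in> ops d"
    by (rule ops_add[OF ops_comp[OF ops] P])
  moreover have "Q d \<alpha> \<alpha>' (Q d \<beta> \<beta>' x) + P x = sc c (Q d \<alpha> \<beta>' x)" for x
    by (simp add: Q_def P_def contract_ext_mult dt)
  ultimately have *: "(\<lambda>x. sc c (Q d \<alpha> \<beta>' x)) \<in> ops d" by simp
  then show ?thesis using c ops_neg[OF *] by auto
qed

text \<open>The commutator of \<alpha> \<and> \<iota>_\<gamma> and \<gamma> \<and> \<iota>_\<beta>,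
  as for matrix units: the terms with two contractions agree and cancel, and the pairing of \<gamma>
  with itself leaves the factor 2.\<close>

lemma ops_disjoint:
  fixes \<alpha> \<beta>' \<gamma> \<gamma>' :: "nat \<Rightarrow> 'p::prime_card padic_int fract"
  assumes two: "(2 :: 'p padic_int) dvd 1"
    and ops: "Q d \<alpha> \<gamma>' \<in> ops d" "Q d \<gamma> \<beta>' \<in> ops d"
    and dt: "dot d \<gamma>' \<gamma> = 2" "dot d \<beta>' \<alpha> = 0"
  shows "Q d \<alpha> \<beta>' \<in> ops d"
proof -
  let ?d = d
  have "ext_mult ?d \<gamma> (ext_mult ?d \<alpha> (contract ?d \<beta>' (contract ?d \<gamma>' x))) = ext_mult ?d \<alpha> (ext_mult ?d \<gamma> (contract ?d \<gamma>' (contract ?d \<beta>' x)))" for x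
    by (subst ext_mult_anticomm, subst contract_anticomm) simp
  then have "Q ?d \<alpha> \<gamma>' (Q ?d \<gamma> \<beta>' x) - Q ?d \<gamma> \<beta>' (Q ?d \<alpha> \<gamma>' x) = sc 2 (Q ?d \<alpha> \<beta>' x)" for x
    by (simp add: Q_def contract_ext_mult dt)
  moreover have "(\<lambda>x. Q ?d \<alpha> \<gamma>' (Q ?d \<gamma> \<beta>' x) - Q ?d \<gamma> \<beta>' (Q ?d \<alpha> \<gamma>' x)) \<in> ops d"
    by (rule ops_diff[OF ops_comp[OF ops] ops_comp[OF ops(2,1)]])
  ultimately show ?thesis by (simp add: ops_half[OF two])
qed

section \<open>Elementary operators obtained from pairs of roots\<close>

context
  fixes d :: nat and ty :: "'p::prime_card itself"
  assumes d: "d \<ge> 2" and two: "(2 :: 'p padic_int) dvd 1"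
begin

lemma ops_adjacent_roots:
  assumes "a \<in> {1..Suc d}" "b \<in> {1..Suc d}" "c \<in> {1..Suc d}" "e \<in> {1..Suc d}" "a \<noteq> b" "c \<noteq> e"
    and "a = c \<or> a = e \<or> b = c \<or> b = e"
  shows "Q d (rvec d a b) (rform d c e :: nat \<Rightarrow> 'p padic_int fract) \<in> ops d"
proof -
  have R: "Q d (rvec d a b) (rform d a b :: nat \<Rightarrow> 'p padic_int fract) \<in> ops d"
    using assms by (intro ops_reflection) auto
  consider "a = c \<and> b = e" | "a = e \<and> b = c" | "\<not> (a = c \<and> b = e)" "\<not> (a = e \<and> b = c)" by blast
  then show ?thesis
  proof cases
    case 1
    then show ?thesis using R by simp
  next
    case 2
    then have "rform d c e = - (rform d a b :: nat \<Rightarrow> 'p padic_int fract)" by (simp add: rform_def)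
    then have "Q d (rvec d a b) (rform d c e :: nat \<Rightarrow> 'p padic_int fract) = (\<lambda>x. - Q d (rvec d a b) (rform d a b) x)"
      by (simp add: Q_def contract_def uminus_apply sum_negf)
    then show ?thesis using ops_neg[OF R] by simp
  next
    case 3
    show ?thesis
      by (rule ops_adjacent[OF two R, of "rvec d c e" _ "(if a = c then 1 else 0) - (if a = e then 1 else 0) - (if b = c then 1 else 0)
        + (if b = e then 1 else 0)"])
        (use d assms 3 in \<open>auto simp: dot_rform_rvec intro: ops_reflection\<close>)
  qed
qed

lemma ops_roots:
  assumes "a \<in> {1..Suc d}" "b \<in> {1..Suc d}" "c \<in> {1..Suc d}" "e \<in> {1..Suc d}" "a \<noteq> b" "c \<noteq> e"
  shows "Q d (rvec d a b) (rform d c e :: nat \<Rightarrow> 'p padic_int fract) \<in> ops d"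
proof (cases "a = c \<or> a = e \<or> b = c \<or> b = e")
  case False
  \<comment> \<open>The root e_a - e_c shares an index with each of the two disjoint roots and
    serves as the intermediate \<gamma>.\<close>
  show ?thesis
    by (rule ops_disjoint[OF two, of _ _ "rform d a c" "rvec d a c"])
      (use d assms False in \<open>auto simp: dot_rform_rvec intro: ops_adjacent_roots\<close>)
qed (use assms ops_adjacent_roots in blast)

lemma ops_sum:
  assumes "\<And>i. i \<in> I \<Longrightarrow> A i \<in> ops d"
  shows "(\<lambda>x. \<Sum>i\<in>I. A i x) \<in> ops d"
  using assms
proof (induction I rule: infinite_finite_induct)
  case (insert i I)
  then show ?case using ops_add[of "A i" d "\<lambda>x. \<Sum>i\<in>I. A i x"] by simp
qed (use ops_sc[OF ops_id, where r = 0] in simp_all)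

lemma rvec_unit: "i \<in> {1..<d} \<Longrightarrow> rvec d i (Suc d) = bs i"
  using d by (auto simp: rvec_def cv_def bs_def fun_algebra)

lemma rform_unit: "j \<in> {1..<d} \<Longrightarrow> rform d j d = bs j"
  using d by (auto simp: rform_def lf_def bs_def fun_algebra)

text \<open>Since f_0 is an integral sum of the roots e_a - e_n, it becomes available as a left
  factor at no cost.\<close>

lemma rvec_sum: "(\<Sum>a\<in>{1..d}. rvec d a (Suc d)) = (bs 0 :: nat \<Rightarrow> 'a::comm_ring_1)"
proof
  fix i
  have e: "{1..d} = insert d {1..<d}" using d by auto
  have "(\<Sum>a\<in>{1..d}. rvec d a (Suc d)) i = (rvec d d (Suc d) i + (\<Sum>a\<in>{1..<d}. if a = i then 1 else 0) :: 'a)"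
    unfolding e using d by (subst sum.insert) (auto simp: rvec_unit plus_fun_apply sum_fun_apply bs_def intro!: sum.cong)
  then show "(\<Sum>a\<in>{1..d}. rvec d a (Suc d)) i = (bs 0 i :: 'a)"
    using d by (auto simp: rvec_def cv_def bs_def fun_algebra)
qed

text \<open>On vectors v with entry sum zero, v_d - v_n minus the sum of the v_j - v_d is n v_d, and
  v_d is the coefficient of f_0. This is the origin of the factor n in front of f_i \<and>
  \<iota>_0.\<close>

lemma rform_sum: "rform d d (Suc d) - (\<Sum>j\<in>{1..<d}. rform d j d) = sc (of_nat (Suc d)) (bs 0 :: nat \<Rightarrow> 'a::comm_ring_1)"
proof
  fix i
  have "(\<Sum>j\<in>{1..<d}. rform d j d) i = (\<Sum>a\<in>{1..<d}. if a = i then 1 else 0 :: 'a)"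
    using d by (auto simp: rform_unit sum_fun_apply bs_def intro!: sum.cong)
  then show "(rform d d (Suc d) - (\<Sum>j\<in>{1..<d}. rform d j d)) i = sc (of_nat (Suc d)) (bs 0 :: nat \<Rightarrow> 'a) i"
    using d by (auto simp: rform_def lf_def bs_def fun_algebra of_nat_diff)
qed

lemma ops_creation0_rform:
  assumes "c \<in> {1..Suc d}" "e \<in> {1..Suc d}" "c \<noteq> e"
  shows "Q d (bs 0) (rform d c e :: nat \<Rightarrow> 'p padic_int fract) \<in> ops d"
proof -
  have "(\<lambda>x. \<Sum>a\<in>{1..d}. Q d (rvec d a (Suc d)) (rform d c e :: nat \<Rightarrow> 'p padic_int fract) x) \<in> ops d"
    using d assms by (intro ops_sum ops_roots) auto
  moreover have "(\<Sum>a\<in>A. Q d (r a) \<phi> x) = Q d (\<Sum>a\<in>A. r a) \<phi> x"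
    for A :: "nat set" and r and \<phi> :: "nat \<Rightarrow> 'p padic_int fract" and x
    by (induction A rule: infinite_finite_induct) (simp_all add: Q_def ext_mult_linear_left ext_mult_zero_left)
  ultimately show ?thesis by (simp only: rvec_sum)
qed

lemma ops_creation_annih: "i \<in> {1..<d} \<Longrightarrow> j \<in> {1..<d} \<Longrightarrow>
    (\<lambda>x. creation i (annih j x) :: nat set \<Rightarrow> 'p padic_int fract) \<in> ops d"
  using ops_roots[of i "Suc d" j d] d by (simp add: rvec_unit rform_unit Q_def ext_mult_bs contract_bs)

lemma ops_creation0_annih: "j \<in> {1..<d} \<Longrightarrow> (\<lambda>x. creation 0 (annih j x) :: nat set \<Rightarrow> 'p padic_int fract) \<in> ops d"
  using ops_creation0_rform[of j d] d by (simp add: rform_unit Q_def ext_mult_bs contract_bs)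

lemma ops_creation_annih0:
  assumes i: "i \<in> {1..<d}"
  shows "(\<lambda>x. sc (of_nat (Suc d)) (creation i (annih 0 x)) :: nat set \<Rightarrow> 'p padic_int fract) \<in> ops d"
proof -
  have "(\<lambda>x. Q d (bs i) (rform d d (Suc d)) x - (\<Sum>j\<in>{1..<d}. Q d (bs i) (rform d j d :: nat \<Rightarrow> 'p padic_int fract) x)) \<in> ops d"
    using d i by (intro ops_diff[OF _ ops_sum]) (auto simp: rvec_unit[symmetric] intro!: ops_roots)
  moreover have "(\<Sum>j\<in>A. Q d v (f j) x) = Q d v (\<Sum>j\<in>A. f j) x"
    for A :: "nat set" and f and v :: "nat \<Rightarrow> 'p padic_int fract" and x
    by (induction A rule: infinite_finite_induct) (simp_all add: Q_def contract_linear_left contract_zero_left)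
  moreover have "Q d v f x - Q d v g x = Q d v (f - g) x"
    for f g v :: "nat \<Rightarrow> 'p padic_int fract" and x by (simp add: Q_def contract_linear_left)
  ultimately have "Q d (bs i) (rform d d (Suc d) - (\<Sum>j\<in>{1..<d}. rform d j d :: nat \<Rightarrow> 'p padic_int fract)) \<in> ops d"
    by simp
  then show ?thesis unfolding rform_sum using d i by (simp add: Q_def contract_linear_left ext_mult_bs contract_bs)
qed

text \<open>Since f_i \<and> \<iota>_i is the projection onto the products containing f_i,
  compositions of these and of their complements prescribe which indices occur. Index 0 is excluded
  because f_0 \<and> \<iota>_0 is not among the operators obtained so far.\<close>

lemma ops_select:
  assumes "finite A" "finite B" "A \<subseteq> {1..<d}" "B \<subseteq> {1..<d}"
  shows "(\<lambda>x K. if A \<subseteq> K \<and> B \<inter> K = {} then x K else 0 :: 'p padic_int fract) \<in> ops d"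
proof -
  have num: "creation i (annih i x) = (\<lambda>K. if i \<in> K then x K else 0)" for i and x :: "nat set \<Rightarrow> 'p padic_int fract"
    by (auto simp: creation_def annih_def sg_remove insert_absorb fun_eq_iff)
  have 1: "(\<lambda>x K. if A \<subseteq> K then x K else 0 :: 'p padic_int fract) \<in> ops d"
    using assms(1,3)
  proof (induction A rule: finite_induct)
    case empty
    show ?case by (simp add: ops_id)
  next
    case (insert i A)
    then have "(\<lambda>x. creation i (annih i (\<lambda>K. if A \<subseteq> K then x K else 0 :: 'p padic_int fract))) \<in> ops d"
      using ops_comp[OF ops_creation_annih[of i i] insert.IH] by simp
    moreover have "(\<lambda>x. creation i (annih i (\<lambda>K. if A \<subseteq> K then x K else 0 :: 'p padic_int fract))) =
        (\<lambda>x K. if insert i A \<subseteq> K then x K else 0)"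
      by (auto simp: num fun_eq_iff)
    ultimately show ?case by simp
  qed
  show ?thesis
    using assms(2,4)
  proof (induction B rule: finite_induct)
    case empty
    show ?case using 1 by simp
  next
    case (insert i B)
    let ?F = "\<lambda>x K. if A \<subseteq> K \<and> B \<inter> K = {} then x K else 0 :: 'p padic_int fract"
    have "(\<lambda>x. ?F x - creation i (annih i (?F x))) \<in> ops d"
      using ops_diff[OF insert.IH ops_comp[OF ops_creation_annih[of i i] insert.IH]] insert.prems by simp
    moreover have "(\<lambda>x. ?F x - creation i (annih i (?F x))) =
        (\<lambda>x K. if A \<subseteq> K \<and> insert i B \<inter> K = {} then x K else 0)"
      by (auto simp: num fun_eq_iff minus_apply)
    ultimately show ?case by simp
  qed
qed

text \<open>Once membership of all indices from 1 on is prescribed, the size k of the set decides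
  about 0. So the selection operator is the projection onto a single coordinate of
  \<open>W d k\<close>.\<close>

lemma ops_component:
  assumes "I \<subseteq> {..<d}" "card I = k"
  obtains P where "P \<in> ops d" "\<And>x :: nat set \<Rightarrow> 'p padic_int fract. x \<in> W d k \<Longrightarrow> P x = sc (x I) (bs I)"
proof -
  let ?A = "I - {0}" and ?B = "{1..<d} - I"
  let ?P = "\<lambda>x K. if ?A \<subseteq> K \<and> ?B \<inter> K = {} then x K else 0 :: 'p padic_int fract"
  have fin: "finite I" using assms(1) finite_subset by blast
  have "?A \<subseteq> {1..<d}"
  proof
    fix i assume "i \<in> ?A"
    then have "i < d" "i \<noteq> 0" using assms(1) by auto
    then show "i \<in> {1..<d}" by simp
  qed
  then have "?P \<in> ops d" using fin by (intro ops_select) auto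
  moreover have "?P x = sc (x I) (bs I)" if x: "x \<in> W d k" for x
  proof
    fix K
    have "K = I" if K: "?A \<subseteq> K" "?B \<inter> K = {}" "x K \<noteq> 0"
    proof -
      have KW: "K \<subseteq> {..<d}" "card K = k" using W_D[OF x K(3)] by blast+
      then have finK: "finite K" using finite_subset by blast
      have s: "K - {0} = I - {0}"
      proof (intro equalityI subsetI)
        fix i assume i: "i \<in> K - {0}"
        then have "i < d" "i \<noteq> 0" using KW(1) by auto
        then have "i \<in> {1..<d}" by simp
        then show "i \<in> I - {0}" using K(2) i by blast
      qed (use K(1) in blast)
      have "card K = card (K - {0}) + (if 0 \<in> K then 1 else 0)"
        using finK card_Suc_Diff1[of K 0] by auto
      moreover have "card I = card (I - {0}) + (if 0 \<in> I then 1 else 0)"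
        using fin card_Suc_Diff1[of I 0] by auto
      moreover have "card (K - {0}) = card (I - {0})" by (simp only: s)
      ultimately have "0 \<in> K \<longleftrightarrow> 0 \<in> I"
        unfolding KW(2) assms(2) by (cases "0 \<in> K"; cases "0 \<in> I") (simp_all only: if_True if_False)
      then show ?thesis using s by blast
    qed
    then show "?P x K = sc (x I) (bs I) K" by (auto simp: sc_apply bs_def)
  qed
  ultimately show ?thesis using that by blast
qed

end

section \<open>Stable lattices\<close>

text \<open>Up to the factor $t^{k-1}$ absorbed by \<open>c\<close>, this is the $k$-th exterior power of the lattice
  with basis $f_0, t f_1, \dots, t f_{d-1}$.\<close>

definition stdlat :: "nat \<Rightarrow> nat \<Rightarrow> 'p::prime_card padic_int fract \<Rightarrow> 'p padic_int \<Rightarrow> (nat set \<Rightarrow> 'p padic_int fract) set"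
  where "stdlat d k c t = {x \<in> W d k. \<forall>I. \<exists>r. x I = c * Zp_to_Qp (r * (if 0 \<in> I then 1 else t))}"

lemma stdlat_D: "x \<in> stdlat d k c t \<Longrightarrow> \<exists>r. x I = c * Zp_to_Qp (r * (if 0 \<in> I then 1 else t))"
  and stdlat_W: "x \<in> stdlat d k c t \<Longrightarrow> x \<in> W d k"
  by (simp_all add: stdlat_def)

lemma ops_closed:
  assumes "A \<in> ops d"
    and "\<And>x y. x \<in> X \<Longrightarrow> y \<in> X \<Longrightarrow> x + y \<in> X" "\<And>r x. x \<in> X \<Longrightarrow> sc (Zp_to_Qp r) x \<in> X"
    and "\<And>a b x. a \<in> {1..Suc d} \<Longrightarrow> b \<in> {1..Suc d} \<Longrightarrow> a \<noteq> b \<Longrightarrow> x \<in> X \<Longrightarrow> Q d (rvec d a b) (rform d a b) x \<in> X"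
    and "x \<in> X"
  shows "A x \<in> X"
  using assms(1,5)
proof (induction arbitrary: x)
  case (ops_reflection a b)
  then show ?case using assms(4)[of a b x] by blast
qed (simp_all add: assms(2,3))

text \<open>The map \<open>h\<close> is linear on \<open>X\<close> only, so each induction step uses
  \<open>ops_closed\<close> to know that the intermediate vectors stay in \<open>X\<close>.\<close>

lemma ops_commute:
  assumes "A \<in> ops d"
    and closed: "\<And>x y. x \<in> X \<Longrightarrow> y \<in> X \<Longrightarrow> x + y \<in> X" "\<And>r x. x \<in> X \<Longrightarrow> sc (Zp_to_Qp r) x \<in> X"
      "\<And>a b x. a \<in> {1..Suc d} \<Longrightarrow> b \<in> {1..Suc d} \<Longrightarrow> a \<noteq> b \<Longrightarrow> x \<in> X \<Longrightarrow> Q d (rvec d a b) (rform d a b) x \<in> X"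
    and h: "\<And>x y. x \<in> X \<Longrightarrow> y \<in> X \<Longrightarrow> h (x + y) = h x + h y"
      "\<And>r x. x \<in> X \<Longrightarrow> h (sc (Zp_to_Qp r) x) = sc (Zp_to_Qp r) (h x)"
      "\<And>a b x. a \<in> {1..Suc d} \<Longrightarrow> b \<in> {1..Suc d} \<Longrightarrow> a \<noteq> b \<Longrightarrow> x \<in> X \<Longrightarrow>
        h (Q d (rvec d a b) (rform d a b) x) = Q d (rvec d a b) (rform d a b) (h x)"
    and "x \<in> X"
  shows "h (A x) = A (h x)"
  using assms(1,8)
proof (induction arbitrary: x)
  case (ops_reflection a b)
  then show ?case using h(3)[of a b x] by blast
next
  case (ops_comp A B)
  have "B x \<in> X" by (rule ops_closed[OF ops_comp.hyps(2) closed ops_comp.prems])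
  then show ?case using ops_comp by simp
next
  case (ops_add A B)
  have AB: "A x \<in> X" "B x \<in> X"
    using ops_closed[OF ops_add.hyps(1) closed ops_add.prems] ops_closed[OF ops_add.hyps(2) closed ops_add.prems] by blast+
  show ?case using h(1)[OF AB] ops_add.IH(1,2)[OF ops_add.prems] by (simp only:)
next
  case (ops_sc A r)
  have "A x \<in> X" by (rule ops_closed[OF ops_sc.hyps(1) closed ops_sc.prems])
  then show ?case using h(2)[of "A x" r] ops_sc.IH[OF ops_sc.prems] by (simp only:)
qed simp

context
  fixes d k :: nat and ty :: "'p::prime_card itself"
  assumes d: "d \<ge> 2" and k: "1 \<le> k" "k < d" and two: "(2 :: 'p padic_int) dvd 1"
begin

lemma creation_annih_bs:
  assumes "j \<in> I" "i \<notin> I"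
  obtains e where "e = 1 \<or> e = - 1" "\<And>c. creation i (annih j (sc c (bs I))) = sc (e * c :: 'p padic_int fract) (bs (insert i (I - {j})))"
proof -
  have "creation i (annih j (sc c (bs I))) = sc (sg j I * sg i (I - {j}) * c :: 'p padic_int fract) (bs (insert i (I - {j})))" for c
    using assms by (simp add: annih_bs creation_bs ac_simps)
  moreover have "sg j I * sg i (I - {j}) = (1 :: 'p padic_int fract) \<or> sg j I * sg i (I - {j}) = (- 1 :: 'p padic_int fract)"
    using sg_cases[of j I, where ?'a = "'p padic_int fract"] sg_cases[of i "I - {j}", where ?'a = "'p padic_int fract"] by auto
  ultimately show ?thesis using that by blast
qed

text \<open>\<open>J I\<close> is the fractional ideal of the coefficients that X admits at the
  product I, and X is the direct sum of these. Let \<open>c1\<close> generate the ideal of the sets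
  without 0 and \<open>c2\<close> that of the sets with 0. Replacing k by 0 gives c1 = c2 t;
  replacing 0 by k costs the factor n and gives n c2 in the ideal of \<open>c1\<close>, so t divides
  n.\<close>

lemma stable_lattice:
  fixes X :: "(nat set \<Rightarrow> 'p padic_int fract) set"
  assumes XW: "X \<subseteq> W d k"
    and add: "\<And>x y. x \<in> X \<Longrightarrow> y \<in> X \<Longrightarrow> x + y \<in> X"
    and mult: "\<And>r x. x \<in> X \<Longrightarrow> sc (Zp_to_Qp r) x \<in> X"
    and refl: "\<And>a b x. a \<in> {1..Suc d} \<Longrightarrow> b \<in> {1..Suc d} \<Longrightarrow> a \<noteq> b \<Longrightarrow> x \<in> X \<Longrightarrow> Q d (rvec d a b) (rform d a b) x \<in> X"
    and span: "\<And>I. I \<subseteq> {..<d} \<Longrightarrow> card I = k \<Longrightarrow> \<exists>a. a \<noteq> 0 \<and> sc (Zp_to_Qp a) (bs I) \<in> X"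
    and bnd: "\<And>I. \<exists>a. a \<noteq> 0 \<and> (\<forall>x\<in>X. \<exists>r. Zp_to_Qp a * x I = Zp_to_Qp r)"
  obtains c t where "c \<noteq> 0" "t dvd of_nat (Suc d)" "X = stdlat d k c t"
proof -
  have op: "A x \<in> X" if "A \<in> ops d" "x \<in> X" for A x
    using ops_closed[OF that(1) add mult refl that(2)] .
  define J where "J I = {c. sc c (bs I) \<in> X}" for I
  have Jadd: "x + y \<in> J I" if "x \<in> J I" "y \<in> J I" for x y I
    using that add by (simp add: J_def sc_add_left)
  have Jmult: "Zp_to_Qp r * x \<in> J I" if "x \<in> J I" for r x I
    using mult[of "sc x (bs I)" r] that by (simp add: J_def)
  have Jsign: "x \<in> J I" if "e * x \<in> J I" "e = 1 \<or> e = - 1" for x I e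
    using Jmult[OF that(1), of "- 1"] that by auto
  \<comment> \<open>The coordinate projections lie in \<open>ops\<close>, hence preserve X; this is
    what splits X into its ideals.\<close>
  have comp: "x I \<in> J I" if I: "I \<subseteq> {..<d}" "card I = k" and x: "x \<in> X" for I x
  proof -
    obtain P where "P \<in> ops d" "\<And>x :: nat set \<Rightarrow> 'p padic_int fract. x \<in> W d k \<Longrightarrow> P x = sc (x I) (bs I)"
      using ops_component[OF d two I] by blast
    then have "sc (x I) (bs I) \<in> X" using op[of P x] x XW by auto
    then show ?thesis by (simp add: J_def)
  qed
  have prin: "\<exists>c. c \<noteq> 0 \<and> J I = range (\<lambda>r. c * Zp_to_Qp r)" if I: "I \<subseteq> {..<d}" "card I = k" for I
  proof -
    obtain a0 where a0: "a0 \<noteq> 0" "Zp_to_Qp a0 \<in> J I" using span[OF I] by (auto simp: J_def)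
    obtain a where a: "a \<noteq> 0" "\<And>x. x \<in> X \<Longrightarrow> \<exists>r. Zp_to_Qp a * x I = Zp_to_Qp r" using bnd[of I] by blast
    have "\<exists>r. Zp_to_Qp a * x = Zp_to_Qp r" if "x \<in> J I" for x
      using a(2)[of "sc x (bs I)"] that by (simp add: J_def sc_apply bs_def)
    then show ?thesis
      using fractional_ideal_principal[of "J I", OF Jadd Jmult a0(2) _ a(1)] a0(1) by (metis Zp_to_Qp_eq_0_iff)
  qed
  \<comment> \<open>Up to sign, u f_i \<and> \<iota>_j exchanges j for i in the index set and
    multiplies the coefficient by u, so it compares the ideals of the two sets.\<close>
  have move: "c \<in> J (insert i (I - {j}))"
    if "(\<lambda>x. sc u (creation i (annih j x))) \<in> ops d" "j \<in> I" "i \<notin> I" "c' \<in> J I" "u * c' = c" for u c c' i j I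
  proof -
    note prem = that
    obtain e where e: "e = 1 \<or> e = - 1" "\<And>c. creation i (annih j (sc c (bs I))) = sc (e * c :: 'p padic_int fract) (bs (insert i (I - {j})))"
      using creation_annih_bs[OF prem(2,3)] by blast
    have "sc u (creation i (annih j (sc c' (bs I)))) \<in> X" using op[OF prem(1), of "sc c' (bs I)"] prem(4) unfolding J_def by blast
    moreover have "sc u (creation i (annih j (sc c' (bs I)))) = sc (e * c) (bs (insert i (I - {j})))"
      unfolding e(2) by (simp add: prem(5)[symmetric] ac_simps)
    ultimately have "e * c \<in> J (insert i (I - {j}))" by (simp only: J_def mem_Collect_eq)
    then show ?thesis using Jsign e by blast
  qed
  have "J I \<subseteq> J I'" if "I \<subseteq> {..<d}" "card I = k" "I' \<subseteq> {..<d}" "card I' = k" "0 \<in> I \<longleftrightarrow> 0 \<in> I'" for I I'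
    using that
  \<comment> \<open>Each exchange of an index outside \<open>I'\<close> for one inside it lowers
    this number. Neither index is 0, because 0 lies in both sets or in none, so the exchange needs
    no factor n.\<close>
  proof (induction "card (I - I')" arbitrary: I rule: less_induct)
    case less
    have fin: "finite I" "finite I'" using less.prems finite_subset by blast+
    show ?case
    proof (cases "I \<subseteq> I'")
      case True
      then have "I = I'" using fin less.prems by (metis card_subset_eq)
      then show ?thesis by simp
    next
      case False
      then obtain j where j: "j \<in> I" "j \<notin> I'" by blast
      have "\<not> I' \<subseteq> I" using j fin less.prems by (metis card_subset_eq)
      then obtain i where i: "i \<in> I'" "i \<notin> I" by blast
      have "i \<noteq> 0" "j \<noteq> 0" "i < d" "j < d" using i j less.prems by (auto intro: gr0I)
      then have ij: "i \<in> {1..<d}" "j \<in> {1..<d}" by auto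
      let ?I = "insert i (I - {j})"
      have "c \<in> J ?I" if "c \<in> J I" for c
        using move[of 1 i j I c c] ops_creation_annih[OF d two ij] j i that by simp
      then have "J I \<subseteq> J ?I" by (rule subsetI)
      moreover have "?I - I' = I - I' - {j}" using i by auto
      then have "card (?I - I') < card (I - I')" using fin j by (simp add: card_Diff1_less del: card_Diff_insert)
      moreover have "card ?I = k" using less.prems(2) i j fin card_Suc_Diff1[of I j] by simp
      moreover have "?I \<subseteq> {..<d}" using less.prems ij by auto
      moreover have "0 \<in> ?I \<longleftrightarrow> 0 \<in> I'" using less.prems ij by auto
      ultimately show ?thesis using less.hyps[of ?I] less.prems(3,4) by blast
    qed
  qed
  then have Jeq: "J I = J I'" if "I \<subseteq> {..<d}" "card I = k" "I' \<subseteq> {..<d}" "card I' = k" "0 \<in> I \<longleftrightarrow> 0 \<in> I'" for I I'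
    using that by blast
  \<comment> \<open>Representatives of the two kinds of sets: k < d leaves room for one without 0,
    and k \<ge> 1 puts 0 into the other.\<close>
  have I0: "{1..k} \<subseteq> {..<d}" "card {1..k} = k" and J0: "{..<k} \<subseteq> {..<d}" "card {..<k} = k" using k by auto
  obtain c1 where c1: "c1 \<noteq> 0" "J {1..k} = range (\<lambda>r. c1 * Zp_to_Qp r)" using prin[OF I0] by blast
  obtain c2 where c2: "c2 \<noteq> 0" "J {..<k} = range (\<lambda>r. c2 * Zp_to_Qp r)" using prin[OF J0] by blast
  have kk: "k \<in> {1..<d}" using k by simp
  have s1: "insert 0 ({1..k} - {k}) = {..<k}" and s2: "insert k ({..<k} - {0}) = {1..k}" using k by auto
  have "c1 \<in> J {1..k}" unfolding c1(2) by (intro range_eqI[of _ _ 1]) simp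
  then have "c1 \<in> J {..<k}"
    using move[of 1 0 k "{1..k}" c1 c1] ops_creation0_annih[OF d two kk] k unfolding s1 by simp
  then obtain t where t: "c1 = c2 * Zp_to_Qp t" unfolding c2(2) by blast
  have "c2 \<in> J {..<k}" unfolding c2(2) by (intro range_eqI[of _ _ 1]) simp
  then have "of_nat (Suc d) * c2 \<in> J {1..k}"
    using move[of "of_nat (Suc d)" k 0 "{..<k}" c2] ops_creation_annih0[OF d two kk] k unfolding s2 by simp
  then obtain r where "of_nat (Suc d) * c2 = c1 * Zp_to_Qp r" unfolding c1(2) by blast
  then have "c2 * Zp_to_Qp (of_nat (Suc d)) = c2 * Zp_to_Qp (t * r)" unfolding t by (simp add: ac_simps del: of_nat_Suc)
  then have "of_nat (Suc d) = t * r" unfolding mult_left_cancel[OF c2(1)] Zp_to_Qp_eq_iff .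
  then have dvd: "t dvd of_nat (Suc d)" by (rule dvdI)
  have JI: "J I = range (\<lambda>r. c2 * Zp_to_Qp (r * (if 0 \<in> I then 1 else t)))" if "I \<subseteq> {..<d}" "card I = k" for I
  proof (cases "0 \<in> I")
    case True
    then have "J I = J {..<k}" using k by (intro Jeq that J0) auto
    then show ?thesis using True c2 by simp
  next
    case False
    then have "J I = J {1..k}" by (intro Jeq that I0) auto
    then show ?thesis using False c1 by (simp add: t ac_simps)
  qed
  have "X = stdlat d k c2 t"
  proof (intro equalityI subsetI)
    fix x assume x: "x \<in> X"
    have "\<exists>r. x I = c2 * Zp_to_Qp (r * (if 0 \<in> I then 1 else t))" for I
    proof (cases "x I = 0")
      case True
      then show ?thesis by (intro exI[of _ 0]) simp
    next
      case False
      then have "I \<subseteq> {..<d}" "card I = k" using x XW W_D by blast+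
      then have "x I \<in> J I" "J I = range (\<lambda>r. c2 * Zp_to_Qp (r * (if 0 \<in> I then 1 else t)))"
        using comp[OF _ _ x] JI by simp_all
      then show ?thesis by (simp only: image_iff Bex_def UNIV_I simp_thms)
    qed
    then show "x \<in> stdlat d k c2 t" using x XW by (auto simp: stdlat_def)
  next
    fix x assume x: "x \<in> stdlat d k c2 t"
    have elem: "sc (x I) (bs I) \<in> X" if "I \<in> {I. I \<subseteq> {..<d} \<and> card I = k}" for I
    proof -
      have "x I \<in> J I" using JI[of I] that stdlat_D[OF x, of I] by auto
      then show ?thesis by (simp add: J_def)
    qed
    have zero: "0 \<in> X" using span[OF I0] mult[of _ 0] by auto
    have sumX: "(\<Sum>i\<in>A. f i) \<in> X" if "\<And>i. i \<in> A \<Longrightarrow> f i \<in> X" "0 \<in> X" for f and A :: "nat set set"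
      using that by (induction A rule: infinite_finite_induct) (simp_all add: add)
    have "(\<Sum>I\<in>{I. I \<subseteq> {..<d} \<and> card I = k}. sc (x I) (bs I)) \<in> X"
      by (rule sumX[OF elem zero])
    then show "x \<in> X" by (rule ssubst[where P = "\<lambda>y. y \<in> X", OF W_expand[OF stdlat_W[OF x]]])
  qed
  then show ?thesis using that c2(1) dvd by blast
qed

text \<open>As \<open>h\<close> commutes with the coordinate projections, it maps coordinate lines
  to coordinate lines. The operator f_0 \<and> \<iota>_k multiplies generators by t on the source,
  up to sign, while on the target it carries multiples of c' t'. Surjectivity at the product
  containing f_0 then yields that t' divides t.\<close>

lemma stable_lattice_invariant:
  fixes h :: "(nat set \<Rightarrow> 'p padic_int fract) \<Rightarrow> nat set \<Rightarrow> 'p padic_int fract"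
  assumes surj: "h ` stdlat d k c t = stdlat d k c' t'" and c': "c' \<noteq> 0"
    and hsc: "\<And>r x. x \<in> stdlat d k c t \<Longrightarrow> h (sc (Zp_to_Qp r) x) = sc (Zp_to_Qp r) (h x)"
    and hop: "\<And>A x. A \<in> ops d \<Longrightarrow> x \<in> stdlat d k c t \<Longrightarrow> h (A x) = A (h x)"
  shows "t' dvd t"
proof -
  let ?N = "stdlat d k c t" and ?N' = "stdlat d k c' t'"
  have I0: "{1..k} \<subseteq> {..<d}" "card {1..k} = k" and J0: "{..<k} \<subseteq> {..<d}" "card {..<k} = k" using k by auto
  have NW: "x \<in> W d k" if "x \<in> ?N" for x using that by (simp add: stdlat_def)
  have NW': "h x \<in> W d k" if "x \<in> ?N" for x using that surj by (force simp: stdlat_def)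
  obtain P1 where P1: "P1 \<in> ops d" "\<And>x :: nat set \<Rightarrow> 'p padic_int fract. x \<in> W d k \<Longrightarrow> P1 x = sc (x {1..k}) (bs {1..k})"
    using ops_component[OF d two I0] by blast
  obtain P2 where P2: "P2 \<in> ops d" "\<And>x :: nat set \<Rightarrow> 'p padic_int fract. x \<in> W d k \<Longrightarrow> P2 x = sc (x {..<k}) (bs {..<k})"
    using ops_component[OF d two J0] by blast
  have inN: "sc (a * Zp_to_Qp (if 0 \<in> I then 1 else s)) (bs I) \<in> stdlat d k a s" if "I \<subseteq> {..<d}" "card I = k" for I a s
    unfolding stdlat_def
  proof (intro CollectI conjI allI)
    show "\<exists>r. sc (a * Zp_to_Qp (if 0 \<in> I then 1 else s)) (bs I) K = a * Zp_to_Qp (r * (if 0 \<in> K then 1 else s))" for K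
      by (intro exI[of _ "if K = I then 1 else 0"]) (simp add: sc_apply bs_def)
  qed (intro W_sc bs_in_W that)
  \<comment> \<open>\<open>A\<close> and \<open>B\<close> generate the lattice on the two
    representative coordinate lines, and f_0 \<and> \<iota>_k sends \<open>A\<close> to t times
    \<open>B\<close>, up to sign.\<close>
  define A where "A = sc (c * Zp_to_Qp t) (bs {1..k})"
  define B where "B = sc c (bs {..<k})"
  have A: "A \<in> ?N" using inN[OF I0, of c t] by (simp add: A_def)
  have B: "B \<in> ?N" using inN[OF J0, of c t] k by (simp add: B_def)
  have selfA: "P1 A = A" using P1(2)[OF NW[OF A]] by (simp add: A_def sc_apply bs_def)
  have selfB: "P2 B = B" using P2(2)[OF NW[OF B]] by (simp add: B_def sc_apply bs_def)
  have hA: "h A = sc (h A {1..k}) (bs {1..k})" 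
    using hop[OF P1(1) A] unfolding selfA P1(2)[OF NW'[OF A]] .
  have hB: "h B = sc (h B {..<k}) (bs {..<k})" 
    using hop[OF P2(1) B] unfolding selfB P2(2)[OF NW'[OF B]] .
  have "h A \<in> ?N'" using surj A by blast
  then obtain r1 where r1: "h A {1..k} = c' * Zp_to_Qp (r1 * t')"
    using stdlat_D[of "h A" d k c' t' "{1..k}"] by auto
  have kk: "k \<in> {1..<d}" using k by simp
  obtain e :: "'p padic_int fract" where e: "e = 1 \<or> e = - 1"
    "\<And>c. creation 0 (annih k (sc c (bs {1..k}))) = sc (e * c) (bs (insert 0 ({1..k} - {k})))"
    using creation_annih_bs[of k "{1..k}" 0] k by auto
  have s1: "insert 0 ({1..k} - {k}) = {..<k}" using k by auto
  obtain e' where e': "e = Zp_to_Qp e'" using e(1) by (metis Zp_to_Qp_simps(2,5))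
  have OA: "creation 0 (annih k A) = sc (Zp_to_Qp (e' * t)) B" unfolding A_def B_def e(2) s1 by (simp add: e' ac_simps)
  have "sc (Zp_to_Qp (e' * t)) (h B) = creation 0 (annih k (h A))"
    using hop[OF ops_creation0_annih[OF d two kk] A] unfolding OA hsc[OF B] .
  also have "\<dots> = sc (e * h A {1..k}) (bs {..<k})" 
    using arg_cong[OF hA, of "\<lambda>y. creation 0 (annih k y)"] unfolding e(2) s1 .
  finally have "sc (Zp_to_Qp (e' * t)) (h B) {..<k} = sc (e * h A {1..k}) (bs {..<k}) {..<k}" by simp
  then have tn: "Zp_to_Qp t * h B {..<k} = h A {1..k}" using e(1) by (auto simp: sc_apply bs_def e'[symmetric])
  \<comment> \<open>Pulling back the generator of the target line and projecting the preimage gives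
    a multiple of \<open>B\<close>. So c' is an integral multiple of the coefficient of
    \<open>h B\<close>.\<close>
  have "sc c' (bs {..<k}) \<in> ?N'" using inN[OF J0, of c' t'] k by simp
  then obtain B' where B': "B' \<in> ?N" "h B' = sc c' (bs {..<k})" using surj by force
  obtain r where r: "B' {..<k} = c * Zp_to_Qp r"
    using stdlat_D[OF B'(1), of "{..<k}"] k by auto
  have PB': "P2 B' = sc (Zp_to_Qp r) B" using P2(2)[OF NW[OF B'(1)]] by (simp add: r B_def mult.commute)
  have "sc (Zp_to_Qp r) (h B) = P2 (h B')" using hop[OF P2(1) B'(1)] unfolding PB' hsc[OF B] .
  also have "\<dots> = sc c' (bs {..<k})" using P2(2)[OF NW'[OF B'(1)]] by (simp add: B' sc_apply bs_def)
  finally have "sc (Zp_to_Qp r) (h B) {..<k} = sc c' (bs {..<k}) {..<k}" by simp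
  then have "c' = Zp_to_Qp r * h B {..<k}" by (simp add: sc_apply bs_def)
  then have "c' * Zp_to_Qp t = Zp_to_Qp r * (Zp_to_Qp t * h B {..<k})" by (simp add: ac_simps)
  then have "c' * Zp_to_Qp t = Zp_to_Qp r * h A {1..k}" unfolding tn .
  also have "\<dots> = c' * Zp_to_Qp (r * r1 * t')" unfolding r1 by (simp add: ac_simps)
  finally have "t = r * r1 * t'" unfolding mult_left_cancel[OF c'] Zp_to_Qp_eq_iff .
  then show ?thesis by simp
qed

end

section \<open>Modules given by generators and relations\<close>

abbreviation Rc :: "'r::comm_ring_1 ring" where "Rc \<equiv> cring_class_ops"

text \<open>The carrier of \<open>free_module Rc X\<close> in type class notation; it also serves as
  the space of coordinate vectors.\<close>

definition fc :: "'x set \<Rightarrow> ('x \<Rightarrow> 'r::comm_ring_1) set"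
  where "fc X = {f. finite {x. f x \<noteq> 0} \<and> {x. f x \<noteq> 0} \<subseteq> X}"

text \<open>Infinite \<open>A\<close> is covered because both sums are then zero by
  convention.\<close>

lemma finsum_class: "finsum Rc f A = sum f A"
proof (induction A rule: infinite_finite_induct)
  case (insert x A)
  then show ?case using cring_class.finsum_insert[of A x f] by (simp add: carrier_class)
qed (simp_all add: finsum_def finprod_def zero_class)

lemma fc_zero [simp]: "0 \<in> fc X"
  by (simp add: fc_def zero_fun_apply)

lemma fc_add:
  assumes "f \<in> fc X" "g \<in> fc X"
  shows "f + g \<in> fc X"
proof -
  have "{x. (f + g) x \<noteq> 0} \<subseteq> {x. f x \<noteq> 0} \<union> {x. g x \<noteq> 0}" by (auto simp: plus_fun_apply)
  then show ?thesis using assms unfolding fc_def by (blast intro: finite_subset)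
qed

lemma fc_sc:
  assumes "f \<in> fc X"
  shows "sc a f \<in> fc X"
proof -
  have "{x. sc a f x \<noteq> 0} \<subseteq> {x. f x \<noteq> 0}" by (auto simp: sc_apply)
  then show ?thesis using assms unfolding fc_def by (blast intro: finite_subset)
qed

lemma sc_minus1: "- f = sc (- 1) f"
  by simp

lemma fc_neg: "f \<in> fc X \<Longrightarrow> - f \<in> fc X"
  unfolding sc_minus1 by (rule fc_sc)

lemma fc_diff: "f \<in> fc X \<Longrightarrow> g \<in> fc X \<Longrightarrow> f - g \<in> fc X"
  using fc_add[OF _ fc_neg, of f X g] by simp

lemma fc_bs: "x \<in> X \<Longrightarrow> bs x \<in> fc X"
  by (auto simp: fc_def bs_def)

lemma fc_sum: "(\<And>i. i \<in> A \<Longrightarrow> f i \<in> fc X) \<Longrightarrow> (\<Sum>i\<in>A. f i) \<in> fc X"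
  by (induction A rule: infinite_finite_induct) (auto intro: fc_add)

lemma fc_expand:
  assumes "f \<in> fc X"
  shows "f = (\<Sum>x\<in>{x. f x \<noteq> 0}. sc (f x) (bs x))"
proof
  fix y
  have "(\<Sum>x\<in>{x. f x \<noteq> 0}. sc (f x) (bs x) y) = (\<Sum>x\<in>{x. f x \<noteq> 0}. if x = y then f y else 0)"
    by (intro sum.cong) (auto simp: bs_def sc_apply)
  also have "\<dots> = f y" using assms by (subst sum.delta) (auto simp: fc_def)
  finally show "f y = (\<Sum>x\<in>{x. f x \<noteq> 0}. sc (f x) (bs x)) y" by (simp add: sum_fun_apply)
qed

lemma fc_induct [consumes 1, case_names zero gen add sc]:
  assumes f: "f \<in> fc X" and "P 0" and gen: "\<And>x. x \<in> X \<Longrightarrow> P (bs x)"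
    and add: "\<And>f g. f \<in> fc X \<Longrightarrow> g \<in> fc X \<Longrightarrow> P f \<Longrightarrow> P g \<Longrightarrow> P (f + g)"
    and sc: "\<And>a f. f \<in> fc X \<Longrightarrow> P f \<Longrightarrow> P (sc a f)"
  shows "P f"
proof -
  have "P (\<Sum>x\<in>A. sc (f x) (bs x))" if "A \<subseteq> X" for A
    using that
  proof (induction A rule: infinite_finite_induct)
    case (insert x A)
    then have "x \<in> X" "A \<subseteq> X" by auto
    have "P (sc (f x) (bs x) + (\<Sum>x\<in>A. sc (f x) (bs x)))"
      using insert \<open>x \<in> X\<close> \<open>A \<subseteq> X\<close> by (intro add sc gen fc_sc fc_bs fc_sum) auto
    then show ?case using insert by simp
  qed (use \<open>P 0\<close> in simp_all)
  then have "P (\<Sum>x\<in>{x. f x \<noteq> 0}. sc (f x) (bs x))" using f by (simp add: fc_def)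
  then show ?thesis by (rule ssubst[where P = P, OF fc_expand[OF f]])
qed

definition lin :: "('x \<Rightarrow> 'z \<Rightarrow> 'r::comm_ring_1) \<Rightarrow> ('x \<Rightarrow> 'r) \<Rightarrow> 'z \<Rightarrow> 'r"
  where "lin w f = (\<Sum>x\<in>{x. f x \<noteq> 0}. sc (f x) (w x))"

lemma lin_superset:
  assumes "finite A" "{x. f x \<noteq> 0} \<subseteq> A"
  shows "lin w f = (\<Sum>x\<in>A. sc (f x) (w x))"
  unfolding lin_def using assms by (intro sum.mono_neutral_left) auto

lemma lin_zero [simp]: "lin w 0 = 0"
  by (simp add: lin_def zero_fun_apply)

lemma lin_add:
  assumes "f \<in> fc X" "g \<in> fc X"
  shows "lin w (f + g) = lin w f + lin w g"
proof -
  let ?A = "{x. f x \<noteq> 0} \<union> {x. g x \<noteq> 0}"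
  have "finite ?A" using assms by (auto simp: fc_def)
  then have "lin w (f + g) = (\<Sum>x\<in>?A. sc ((f + g) x) (w x))" "lin w f = (\<Sum>x\<in>?A. sc (f x) (w x))"
    "lin w g = (\<Sum>x\<in>?A. sc (g x) (w x))"
    by (intro lin_superset; auto simp: plus_fun_apply)+
  then show ?thesis by (simp add: plus_fun_apply sc_add_left sum.distrib)
qed

lemma lin_sc:
  assumes "f \<in> fc X"
  shows "lin w (sc a f) = sc a (lin w f)"
proof -
  have "lin w (sc a f) = (\<Sum>x\<in>{x. f x \<noteq> 0}. sc (sc a f x) (w x))"
    using assms by (intro lin_superset) (auto simp: fc_def sc_apply)
  then show ?thesis by (simp add: lin_def sc_apply sc_sum_right)
qed

lemma lin_diff: "f \<in> fc X \<Longrightarrow> g \<in> fc X \<Longrightarrow> lin w (f - g) = lin w f - lin w g"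
  using lin_add[OF _ fc_neg, of f X g w] lin_sc[of g X w "- 1"] by simp

lemma lin_bs [simp]: "lin w (bs x) = w x"
  by (subst lin_superset[of "{x}"]) (auto simp: bs_def)

text \<open>As a linear extension, \<open>push\<close> inherits linearity and functoriality from
  \<open>lin\<close>, without sums over fibres.\<close>

lemma push_eq_lin:
  assumes "f \<in> fc X"
  shows "push Rc h f = lin (\<lambda>x. bs (h x)) f"
proof
  fix y
  have fin: "finite {x. f x \<noteq> 0}" using assms by (simp add: fc_def)
  have "push Rc h f y = (\<Sum>x\<in>{x. f x \<noteq> 0 \<and> h x = y}. f x)"
    by (simp add: push_def finsum_class zero_class)
  also have "\<dots> = (\<Sum>x\<in>{x. f x \<noteq> 0}. if h x = y then f x else 0)"
    using fin by (subst sum.inter_filter[symmetric]) (auto intro: sum.cong)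
  also have "\<dots> = lin (\<lambda>x. bs (h x)) f y"
    by (auto simp: lin_def sum_fun_apply sc_apply bs_def intro!: sum.cong)
  finally show "push Rc h f y = lin (\<lambda>x. bs (h x)) f y" .
qed

lemma push_add: "f \<in> fc X \<Longrightarrow> g \<in> fc X \<Longrightarrow> push Rc h (f + g) = push Rc h f + push Rc h g"
  by (simp add: push_eq_lin[of _ X] fc_add lin_add[of _ X])

lemma push_sc: "f \<in> fc X \<Longrightarrow> push Rc h (sc a f) = sc a (push Rc h f)"
  by (simp add: push_eq_lin[of _ X] fc_sc lin_sc[of _ X])

lemmas push_simps = push_add push_sc

lemma push_zero [simp]: "push Rc h 0 = 0"
  using push_eq_lin[of 0 UNIV h] by simp

lemma push_bs [simp]: "push Rc h (bs x) = bs (h x)"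
  using push_eq_lin[of "bs x" UNIV h] by (simp add: fc_bs)

lemma push_diff: "f \<in> fc X \<Longrightarrow> g \<in> fc X \<Longrightarrow> push Rc h (f - g) = push Rc h f - push Rc h g"
  using push_add[OF _ fc_neg, of f X g h] push_sc[of g X h "- 1"] by simp

lemma push_closed:
  assumes "f \<in> fc X" "\<And>x. x \<in> X \<Longrightarrow> h x \<in> Y"
  shows "push Rc h f \<in> fc Y"
  using assms by (induction rule: fc_induct) (auto simp: push_simps[of _ X] intro: fc_add fc_sc fc_bs)

lemma lin_push:
  assumes "f \<in> fc X"
  shows "lin w (push Rc h f) = lin (\<lambda>x. w (h x)) f"
  using assms
proof (induction rule: fc_induct)
  case (add f g)
  then show ?case
    by (simp add: push_simps[of _ X] lin_add[of _ X] lin_add[of _ UNIV] push_closed[of _ X h UNIV])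
next
  case (sc a f)
  then show ?case
    by (simp add: push_simps[of _ X] lin_sc[of _ X] lin_sc[of _ UNIV] push_closed[of _ X h UNIV])
qed simp_all

lemma push_push:
  assumes f: "f \<in> fc X"
  shows "push Rc h (push Rc h' f) = push Rc (\<lambda>x. h (h' x)) f"
proof -
  have "push Rc h' f \<in> fc UNIV" by (rule push_closed[OF f]) simp
  then have "push Rc h (push Rc h' f) = lin (\<lambda>x. bs (h x)) (push Rc h' f)" by (rule push_eq_lin)
  also have "\<dots> = lin (\<lambda>x. bs (h (h' x))) f" by (rule lin_push[OF f])
  also have "\<dots> = push Rc (\<lambda>x. h (h' x)) f" by (rule push_eq_lin[OF f, symmetric])
  finally show ?thesis .
qed

lemma push_cong:
  assumes "f \<in> fc X" "\<And>x. x \<in> X \<Longrightarrow> h x = h' x"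
  shows "push Rc h f = push Rc h' f"
  using assms by (induction rule: fc_induct) (auto simp: push_simps[of _ X])

lemma push_id: "f \<in> fc X \<Longrightarrow> push Rc (\<lambda>x. x) f = f"
  by (induction rule: fc_induct) (auto simp: push_simps[of _ X])

lemma free_module_simps [simp]:
  "carrier (free_module Rc X) = fc X" "zero (free_module Rc X) = 0"
  "add (free_module Rc X) f g = f + g" "module.smult (free_module Rc X) a f = sc a f"
  by (auto simp: free_module_def fc_def class_simps fun_algebra)

lemma free_gen_class: "free_gen Rc = bs"
  by (simp add: free_gen_def bs_def class_simps fun_eq_iff)

lemma free_module_is_module:
  fixes X :: "'x set"
  shows "Module.module (Rc :: 'r::comm_ring_1 ring) (free_module Rc X)"
proof (rule moduleI)
  show "abelian_group (free_module (Rc :: 'r ring) X)"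
  proof (rule abelian_groupI)
    fix f assume "f \<in> carrier (free_module (Rc :: 'r ring) X)"
    then show "\<exists>g\<in>carrier (free_module (Rc :: 'r ring) X). g \<oplus>\<^bsub>free_module Rc X\<^esub> f = \<zero>\<^bsub>free_module Rc X\<^esub>"
      by (intro bexI[of _ "- f"]) (auto intro: fc_neg)
  qed (auto simp: fc_add ac_simps)
qed (auto simp: cring_class fc_sc sc_add_left sc_add_right class_simps)

lemma free_module_neg:
  fixes f :: "'x \<Rightarrow> 'r::comm_ring_1"
  assumes "f \<in> fc X"
  shows "a_inv (free_module Rc X) f = - f"
proof -
  interpret Module.module "Rc :: 'r ring" "free_module Rc X" by (rule free_module_is_module)
  show ?thesis using assms M.minus_equality[of "- f" f] by (simp add: fc_neg)
qed

lemma free_module_minus: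
  assumes "f \<in> fc X" "g \<in> fc X"
  shows "f \<ominus>\<^bsub>free_module Rc X\<^esub> g = f - g"
  using assms by (simp add: a_minus_def free_module_neg)

section \<open>The submodule spanned by the relations\<close>

context
  fixes X :: "'x set" and S :: "('x \<Rightarrow> 'r::comm_ring_1) set"
  assumes S: "S \<subseteq> fc X"
begin

lemma submodule_free_iff:
  fixes N :: "('x \<Rightarrow> 'r) set"
  shows "submodule N Rc (free_module Rc X) \<longleftrightarrow>
    N \<subseteq> fc X \<and> 0 \<in> N \<and> (\<forall>f\<in>N. \<forall>g\<in>N. f + g \<in> N) \<and> (\<forall>a. \<forall>f\<in>N. sc a f \<in> N)"
proof -
  interpret Module.module "Rc :: 'r ring" "free_module Rc X" by (rule free_module_is_module)
  show ?thesis
  proof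
    assume N: "submodule N Rc (free_module Rc X)"
    then obtain f where "f \<in> N" using submoduleE(2)[OF N] by blast
    then have "sc 0 f \<in> N" using submoduleE(4)[OF N, of 0 f] by (simp add: carrier_class)
    then show "N \<subseteq> fc X \<and> 0 \<in> N \<and> (\<forall>f\<in>N. \<forall>g\<in>N. f + g \<in> N) \<and> (\<forall>a. \<forall>f\<in>N. sc a f \<in> N)"
      using submoduleE(1)[OF N] submoduleE(4)[OF N] submoduleE(5)[OF N] by (auto simp: carrier_class)
  next
    assume *: "N \<subseteq> fc X \<and> 0 \<in> N \<and> (\<forall>f\<in>N. \<forall>g\<in>N. f + g \<in> N) \<and> (\<forall>a. \<forall>f\<in>N. sc a f \<in> N)"
    then have "- f \<in> N" if "f \<in> N" for f using that unfolding sc_minus1[of f] by blast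
    with * show "submodule N Rc (free_module Rc X)"
      by (intro submoduleI) (auto simp: free_module_neg subset_iff)
  qed
qed

definition "rel_span = generated_submodule Rc (free_module Rc X) S"

lemma rel_span_least:
  assumes "N \<subseteq> fc X" "0 \<in> N" "\<And>f g. f \<in> N \<Longrightarrow> g \<in> N \<Longrightarrow> f + g \<in> N" "\<And>a f. f \<in> N \<Longrightarrow> sc a f \<in> N" "S \<subseteq> N"
  shows "rel_span \<subseteq> N"
proof -
  have "submodule N Rc (free_module Rc X)" unfolding submodule_free_iff using assms by blast
  then show ?thesis using assms(5) unfolding rel_span_def generated_submodule_def by blast
qed

lemma rel_span_submodule: "submodule rel_span Rc (free_module Rc X)"
proof -
  have "submodule (fc X :: ('x \<Rightarrow> 'r) set) Rc (free_module Rc X)"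
    unfolding submodule_free_iff by (auto intro: fc_add fc_sc)
  then have "rel_span \<subseteq> fc X" unfolding rel_span_def generated_submodule_def using S by blast
  then show ?thesis
    unfolding submodule_free_iff unfolding rel_span_def generated_submodule_def
    by (auto simp: submodule_free_iff)
qed

lemma rel_span_simps:
  shows rel_span_sub: "rel_span \<subseteq> fc X" and rel_span_zero: "0 \<in> rel_span"
    and rel_span_add: "f \<in> rel_span \<Longrightarrow> g \<in> rel_span \<Longrightarrow> f + g \<in> rel_span"
    and rel_span_sc: "f \<in> rel_span \<Longrightarrow> sc a f \<in> rel_span"
    and rel_span_gen: "S \<subseteq> rel_span"
  using rel_span_submodule unfolding submodule_free_iff
  by (simp_all add: rel_span_def generated_submodule_def) blast

lemma rel_span_neg: "f \<in> rel_span \<Longrightarrow> - f \<in> rel_span"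
  unfolding sc_minus1[of f] by (rule rel_span_sc)

lemma rel_span_diff: "f \<in> rel_span \<Longrightarrow> g \<in> rel_span \<Longrightarrow> f - g \<in> rel_span"
  using rel_span_add[OF _ rel_span_neg, of f g] by simp

lemma rel_span_ker:
  assumes "\<And>s. s \<in> S \<Longrightarrow> lin w s = 0" "f \<in> rel_span"
  shows "lin w f = 0"
proof -
  have "rel_span \<subseteq> {f \<in> fc X. lin w f = 0}"
    by (rule rel_span_least) (use S assms(1) in \<open>auto simp: lin_add[of _ X] lin_sc[of _ X] intro: fc_add fc_sc\<close>)
  then show ?thesis using assms(2) by blast
qed

end

text \<open>Bijectivity of each \<open>act M g\<close> comes for free from the action of the
  inverse, so it is not among the obligations.\<close>

lemma gmoduleI:
  assumes mod: "Module.module R M" and G: "group G"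
    and closed: "\<And>g x. g \<in> carrier G \<Longrightarrow> x \<in> carrier M \<Longrightarrow> act M g x \<in> carrier M"
    and comp: "\<And>g h x. g \<in> carrier G \<Longrightarrow> h \<in> carrier G \<Longrightarrow> x \<in> carrier M \<Longrightarrow> act M (g \<otimes>\<^bsub>G\<^esub> h) x = act M g (act M h x)"
    and one: "\<And>x. x \<in> carrier M \<Longrightarrow> act M \<one>\<^bsub>G\<^esub> x = x"
    and ext: "\<And>g. act M g \<in> extensional (carrier M)"
    and add: "\<And>g x y. g \<in> carrier G \<Longrightarrow> x \<in> carrier M \<Longrightarrow> y \<in> carrier M \<Longrightarrow>
      act M g (x \<oplus>\<^bsub>M\<^esub> y) = act M g x \<oplus>\<^bsub>M\<^esub> act M g y"
    and smult: "\<And>g a x. g \<in> carrier G \<Longrightarrow> a \<in> carrier R \<Longrightarrow> x \<in> carrier M \<Longrightarrow>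
      act M g (a \<odot>\<^bsub>M\<^esub> x) = a \<odot>\<^bsub>M\<^esub> act M g x"
  shows "gmodule R G M"
proof -
  interpret group G by (rule G)
  have "group_action G (carrier M) (act M)"
  proof (intro group_action.intro group_hom.intro group_hom_axioms.intro homI)
    show "group (BijGroup (carrier M))" by (rule group_BijGroup)
    have B: "act M g \<in> Bij (carrier M)" if g: "g \<in> carrier G" for g
    proof -
      have "bij_betw (act M g) (carrier M) (carrier M)"
      proof (rule bij_betw_byWitness[where f' = "act M (inv\<^bsub>G\<^esub> g)"])
        show "\<forall>x\<in>carrier M. act M (inv\<^bsub>G\<^esub> g) (act M g x) = x"
          using g by (auto simp: one simp flip: comp)
        show "\<forall>x\<in>carrier M. act M g (act M (inv\<^bsub>G\<^esub> g) x) = x"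
          using g by (auto simp: one simp flip: comp)
      qed (use g closed in auto)
      then show ?thesis using ext by (simp add: Bij_def)
    qed
    then show "act M g \<in> carrier (BijGroup (carrier M))" if "g \<in> carrier G" for g
      using that by (simp add: BijGroup_def)
    fix g h assume gh: "g \<in> carrier G" "h \<in> carrier G"
    have "act M (g \<otimes>\<^bsub>G\<^esub> h) = compose (carrier M) (act M g) (act M h)"
      by (rule extensionalityI[OF ext]) (auto simp: compose_def comp gh)
    then show "act M (g \<otimes>\<^bsub>G\<^esub> h) = act M g \<otimes>\<^bsub>BijGroup (carrier M)\<^esub> act M h"
      using B gh by (simp add: BijGroup_def)
  qed (rule G)
  with mod add smult show ?thesis by (intro gmodule.intro gmodule_axioms.intro) auto
qed

text \<open>The map \<open>w\<close> on generators is a concrete model: its linear extension kills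
  exactly the span of the relations. Hence the quotient is isomorphic to the image of
  \<open>lin w\<close>, and the group acts on it through \<open>h\<close>. Exterior powers and
  extensions of scalars are both treated as instances.\<close>

locale presented =
  fixes X :: "'x set" and S :: "('x \<Rightarrow> 'r::comm_ring_1) set" and h :: "'g \<Rightarrow> 'x \<Rightarrow> 'x"
    and G :: "'g monoid" and w :: "'x \<Rightarrow> 'z \<Rightarrow> 'r"
  assumes S: "S \<subseteq> fc X"
    and S_ker: "s \<in> S \<Longrightarrow> lin w s = 0"
    and ker: "f \<in> fc X \<Longrightarrow> lin w f = 0 \<Longrightarrow> f \<in> rel_span X S"
    and G: "group G"
    and h_closed: "g \<in> carrier G \<Longrightarrow> x \<in> X \<Longrightarrow> h g x \<in> X"
    and h_one: "x \<in> X \<Longrightarrow> h \<one>\<^bsub>G\<^esub> x = x"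
    and h_mult: "g \<in> carrier G \<Longrightarrow> g' \<in> carrier G \<Longrightarrow> x \<in> X \<Longrightarrow> h (g \<otimes>\<^bsub>G\<^esub> g') x = h g (h g' x)"
    and h_rel: "g \<in> carrier G \<Longrightarrow> s \<in> S \<Longrightarrow> push Rc (h g) s \<in> rel_span X S"
begin

definition "P = presented_gmodule Rc X S h"

text \<open>By the kernel condition the cosets are the fibres of \<open>lin w\<close>. The function
  \<open>bar\<close> below reads off the value on a fibre, so its choice of a member does not
  matter.\<close>

definition "cls f = {f' \<in> fc X. lin w f' = lin w f}"

definition "bar C = lin w (SOME f. f \<in> C)"

lemma rel_span_iff: "f \<in> rel_span X S \<longleftrightarrow> f \<in> fc X \<and> lin w f = 0"
  using ker rel_span_ker[OF S S_ker] rel_span_sub[OF S] by blast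

lemma coset_eq:
  assumes "f \<in> fc X"
  shows "rel_span X S +>\<^bsub>free_module Rc X\<^esub> f = cls f"
proof (intro equalityI subsetI)
  fix f' assume "f' \<in> rel_span X S +>\<^bsub>free_module Rc X\<^esub> f"
  then obtain r where "r \<in> rel_span X S" "f' = r + f" by (auto simp: a_r_coset_def')
  then show "f' \<in> cls f" using assms by (auto simp: rel_span_iff cls_def lin_add[of _ X] fc_add)
next
  fix f' assume f': "f' \<in> cls f"
  then have "f' - f \<in> rel_span X S" using assms by (auto simp: rel_span_iff cls_def lin_diff[of _ X] fc_diff)
  then show "f' \<in> rel_span X S +>\<^bsub>free_module Rc X\<^esub> f"
    by (auto simp: a_r_coset_def' intro!: bexI[of _ "f' - f"])
qed

lemma carrier_P: "carrier P = cls ` fc X"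
proof -
  have "carrier P = (\<lambda>f. rel_span X S +>\<^bsub>free_module Rc X\<^esub> f) ` fc X"
    by (auto simp: P_def presented_gmodule_def Let_def A_RCOSETS_def' rel_span_def[OF S])
  also have "\<dots> = cls ` fc X" by (intro image_cong) (auto simp: coset_eq)
  finally show ?thesis .
qed

lemma cls_self: "f \<in> fc X \<Longrightarrow> f \<in> cls f"
  by (simp add: cls_def)

lemma bar_cls [simp]:
  assumes "f \<in> fc X"
  shows "bar (cls f) = lin w f"
proof -
  have "(SOME f'. f' \<in> cls f) \<in> cls f" using cls_self[OF assms] by (rule someI[where P = "\<lambda>f'. f' \<in> cls f"])
  then show ?thesis by (simp add: bar_def cls_def)
qed

lemma zero_P: "\<zero>\<^bsub>P\<^esub> = cls 0"
proof -
  have "\<zero>\<^bsub>P\<^esub> = rel_span X S" by (simp add: P_def presented_gmodule_def Let_def rel_span_def[OF S])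
  also have "\<dots> = cls 0" by (auto simp: rel_span_iff cls_def)
  finally show ?thesis .
qed

lemma add_P:
  assumes f: "f \<in> fc X" and g: "g \<in> fc X"
  shows "cls f \<oplus>\<^bsub>P\<^esub> cls g = cls (f + g)"
proof -
  have "cls f \<oplus>\<^bsub>P\<^esub> cls g = {u + v | u v. u \<in> cls f \<and> v \<in> cls g}"
    by (auto simp: P_def presented_gmodule_def Let_def set_add_def')
  also have "\<dots> = cls (f + g)"
  proof (intro equalityI subsetI)
    fix e assume e: "e \<in> cls (f + g)"
    then have "e - f \<in> cls g" using f g by (auto simp: cls_def lin_diff[of _ X] lin_add[of _ X] fc_diff)
    moreover have "e = f + (e - f)" by simp
    ultimately show "e \<in> {u + v | u v. u \<in> cls f \<and> v \<in> cls g}" using cls_self[OF f] by blast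
  qed (use f g in \<open>auto simp: cls_def lin_add[of _ X] fc_add\<close>)
  finally show ?thesis .
qed

lemma smult_P:
  assumes f: "f \<in> fc X"
  shows "a \<odot>\<^bsub>P\<^esub> cls f = cls (sc a f)"
proof -
  have "a \<odot>\<^bsub>P\<^esub> cls f = (\<Union>f'\<in>cls f. rel_span X S +>\<^bsub>free_module Rc X\<^esub> sc a f')"
    by (simp add: P_def presented_gmodule_def Let_def rel_span_def[OF S])
  also have "\<dots> = (\<Union>f'\<in>cls f. cls (sc a f))"
    by (intro SUP_cong refl) (use f in \<open>auto simp: cls_def coset_eq fc_sc lin_sc[of _ X]\<close>)
  also have "\<dots> = cls (sc a f)" using cls_self[OF f] by blast
  finally show ?thesis .
qed

lemma push_h_closed: "g \<in> carrier G \<Longrightarrow> f \<in> fc X \<Longrightarrow> push Rc (h g) f \<in> fc X"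
  using h_closed by (intro push_closed[of f X]) auto

lemma push_rel_span:
  assumes g: "g \<in> carrier G" and f: "f \<in> rel_span X S"
  shows "push Rc (h g) f \<in> rel_span X S"
proof -
  have "rel_span X S \<subseteq> {f \<in> fc X. push Rc (h g) f \<in> rel_span X S}"
    by (rule rel_span_least[OF S])
      (use S h_rel g in \<open>auto simp: push_simps[of _ X] rel_span_zero[OF S] intro: fc_add fc_sc rel_span_add[OF S] rel_span_sc[OF S]\<close>)
  then show ?thesis using f by blast
qed

lemma push_cls:
  assumes g: "g \<in> carrier G" and f: "f \<in> fc X" and f': "f' \<in> cls f"
  shows "push Rc (h g) f' \<in> cls (push Rc (h g) f)"
proof -
  have fX: "f' \<in> fc X" using f' by (simp add: cls_def)
  have "f' - f \<in> rel_span X S" using f f' by (auto simp: rel_span_iff cls_def lin_diff[of _ X] fc_diff)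
  then have "push Rc (h g) f' - push Rc (h g) f \<in> rel_span X S"
    using push_rel_span[OF g] f fX by (simp flip: push_diff[of _ X])
  then show ?thesis using g f fX
    by (auto simp: rel_span_iff cls_def lin_diff[of _ X] push_h_closed)
qed

lemma push_push_h:
  assumes "g \<in> carrier G" "g' \<in> carrier G" "f \<in> fc X"
  shows "push Rc (h g) (push Rc (h g') f) = push Rc (h (g \<otimes>\<^bsub>G\<^esub> g')) f"
  unfolding push_push[OF assms(3)]
  by (rule push_cong[OF assms(3)]) (simp add: h_mult assms)

lemma push_h_one: "f \<in> fc X \<Longrightarrow> push Rc (h \<one>\<^bsub>G\<^esub>) f = f"
  using push_cong[of f X "h \<one>\<^bsub>G\<^esub>" "\<lambda>x. x"] by (simp add: h_one push_id)

text \<open>The action takes images of cosets. That such an image fills a whole coset, and not just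
  a part of it, is seen by pushing back with the inverse group element.\<close>

lemma act_P:
  assumes g: "g \<in> carrier G" and f: "f \<in> fc X"
  shows "act P g (cls f) = cls (push Rc (h g) f)"
proof -
  interpret group G by (rule G)
  have "act P g (cls f) = push Rc (h g) ` cls f"
    using f carrier_P by (auto simp: P_def presented_gmodule_def Let_def)
  also have "\<dots> = cls (push Rc (h g) f)"
  proof (intro equalityI subsetI)
    fix e assume e: "e \<in> cls (push Rc (h g) f)"
    then have eX: "e \<in> fc X" by (simp add: cls_def)
    let ?i = "inv\<^bsub>G\<^esub> g"
    have "push Rc (h ?i) e \<in> cls (push Rc (h ?i) (push Rc (h g) f))"
      using g f e by (intro push_cls push_h_closed) auto
    also have "push Rc (h ?i) (push Rc (h g) f) = f"
      using g f by (simp add: push_push_h push_h_one)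
    finally have "push Rc (h ?i) e \<in> cls f" .
    moreover have "e = push Rc (h g) (push Rc (h ?i) e)"
      using g eX by (simp add: push_push_h push_h_one)
    ultimately show "e \<in> push Rc (h g) ` cls f" by blast
  qed (use push_cls[OF g f] in blast)
  finally show ?thesis .
qed

lemma cls_eq_iff: "f \<in> fc X \<Longrightarrow> g \<in> fc X \<Longrightarrow> cls f = cls g \<longleftrightarrow> lin w f = lin w g"
  by (auto simp: cls_def)

lemma inj_bar: "inj_on bar (carrier P)"
  by (rule inj_onI) (clarsimp simp: carrier_P cls_eq_iff)

lemma bar_image: "bar ` carrier P = lin w ` fc X"
  by (auto simp: carrier_P image_image)

lemma bar_add: "C \<in> carrier P \<Longrightarrow> D \<in> carrier P \<Longrightarrow> bar (C \<oplus>\<^bsub>P\<^esub> D) = bar C + bar D"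
  by (auto simp: carrier_P add_P fc_add lin_add[of _ X])

lemma bar_smult: "C \<in> carrier P \<Longrightarrow> bar (a \<odot>\<^bsub>P\<^esub> C) = sc a (bar C)"
  by (auto simp: carrier_P smult_P fc_sc lin_sc[of _ X])

lemma gmodule_P: "gmodule Rc G P"
proof (rule gmoduleI[OF _ G])
  show "Module.module Rc P"
  proof (rule moduleI)
    show "abelian_group P"
    proof (rule abelian_groupI)
      fix C assume "C \<in> carrier P"
      then obtain f where f: "f \<in> fc X" "C = cls f" by (auto simp: carrier_P)
      then have "cls (- f) \<oplus>\<^bsub>P\<^esub> C = \<zero>\<^bsub>P\<^esub>" "cls (- f) \<in> carrier P"
        by (simp_all add: carrier_P add_P zero_P fc_neg)
      then show "\<exists>D\<in>carrier P. D \<oplus>\<^bsub>P\<^esub> C = \<zero>\<^bsub>P\<^esub>" by blast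
    qed (auto simp: carrier_P add_P zero_P fc_add ac_simps)
  qed (auto simp: carrier_P add_P smult_P zero_P fc_add fc_sc cring_class sc_add_left sc_add_right class_simps)
  show "act P g \<in> extensional (carrier P)" for g
    by (simp add: P_def presented_gmodule_def Let_def)
  show "act P \<one>\<^bsub>G\<^esub> C = C" if "C \<in> carrier P" for C
    using that group.is_monoid[OF G] by (auto simp: carrier_P act_P monoid.one_closed push_h_one)
  show "act P (g \<otimes>\<^bsub>G\<^esub> g') C = act P g (act P g' C)"
    if "g \<in> carrier G" "g' \<in> carrier G" "C \<in> carrier P" for g g' C
    using that monoid.m_closed[OF group.is_monoid[OF G]] by (auto simp: carrier_P act_P push_h_closed push_push_h)
qed (auto simp: carrier_P add_P smult_P act_P fc_add fc_sc push_simps[of _ X] push_h_closed)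

end

section \<open>Coordinates and exterior powers\<close>

text \<open>A basis of M indexed by D, encoded by its coordinate isomorphism, which makes transport
  between types easier than a set of basis elements would.\<close>

definition coords :: "('r::comm_ring_1, 'm, 'g) gmodule \<Rightarrow> 'i set \<Rightarrow> ('m \<Rightarrow> 'i \<Rightarrow> 'r) \<Rightarrow> bool"
  where "coords M D \<kappa> \<longleftrightarrow> bij_betw \<kappa> (carrier M) (fc D) \<and>
    (\<forall>x\<in>carrier M. \<forall>y\<in>carrier M. \<kappa> (x \<oplus>\<^bsub>M\<^esub> y) = \<kappa> x + \<kappa> y) \<and>
    (\<forall>a. \<forall>x\<in>carrier M. \<kappa> (a \<odot>\<^bsub>M\<^esub> x) = sc a (\<kappa> x))"

lemma coords_add: "coords M D \<kappa> \<Longrightarrow> x \<in> carrier M \<Longrightarrow> y \<in> carrier M \<Longrightarrow> \<kappa> (x \<oplus>\<^bsub>M\<^esub> y) = \<kappa> x + \<kappa> y"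
  and coords_smult: "coords M D \<kappa> \<Longrightarrow> x \<in> carrier M \<Longrightarrow> \<kappa> (a \<odot>\<^bsub>M\<^esub> x) = sc a (\<kappa> x)"
  and coords_inj: "coords M D \<kappa> \<Longrightarrow> x \<in> carrier M \<Longrightarrow> y \<in> carrier M \<Longrightarrow> \<kappa> x = \<kappa> y \<Longrightarrow> x = y"
  and coords_in: "coords M D \<kappa> \<Longrightarrow> x \<in> carrier M \<Longrightarrow> \<kappa> x \<in> fc D"
  and coords_surj: "coords M D \<kappa> \<Longrightarrow> v \<in> fc D \<Longrightarrow> \<exists>x\<in>carrier M. v = \<kappa> x"
  unfolding coords_def bij_betw_def by (blast dest: inj_onD)+

lemma coords_finsum:
  fixes M :: "('r::comm_ring_1, 'm, 'g) gmodule"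
  assumes M: "Module.module Rc M" and \<kappa>: "coords M D \<kappa>" and "finite A" "u \<in> A \<rightarrow> carrier M"
  shows "\<kappa> (finsum M u A) = (\<Sum>b\<in>A. \<kappa> (u b))"
proof -
  interpret Module.module "Rc :: 'r ring" M by (rule M)
  have "\<kappa> (0 \<odot>\<^bsub>M\<^esub> \<zero>\<^bsub>M\<^esub>) = 0" using coords_smult[OF \<kappa>, of "\<zero>\<^bsub>M\<^esub>" 0] by simp
  then have z: "\<kappa> \<zero>\<^bsub>M\<^esub> = 0" using smult_r_null[of 0] by (simp add: carrier_class)
  show ?thesis
    using assms(3,4)
  proof (induction A rule: finite_induct)
    case (insert b A)
    then show ?case by (simp add: coords_add[OF \<kappa>] Pi_iff)
  qed (simp add: z)
qed

text \<open>The preimages \<open>\<beta> i\<close> of the unit vectors form the basis. By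
  \<open>iff\<close>, the coefficients of x in it are forced to be its coordinates.\<close>

lemma coords_finite_basis:
  fixes M :: "('r::comm_ring_1, 'm, 'g) gmodule"
  assumes M: "Module.module Rc M" and \<kappa>: "coords M D \<kappa>" and D: "finite D"
  shows "\<exists>B. finite_basis Rc M B"
proof -
  interpret Module.module "Rc :: 'r ring" M by (rule M)
  have "\<forall>i\<in>D. \<exists>b. b \<in> carrier M \<and> \<kappa> b = bs i" using coords_surj[OF \<kappa>] fc_bs by metis
  then obtain \<beta> where \<beta>: "\<And>i. i \<in> D \<Longrightarrow> \<beta> i \<in> carrier M" "\<And>i. i \<in> D \<Longrightarrow> \<kappa> (\<beta> i) = bs i" by metis
  have inj: "inj_on \<beta> D"
  proof (rule inj_onI)
    fix i j assume "i \<in> D" "j \<in> D" "\<beta> i = \<beta> j"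
    then have "(bs i :: 'a \<Rightarrow> 'r) = bs j" using \<beta>(2) by metis
    then show "i = j" unfolding bs_def by (metis zero_neq_one)
  qed
  have iff: "x = (\<Oplus>\<^bsub>M\<^esub>b\<in>\<beta> ` D. c b \<odot>\<^bsub>M\<^esub> b) \<longleftrightarrow> (\<forall>i\<in>D. \<kappa> x i = c (\<beta> i))" if x: "x \<in> carrier M" for x c
  proof -
    have cl: "(\<lambda>b. c b \<odot>\<^bsub>M\<^esub> b) \<in> \<beta> ` D \<rightarrow> carrier M" using \<beta>(1) by (auto simp: carrier_class)
    have y: "(\<Oplus>\<^bsub>M\<^esub>b\<in>\<beta> ` D. c b \<odot>\<^bsub>M\<^esub> b) \<in> carrier M" using cl by (rule M.finsum_closed)
    have "\<kappa> (\<Oplus>\<^bsub>M\<^esub>b\<in>\<beta> ` D. c b \<odot>\<^bsub>M\<^esub> b) = (\<Sum>b\<in>\<beta> ` D. \<kappa> (c b \<odot>\<^bsub>M\<^esub> b))"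
      using D cl by (intro coords_finsum[OF M \<kappa>]) auto
    also have "\<dots> = (\<Sum>i\<in>D. sc (c (\<beta> i)) (bs i))"
      using \<beta> by (simp add: sum.reindex[OF inj] coords_smult[OF \<kappa>])
    finally have ky: "\<kappa> (\<Oplus>\<^bsub>M\<^esub>b\<in>\<beta> ` D. c b \<odot>\<^bsub>M\<^esub> b) = (\<Sum>i\<in>D. sc (c (\<beta> i)) (bs i))" .
    have "(\<Sum>i\<in>D. sc (c (\<beta> i)) (bs i)) j = (if j \<in> D then c (\<beta> j) else 0)" for j
    proof -
      have "(\<Sum>i\<in>D. sc (c (\<beta> i)) (bs i)) j = (\<Sum>i\<in>D. if i = j then c (\<beta> j) else 0)"
        unfolding sum_fun_apply by (intro sum.cong) (auto simp: sc_apply bs_def)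
      then show ?thesis using D by simp
    qed
    then have "\<kappa> x = \<kappa> (\<Oplus>\<^bsub>M\<^esub>b\<in>\<beta> ` D. c b \<odot>\<^bsub>M\<^esub> b) \<longleftrightarrow> (\<forall>i\<in>D. \<kappa> x i = c (\<beta> i))"
      unfolding ky using coords_in[OF \<kappa> x] by (auto simp: fun_eq_iff fc_def)
    then show ?thesis using coords_inj[OF \<kappa> x y] by metis
  qed
  have "finite_basis Rc M (\<beta> ` D)"
    unfolding finite_basis_def
  proof (intro conjI ballI)
    fix x assume x: "x \<in> carrier M"
    let ?c = "\<lambda>b\<in>\<beta> ` D. \<kappa> x (the_inv_into D \<beta> b)"
    show "\<exists>!c. c \<in> \<beta> ` D \<rightarrow>\<^sub>E carrier Rc \<and> x = (\<Oplus>\<^bsub>M\<^esub>b\<in>\<beta> ` D. c b \<odot>\<^bsub>M\<^esub> b)"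
    proof (rule ex1I[of _ ?c])
      show "?c \<in> \<beta> ` D \<rightarrow>\<^sub>E carrier Rc \<and> x = (\<Oplus>\<^bsub>M\<^esub>b\<in>\<beta> ` D. ?c b \<odot>\<^bsub>M\<^esub> b)"
        unfolding iff[OF x] by (auto simp: carrier_class the_inv_into_f_f[OF inj])
    next
      fix c assume c: "c \<in> \<beta> ` D \<rightarrow>\<^sub>E carrier Rc \<and> x = (\<Oplus>\<^bsub>M\<^esub>b\<in>\<beta> ` D. c b \<odot>\<^bsub>M\<^esub> b)"
      show "c = ?c"
      proof (rule extensionalityI[of _ "\<beta> ` D"])
        show "c \<in> extensional (\<beta> ` D)" using c by (simp add: PiE_def)
        fix b assume "b \<in> \<beta> ` D"
        then show "c b = ?c b" using c unfolding iff[OF x] by (auto simp: the_inv_into_f_f[OF inj])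
      qed simp
    qed
  qed (use D \<beta> in auto)
  then show ?thesis by blast
qed

text \<open>The linear combination map \<open>\<psi>\<close> is bijective on coefficient vectors by
  the basis property, and its inverse is the coordinate map.\<close>

lemma finite_basis_coords:
  fixes M :: "('r::comm_ring_1, 'm, 'g) gmodule"
  assumes M: "Module.module Rc M" and B: "finite_basis Rc M B"
  obtains \<kappa> where "coords M B \<kappa>"
proof -
  interpret Module.module "Rc :: 'r ring" M by (rule M)
  have fin: "finite B" and BM: "B \<subseteq> carrier M"
    and ex: "\<And>x. x \<in> carrier M \<Longrightarrow> \<exists>!c. c \<in> B \<rightarrow>\<^sub>E carrier Rc \<and> x = (\<Oplus>\<^bsub>M\<^esub>b\<in>B. c b \<odot>\<^bsub>M\<^esub> b)"
    using B by (auto simp: finite_basis_def)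
  define \<psi> where "\<psi> v = (\<Oplus>\<^bsub>M\<^esub>b\<in>B. v b \<odot>\<^bsub>M\<^esub> b)" for v :: "'m \<Rightarrow> 'r"
  have cl: "(\<lambda>b. v b \<odot>\<^bsub>M\<^esub> b) \<in> B \<rightarrow> carrier M" for v using BM by (auto simp: carrier_class)
  have closed: "\<psi> v \<in> carrier M" for v unfolding \<psi>_def using cl by (rule M.finsum_closed)
  have cong: "\<psi> v = \<psi> v'" if "\<And>b. b \<in> B \<Longrightarrow> v b = v' b" for v v'
    unfolding \<psi>_def using cl that by (intro M.finsum_cong') auto
  have bij: "bij_betw \<psi> (fc B) (carrier M)"
  proof (rule bij_betwI')
    fix v v' :: "'m \<Rightarrow> 'r" assume v: "v \<in> fc B" "v' \<in> fc B"
    show "(\<psi> v = \<psi> v') = (v = v')"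
    proof
      assume eq: "\<psi> v = \<psi> v'"
      \<comment> \<open>Uniqueness in \<open>finite_basis\<close> concerns coefficient functions
        that are undefined outside \<open>B\<close>, whereas members of \<open>fc B\<close> are zero
        there; so only the restrictions to \<open>B\<close> are compared.\<close>
      have "restrict v B = restrict v' B"
        using ex1_implies_ex[OF ex[OF closed[of v]]] ex[OF closed[of v]] cong[of v "restrict v B"] cong[of v' "restrict v' B"] eq
        by (elim ex1E) (metis (no_types, lifting) \<psi>_def carrier_class restrict_PiE restrict_apply' PiE_restrict restrict_PiE_iff)
      then have "v b = v' b" if "b \<in> B" for b using that by (metis restrict_apply')
      moreover have "v b = v' b" if "b \<notin> B" for b
      proof -
        have "v b = 0" "v' b = 0" using v that unfolding fc_def by blast+
        then show ?thesis by simp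
      qed
      ultimately show "v = v'" by blast
    qed simp
  next
    fix x assume "x \<in> carrier M"
    then obtain c where c: "x = \<psi> c" using ex unfolding \<psi>_def by blast
    let ?v = "\<lambda>b. if b \<in> B then c b else 0"
    have "?v \<in> fc B" using fin by (auto simp: fc_def elim: finite_subset[rotated])
    moreover have "x = \<psi> ?v" unfolding c by (rule cong) simp
    ultimately show "\<exists>v\<in>fc B. x = \<psi> v" by blast
  qed (rule closed)
  have add: "\<psi> (v + v') = \<psi> v \<oplus>\<^bsub>M\<^esub> \<psi> v'" for v v'
  proof -
    have "\<psi> (v + v') = (\<Oplus>\<^bsub>M\<^esub>b\<in>B. v b \<odot>\<^bsub>M\<^esub> b \<oplus>\<^bsub>M\<^esub> v' b \<odot>\<^bsub>M\<^esub> b)"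
      unfolding \<psi>_def using BM cl
      by (intro M.finsum_cong') (auto simp: plus_fun_apply smult_l_distr[simplified plus_class carrier_class] Pi_iff subset_iff carrier_class)
    then show ?thesis using M.finsum_addf[OF cl cl] by (simp add: \<psi>_def)
  qed
  have smult: "\<psi> (sc a v) = a \<odot>\<^bsub>M\<^esub> \<psi> v" for a v
  proof -
    have "\<psi> (sc a v) = (\<Oplus>\<^bsub>M\<^esub>b\<in>B. a \<odot>\<^bsub>M\<^esub> (v b \<odot>\<^bsub>M\<^esub> b))"
      unfolding \<psi>_def using BM cl
      by (intro M.finsum_cong') (auto simp: sc_apply smult_assoc1[simplified times_class carrier_class] Pi_iff subset_iff carrier_class)
    then show ?thesis using finsum_smult_ldistr[OF fin _ cl, of a v] by (simp add: \<psi>_def carrier_class)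
  qed
  define \<kappa> where "\<kappa> = the_inv_into (fc B) \<psi>"
  have \<kappa>b: "bij_betw \<kappa> (carrier M) (fc B)" unfolding \<kappa>_def by (rule bij_betw_the_inv_into[OF bij])
  have \<psi>\<kappa>: "\<psi> (\<kappa> x) = x" if "x \<in> carrier M" for x
    unfolding \<kappa>_def by (rule f_the_inv_into_f_bij_betw[OF bij that])
  have \<kappa>\<psi>: "\<kappa> (\<psi> v) = v" if "v \<in> fc B" for v
    unfolding \<kappa>_def using bij that by (intro the_inv_into_f_f) (auto simp: bij_betw_def)
  have in_fc: "\<kappa> x \<in> fc B" if "x \<in> carrier M" for x using \<kappa>b that by (auto simp: bij_betw_def)
  have "coords M B \<kappa>"
    unfolding coords_def
  proof (intro conjI ballI allI)
    fix x y assume xy: "x \<in> carrier M" "y \<in> carrier M"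
    show "\<kappa> (x \<oplus>\<^bsub>M\<^esub> y) = \<kappa> x + \<kappa> y"
      using \<kappa>\<psi>[OF fc_add[OF in_fc[OF xy(1)] in_fc[OF xy(2)]]] \<psi>\<kappa> xy by (simp add: add)
  next
    fix a x assume x: "x \<in> carrier M"
    show "\<kappa> (a \<odot>\<^bsub>M\<^esub> x) = sc a (\<kappa> x)"
      using \<kappa>\<psi>[OF fc_sc[OF in_fc[OF x], of a]] \<psi>\<kappa> x by (simp add: smult)
  qed (rule \<kappa>b)
  then show ?thesis using that by blast
qed

lemma W_eq_fc: "W d k = fc {I. I \<subseteq> {..<d} \<and> card I = k}"
proof -
  have fin: "finite {I :: nat set. I \<subseteq> {..<d} \<and> card I = k}" by (rule finite_subset[of _ "Pow {..<d}"]) auto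
  show ?thesis by (auto simp: W_def fc_def intro: finite_subset[OF _ fin])
qed

section \<open>The exterior power of a free module\<close>

locale ext_power =
  fixes G :: "'g monoid" and M :: "('r::comm_ring_1, 'm, 'g) gmodule" and d k :: nat
    and \<kappa> :: "'m \<Rightarrow> nat \<Rightarrow> 'r"
  assumes M: "gmodule Rc G M" and \<kappa>: "coords M {..<d} \<kappa>" and d: "d > 0"
begin

sublocale gmodule Rc G M by (rule M)

abbreviation "X \<equiv> tuples M k"
abbreviation "S \<equiv> exterior_relations Rc k M"

definition "w ms = wedge d (map \<kappa> ms)"

lemma smult_closed' [simp]: "x \<in> carrier M \<Longrightarrow> a \<odot>\<^bsub>M\<^esub> x \<in> carrier M"
  by (simp add: carrier_class)

lemma tuples_update [simp]: "ms \<in> X \<Longrightarrow> x \<in> carrier M \<Longrightarrow> ms[i := x] \<in> X"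
  using set_update_subset_insert[of ms i x] by (auto simp: tuples_def)

lemma S_eq: "S = {bs (ms[i := x \<oplus>\<^bsub>M\<^esub> y]) - (bs (ms[i := x]) + bs (ms[i := y])) | ms i x y.
      ms \<in> X \<and> i < k \<and> x \<in> carrier M \<and> y \<in> carrier M} \<union>
    {bs (ms[i := a \<odot>\<^bsub>M\<^esub> x]) - sc a (bs (ms[i := x])) | ms i a x. ms \<in> X \<and> i < k \<and> x \<in> carrier M} \<union>
    {bs ms | ms. ms \<in> X \<and> \<not> distinct ms}"
proof -
  have 1: "bs (ms[i := x \<oplus>\<^bsub>M\<^esub> y]) \<ominus>\<^bsub>free_module Rc X\<^esub> (bs (ms[i := x]) + bs (ms[i := y])) =
      bs (ms[i := x \<oplus>\<^bsub>M\<^esub> y]) - (bs (ms[i := x]) + bs (ms[i := y]) :: 'm list \<Rightarrow> 'r)"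
    if "ms \<in> X" "x \<in> carrier M" "y \<in> carrier M" for ms i x y
    using that by (intro free_module_minus fc_add fc_bs) auto
  have 2: "bs (ms[i := a \<odot>\<^bsub>M\<^esub> x]) \<ominus>\<^bsub>free_module Rc X\<^esub> sc a (bs (ms[i := x])) =
      bs (ms[i := a \<odot>\<^bsub>M\<^esub> x]) - (sc a (bs (ms[i := x])) :: 'm list \<Rightarrow> 'r)"
    if "ms \<in> X" "x \<in> carrier M" for ms i a x
    using that by (intro free_module_minus fc_sc fc_bs) auto
  have s1: "{bs (ms[i := x \<oplus>\<^bsub>M\<^esub> y]) \<ominus>\<^bsub>free_module Rc X\<^esub> (bs (ms[i := x]) + bs (ms[i := y])) | ms i x y.
      ms \<in> X \<and> i < k \<and> x \<in> carrier M \<and> y \<in> carrier M} =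
    {bs (ms[i := x \<oplus>\<^bsub>M\<^esub> y]) - (bs (ms[i := x]) + bs (ms[i := y]) :: 'm list \<Rightarrow> 'r) | ms i x y.
      ms \<in> X \<and> i < k \<and> x \<in> carrier M \<and> y \<in> carrier M}"
    using 1 by (intro Collect_cong ex_cong1) auto
  have s2: "{bs (ms[i := a \<odot>\<^bsub>M\<^esub> x]) \<ominus>\<^bsub>free_module Rc X\<^esub> sc a (bs (ms[i := x])) | ms i a x.
      ms \<in> X \<and> i < k \<and> a \<in> carrier Rc \<and> x \<in> carrier M} =
    {bs (ms[i := a \<odot>\<^bsub>M\<^esub> x]) - sc a (bs (ms[i := x]) :: 'm list \<Rightarrow> 'r) | ms i a x. ms \<in> X \<and> i < k \<and> x \<in> carrier M}"
    using 2 by (intro Collect_cong ex_cong1) (auto simp: carrier_class)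
  show ?thesis
    unfolding exterior_relations_def Let_def free_gen_class free_module_simps s1 s2 ..
qed

lemma S_sub: "S \<subseteq> fc X"
  unfolding S_eq by (auto intro!: fc_diff fc_add fc_sc fc_bs)

lemma w_add:
  assumes "ms \<in> X" "i < k" "x \<in> carrier M" "y \<in> carrier M"
  shows "w (ms[i := x \<oplus>\<^bsub>M\<^esub> y]) = w (ms[i := x]) + w (ms[i := y])"
  using assms by (simp add: w_def map_update coords_add[OF \<kappa>] wedge_add tuples_def)

lemma w_smult:
  assumes "ms \<in> X" "i < k" "x \<in> carrier M"
  shows "w (ms[i := a \<odot>\<^bsub>M\<^esub> x]) = sc a (w (ms[i := x]))"
  using assms by (simp add: w_def map_update coords_smult[OF \<kappa>] wedge_sc tuples_def)

lemma w_not_distinct: "\<not> distinct ms \<Longrightarrow> w ms = 0"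
  unfolding w_def by (rule wedge_eq_0) (simp add: distinct_map)

lemma lin_w_S: "s \<in> S \<Longrightarrow> lin w s = 0"
  unfolding S_eq
  by (auto simp: lin_diff[of _ X] lin_add[of _ X] lin_sc[of _ X] fc_add fc_sc fc_bs w_add w_smult w_not_distinct)

abbreviation "N \<equiv> rel_span X S"

lemmas N_simps = rel_span_sub[OF S_sub] rel_span_zero[OF S_sub] rel_span_add[OF S_sub]
  rel_span_sc[OF S_sub] rel_span_gen[OF S_sub] rel_span_neg[OF S_sub] rel_span_diff[OF S_sub]

definition "ki v = (THE x. x \<in> carrier M \<and> \<kappa> x = v)"

lemma ki: "v \<in> fc {..<d} \<Longrightarrow> ki v \<in> carrier M \<and> \<kappa> (ki v) = v"
  unfolding ki_def by (rule theI') (use coords_surj[OF \<kappa>, of v] coords_inj[OF \<kappa>] in blast)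

lemma ki_\<kappa>: "x \<in> carrier M \<Longrightarrow> ki (\<kappa> x) = x"
  using ki[OF coords_in[OF \<kappa>]] coords_inj[OF \<kappa>] by blast

definition "\<beta> i = ki (bs i)"

lemma \<beta>: "i < d \<Longrightarrow> \<beta> i \<in> carrier M" "i < d \<Longrightarrow> \<kappa> (\<beta> i) = bs i"
  using ki[OF fc_bs, of i] by (simp_all add: \<beta>_def)

definition "idx = {I. I \<subseteq> {..<d} \<and> card I = k}"

text \<open>A linear right inverse of \<open>lin w\<close> on \<open>W d k\<close>: each basis
  product is lifted to the generator that lists its vectors in increasing order.\<close>

definition "sec (x :: nat set \<Rightarrow> 'r) = (\<Sum>I\<in>idx. sc (x I) (bs (map \<beta> (sorted_list_of_set I))))"

lemma sec_linear: "sec (x + y) = sec x + sec y" "sec (sc a x) = sc a (sec x)" "sec 0 = 0"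
  by (simp_all add: sec_def plus_fun_apply sc_apply zero_fun_apply sc_add_left sum.distrib sc_sum_right)

lemma basis_tuple: "set is \<subseteq> {..<d} \<Longrightarrow> length is = k \<Longrightarrow> map \<beta> is \<in> X"
  using \<beta>(1) by (auto simp: tuples_def)

lemma idx_tuple:
  assumes "I \<in> idx"
  shows "map \<beta> (sorted_list_of_set I) \<in> X"
proof -
  have "finite I" using assms finite_subset by (auto simp: idx_def)
  then show ?thesis using assms by (intro basis_tuple) (auto simp: idx_def)
qed

lemma sec_closed: "sec x \<in> fc X"
  unfolding sec_def by (intro fc_sum fc_sc fc_bs idx_tuple)

lemma w_basis:
  assumes "set is \<subseteq> {..<d}" "sorted_wrt (<) is"
  shows "w (map \<beta> is) = bs (set is)"
proof -
  have "map \<kappa> (map \<beta> is) = map bs is" using assms(1) \<beta>(2) by auto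
  then show ?thesis using wedge_bs[OF assms(2,1)] by (simp only: w_def)
qed

lemma w_idx:
  assumes "I \<in> idx"
  shows "w (map \<beta> (sorted_list_of_set I)) = bs I"
proof -
  have "finite I" using assms finite_subset by (auto simp: idx_def)
  then show ?thesis using assms w_basis[of "sorted_list_of_set I"] by (simp add: idx_def)
qed

lemma lin_w_sec:
  assumes "x \<in> W d k"
  shows "lin w (sec x) = x"
proof -
  have "lin w (\<Sum>I\<in>A. sc (x I) (bs (map \<beta> (sorted_list_of_set I)))) = (\<Sum>I\<in>A. sc (x I) (bs I))" if "A \<subseteq> idx" for A
    using that
  proof (induction A rule: infinite_finite_induct)
    case (insert I A)
    then have I: "I \<in> idx" "\<And>J. J \<in> A \<Longrightarrow> J \<in> idx" by auto
    have "(\<Sum>I\<in>A. sc (x I) (bs (map \<beta> (sorted_list_of_set I)))) \<in> fc X"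
      using I by (intro fc_sum fc_sc fc_bs idx_tuple)
    then show ?case using insert I(1)
      by (simp add: lin_add[of _ X] lin_sc[of _ X] fc_sc fc_bs idx_tuple w_idx)
  qed simp_all
  from this[of idx] show ?thesis
    unfolding sec_def by (rule trans[OF _ sym]) (use W_expand[OF assms] in \<open>simp_all add: idx_def\<close>)
qed

text \<open>The kernel of the wedge map is spanned by the relations because each generator agrees modulo
  the relations with its normal form, a combination of increasing products of basis vectors.\<close>

definition "Z ms = bs ms - sec (w ms)"

text \<open>Modulo the relations, \<open>Z\<close> is additive and homogeneous in each entry and
  vanishes on repetitions. This allows the reduction to tuples of basis vectors.\<close>

lemma Z_add:
  assumes "ms \<in> X" "i < k" "x \<in> carrier M" "y \<in> carrier M"
  shows "Z (ms[i := x \<oplus>\<^bsub>M\<^esub> y]) - Z (ms[i := x]) - Z (ms[i := y]) \<in> N"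
proof -
  have "bs (ms[i := x \<oplus>\<^bsub>M\<^esub> y]) - (bs (ms[i := x]) + bs (ms[i := y])) \<in> N"
    using assms by (intro subsetD[OF N_simps(5)]) (auto simp: S_eq)
  then show ?thesis using w_add[OF assms] by (simp add: Z_def sec_linear algebra_simps)
qed

lemma Z_smult:
  assumes "ms \<in> X" "i < k" "x \<in> carrier M" "Z (ms[i := x]) \<in> N"
  shows "Z (ms[i := a \<odot>\<^bsub>M\<^esub> x]) \<in> N"
proof -
  have "bs (ms[i := a \<odot>\<^bsub>M\<^esub> x]) - sc a (bs (ms[i := x])) \<in> N"
    using assms by (intro subsetD[OF N_simps(5)]) (auto simp: S_eq)
  then have "(bs (ms[i := a \<odot>\<^bsub>M\<^esub> x]) - sc a (bs (ms[i := x]))) + sc a (Z (ms[i := x])) \<in> N"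
    using assms(4) by (intro N_simps(3) N_simps(4))
  then show ?thesis using w_smult[OF assms(1-3)] by (simp add: Z_def sec_linear sc_diff_right)
qed

lemma Z_not_distinct:
  assumes "ms \<in> X" "\<not> distinct ms"
  shows "Z ms \<in> N"
proof -
  have "bs ms \<in> N" using assms by (intro subsetD[OF N_simps(5)]) (auto simp: S_eq)
  then show ?thesis using w_not_distinct[OF assms(2)] by (simp add: Z_def sec_linear)
qed

text \<open>Polarization: with x + y at both positions, \<open>Z\<close> lies in \<open>N\<close>.
  Expanding both entries, the terms with equal entries lie in \<open>N\<close> too, so if one mixed
  term does, then so does the other.\<close>

lemma Z_swap:
  assumes ms: "ms \<in> X" and ij: "i < k" "j < k" "i \<noteq> j" and Z: "Z ms \<in> N"
  shows "Z (ms[i := ms ! j, j := ms ! i]) \<in> N"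
proof -
  have len: "length ms = k" and set: "set ms \<subseteq> carrier M" using ms by (auto simp: tuples_def)
  define x where "x = ms ! i"
  define y where "y = ms ! j"
  have xy: "x \<in> carrier M" "y \<in> carrier M" using set len ij by (auto simp: x_def y_def)
  let ?m = "\<lambda>a b. Z (ms[i := a, j := b])"
  have sw: "ms[i := a, j := b] = ms[j := b, i := a]" for a b using ij(3) by (rule list_update_swap)
  have nd: "?m a a \<in> N" if "a \<in> carrier M" for a
  proof (rule Z_not_distinct)
    show "ms[i := a, j := a] \<in> X" using ms that by simp
    show "\<not> distinct (ms[i := a, j := a])"
    proof
      assume "distinct (ms[i := a, j := a])"
      then have "ms[i := a, j := a] ! i \<noteq> ms[i := a, j := a] ! j" using ij len by (subst nth_eq_iff_index_eq) auto
      then show False using ij len by simp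
    qed
  qed
  have "?m (x \<oplus>\<^bsub>M\<^esub> y) (x \<oplus>\<^bsub>M\<^esub> y) - ?m (x \<oplus>\<^bsub>M\<^esub> y) x - ?m (x \<oplus>\<^bsub>M\<^esub> y) y \<in> N"
    using ms xy ij by (intro Z_add) auto
  moreover have "?m (x \<oplus>\<^bsub>M\<^esub> y) x - ?m x x - ?m y x \<in> N" "?m (x \<oplus>\<^bsub>M\<^esub> y) y - ?m x y - ?m y y \<in> N"
    unfolding sw using ms xy ij by (intro Z_add; auto)+
  moreover have "?m (x \<oplus>\<^bsub>M\<^esub> y) (x \<oplus>\<^bsub>M\<^esub> y) \<in> N" "?m x x \<in> N" "?m y y \<in> N" using xy by (auto intro: nd)
  moreover have "?m x y \<in> N" using Z by (simp add: x_def y_def)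
  ultimately have "?m (x \<oplus>\<^bsub>M\<^esub> y) (x \<oplus>\<^bsub>M\<^esub> y) - (?m (x \<oplus>\<^bsub>M\<^esub> y) (x \<oplus>\<^bsub>M\<^esub> y) - ?m (x \<oplus>\<^bsub>M\<^esub> y) x - ?m (x \<oplus>\<^bsub>M\<^esub> y) y)
      - (?m (x \<oplus>\<^bsub>M\<^esub> y) x - ?m x x - ?m y x) - (?m (x \<oplus>\<^bsub>M\<^esub> y) y - ?m x y - ?m y y) - ?m x x - ?m y y - ?m x y \<in> N"
    by - (assumption | rule N_simps(7))+
  then show ?thesis by (simp add: x_def y_def)
qed

text \<open>A tuple of distinct basis vectors is sorted by transpositions, which
  \<open>Z_swap\<close> permits. For the sorted tuple \<open>Z\<close> is zero outright, since
  \<open>sec\<close> lifts its product to the same generator.\<close>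

lemma Z_basis:
  assumes "set is \<subseteq> {..<d}" "length is = k"
  shows "Z (map \<beta> is) \<in> N"
proof (cases "distinct is")
  case False
  then show ?thesis using assms by (intro Z_not_distinct basis_tuple) (auto simp: distinct_map)
next
  case True
  let ?s = "sort is"
  have fin: "set is \<in> idx" using assms distinct_card[OF True] by (simp add: idx_def)
  have "mset is = mset ?s" by simp
  then obtain p where p: "p permutes {..<length ?s}" "permute_list p ?s = is"
    using mset_eq_permutation by blast
  have "Z (map \<beta> (permute_list p ?s)) \<in> N"
    using finite_lessThan p(1)
  \<comment> \<open>The reverse rule composes transpositions on the right, and by
    \<open>permute_list_compose\<close> this swaps two positions of the list already
    permuted.\<close>
  proof (induction rule: permutes_rev_induct)
    case id
    have ss: "sorted_list_of_set (set is) = ?s"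
      using True by (simp add: sorted_list_of_set_sort_remdups distinct_remdups_id)
    have ws: "w (map \<beta> ?s) = bs (set is)"
      using assms True w_basis[of ?s] by (simp add: strict_sorted_iff)
    have "sec (bs (set is)) = (\<Sum>I\<in>idx. if I = set is then bs (map \<beta> ?s) else 0)"
      unfolding sec_def by (intro sum.cong) (auto simp: bs_def[of "set is"] ss)
    moreover have "finite idx" unfolding idx_def by (rule finite_subset[of _ "Pow {..<d}"]) auto
    ultimately have "sec (bs (set is)) = bs (map \<beta> ?s)" using fin by simp
    then have "Z (map \<beta> ?s) = 0" by (simp only: Z_def ws diff_self)
    then show ?case using N_simps(2) by simp
  next
    case (swap a b p)
    let ?l = "permute_list p ?s"
    have len: "length ?s = k" using assms by simp
    have t: "Transposition.transpose a b permutes {..<length ?s}" using swap by (intro permutes_swap_id)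
    have "map \<beta> (permute_list (p \<circ> Transposition.transpose a b) ?s) = map \<beta> (permute_list (Transposition.transpose a b) ?l)"
      by (simp only: permute_list_compose[OF t])
    also have "\<dots> = (map \<beta> ?l)[a := map \<beta> ?l ! b, b := map \<beta> ?l ! a]"
      using swap t by (intro nth_equalityI) (auto simp: permute_list_nth nth_list_update transpose_def)
    finally have eq: "map \<beta> (permute_list (p \<circ> Transposition.transpose a b) ?s) =
      (map \<beta> ?l)[a := map \<beta> ?l ! b, b := map \<beta> ?l ! a]" .
    have l: "map \<beta> ?l \<in> X" using swap assms by (intro basis_tuple) (simp_all add: set_permute_list)
    have ab: "a < k" "b < k" using swap(1,2) len by simp_all
    show ?case unfolding eq by (rule Z_swap[OF l ab swap.hyps(3) swap.IH])
  qed
  then show ?thesis using p(2) by simp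
qed

text \<open>Induction on the number \<open>j\<close> of leading entries that may be arbitrary, all
  later ones being basis vectors. The step expands the entry at position \<open>j\<close> in the
  basis.\<close>

lemma Z_all:
  assumes "ms \<in> X"
  shows "Z ms \<in> N"
proof -
  have "\<forall>ms\<in>X. (\<forall>i. j \<le> i \<and> i < k \<longrightarrow> ms ! i \<in> \<beta> ` {..<d}) \<longrightarrow> Z ms \<in> N" if "j \<le> k" for j
    using that
  proof (induction j)
    case 0
    show ?case
    proof (intro ballI impI)
      fix ms assume ms: "ms \<in> X" "\<forall>i. 0 \<le> i \<and> i < k \<longrightarrow> ms ! i \<in> \<beta> ` {..<d}"
      then have len: "length ms = k" by (simp add: tuples_def)
      then have "\<forall>i. \<exists>a. i < k \<longrightarrow> a < d \<and> ms ! i = \<beta> a" using ms(2) by fastforce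
      then obtain f where f: "\<And>i. i < k \<Longrightarrow> f i < d \<and> ms ! i = \<beta> (f i)" by metis
      have eq: "ms = map \<beta> (map f [0..<k])" using f len by (intro nth_equalityI) auto
      show "Z ms \<in> N" by (subst eq, rule Z_basis) (use f in auto)
    qed
  next
    case (Suc j)
    show ?case
    proof (intro ballI impI)
      fix ms assume ms: "ms \<in> X" "\<forall>i. Suc j \<le> i \<and> i < k \<longrightarrow> ms ! i \<in> \<beta> ` {..<d}"
      have len: "length ms = k" using ms by (simp add: tuples_def)
      have jk: "j < k" using Suc.prems by simp
      have b: "Z (ms[j := \<beta> i]) \<in> N" if "i < d" for i
      proof -
        have "ms[j := \<beta> i] \<in> X" using ms(1) \<beta>(1)[OF that] by simp
        moreover have "\<forall>l. j \<le> l \<and> l < k \<longrightarrow> ms[j := \<beta> i] ! l \<in> \<beta> ` {..<d}"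
          using ms(2) that len by (auto simp: nth_list_update)
        ultimately show ?thesis using Suc by auto
      qed
      have "Z (ms[j := ki v]) \<in> N" if "v \<in> fc {..<d}" for v
        using that
      proof (induction rule: fc_induct)
        case zero
        \<comment> \<open>The zero vector is treated as a multiple of a basis vector, for which the
          claim is already known; d > 0 provides one.\<close>
        have "ki 0 = 0 \<odot>\<^bsub>M\<^esub> \<beta> 0"
          using coords_smult[OF \<kappa> \<beta>(1)[OF d], of 0] ki_\<kappa>[of "0 \<odot>\<^bsub>M\<^esub> \<beta> 0"] \<beta>(1)[OF d] by simp
        then show ?case using Z_smult[OF ms(1) jk \<beta>(1)[OF d] b[OF d], of 0] by simp
      next
        case (gen i)
        then show ?case using b[of i] by (simp add: \<beta>_def)
      next
        case (add f g)
        have "ki (f + g) = ki f \<oplus>\<^bsub>M\<^esub> ki g"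
          using ki[OF add(1)] ki[OF add(2)] coords_add[OF \<kappa>, of "ki f" "ki g"] ki_\<kappa>[of "ki f \<oplus>\<^bsub>M\<^esub> ki g"] by simp
        then have "Z (ms[j := ki (f + g)]) - Z (ms[j := ki f]) - Z (ms[j := ki g]) \<in> N"
          using Z_add[OF ms(1) jk, of "ki f" "ki g"] ki[OF add(1)] ki[OF add(2)] by simp
        then have "(Z (ms[j := ki (f + g)]) - Z (ms[j := ki f]) - Z (ms[j := ki g])) + Z (ms[j := ki f]) + Z (ms[j := ki g]) \<in> N"
          using add by (intro N_simps(3))
        then show ?case by simp
      next
        case (sc a f)
        have "ki (sc a f) = a \<odot>\<^bsub>M\<^esub> ki f"
          using ki[OF sc(1)] coords_smult[OF \<kappa>, of "ki f" a] ki_\<kappa>[of "a \<odot>\<^bsub>M\<^esub> ki f"] by simp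
        then show ?case using Z_smult[OF ms(1) jk _ sc(2), of a] ki[OF sc(1)] by simp
      qed
      moreover have "ms ! j \<in> carrier M" using ms(1) len jk by (auto simp: tuples_def)
      ultimately have "Z (ms[j := ms ! j]) \<in> N" using coords_in[OF \<kappa>, of "ms ! j"] ki_\<kappa>[of "ms ! j"] by metis
      then show "Z ms \<in> N" by simp
    qed
  qed
  from this[of k] show ?thesis using assms by auto
qed

lemma ker_w:
  assumes "f \<in> fc X" "lin w f = 0"
  shows "f \<in> N"
proof -
  have "f - sec (lin w f) \<in> N"
    using assms(1)
  proof (induction rule: fc_induct)
    case zero
    then show ?case using N_simps(2) by (simp add: sec_linear)
  next
    case (gen ms)
    then show ?case using Z_all[OF gen] by (simp add: Z_def)
  next
    case (add f g)
    then have "(f - sec (lin w f)) + (g - sec (lin w g)) \<in> N" by (intro N_simps(3))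
    then show ?case using add by (simp add: lin_add[of _ X] sec_linear algebra_simps)
  next
    case (sc a f)
    then have "sc a (f - sec (lin w f)) \<in> N" by (intro N_simps(4))
    then show ?case using sc by (simp add: lin_sc[of _ X] sec_linear sc_diff_right)
  qed
  then show ?thesis using assms(2) by (simp add: sec_linear)
qed

lemma act_closed: "g \<in> carrier G \<Longrightarrow> x \<in> carrier M \<Longrightarrow> act M g x \<in> carrier M"
  using element_image by blast

lemma act_tuple: "g \<in> carrier G \<Longrightarrow> ms \<in> X \<Longrightarrow> map (act M g) ms \<in> X"
  using act_closed by (auto simp: tuples_def)

lemma push_S:
  assumes g: "g \<in> carrier G" and s: "s \<in> S"
  shows "push Rc (map (act M g)) s \<in> S"
proof -
  consider (1) ms i x y where "s = bs (ms[i := x \<oplus>\<^bsub>M\<^esub> y]) - (bs (ms[i := x]) + bs (ms[i := y]))"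
      "ms \<in> X" "i < k" "x \<in> carrier M" "y \<in> carrier M"
    | (2) ms i a x where "s = bs (ms[i := a \<odot>\<^bsub>M\<^esub> x]) - sc a (bs (ms[i := x]))" "ms \<in> X" "i < k" "x \<in> carrier M"
    | (3) ms where "s = bs ms" "ms \<in> X" "\<not> distinct ms"
    using s unfolding S_eq by blast
  then show ?thesis
  proof cases
    case 1
    let ?ms = "map (act M g) ms"
    have "push Rc (map (act M g)) s = bs (?ms[i := act M g x \<oplus>\<^bsub>M\<^esub> act M g y]) - (bs (?ms[i := act M g x]) + bs (?ms[i := act M g y]))"
      using 1 g by (simp add: push_diff[of _ X] push_simps[of _ X] fc_add fc_bs map_update act_add)
    then show ?thesis unfolding S_eq using 1 g act_closed act_tuple by blast
  next
    case 2
    let ?ms = "map (act M g) ms"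
    have "push Rc (map (act M g)) s = bs (?ms[i := a \<odot>\<^bsub>M\<^esub> act M g x]) - sc a (bs (?ms[i := act M g x]))"
      using 2 g by (simp add: push_diff[of _ X] push_simps[of _ X] fc_sc fc_bs map_update act_smult carrier_class)
    then show ?thesis unfolding S_eq using 2 g act_closed act_tuple by blast
  next
    case 3
    have "push Rc (map (act M g)) s = bs (map (act M g) ms)" using 3 by simp
    moreover have "\<not> distinct (map (act M g) ms)" using 3 by (simp add: distinct_map)
    ultimately show ?thesis unfolding S_eq using 3 g act_tuple by blast
  qed
qed

sublocale E: presented X S "\<lambda>g. map (act M g)" G w
proof (rule presented.intro)
  show "group G" using group_hom by (simp add: group_hom_def)
  fix g g' ms assume g: "g \<in> carrier G" "g' \<in> carrier G" and ms: "ms \<in> X"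
  then have sub: "set ms \<subseteq> carrier M" by (simp add: tuples_def)
  show "map (act M (g \<otimes>\<^bsub>G\<^esub> g')) ms = map (act M g) (map (act M g') ms)"
    using composition_rule g sub by (auto simp: subset_iff)
next
  fix ms assume "ms \<in> X"
  then have sub: "set ms \<subseteq> carrier M" by (simp add: tuples_def)
  show "map (act M \<one>\<^bsub>G\<^esub>) ms = ms"
  proof (rule map_idI)
    fix x assume "x \<in> set ms"
    then have "x \<in> carrier M" using sub by blast
    then show "act M \<one>\<^bsub>G\<^esub> x = x" using fun_cong[OF id_eq_one, of x] by simp
  qed
qed (use S_sub lin_w_S ker_w act_tuple push_S N_simps(5) in auto)

lemma E_P: "E.P = exterior_power Rc k M"
  by (simp add: E.P_def exterior_power_def)

lemma lin_w_image: "lin w ` fc X = W d k"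
proof (intro equalityI subsetI)
  fix x assume "x \<in> lin w ` fc X"
  then obtain f where f: "f \<in> fc X" "x = lin w f" by blast
  have "lin w f \<in> W d k" using f(1)
  proof (induction rule: fc_induct)
    case (gen ms)
    then show ?case using wedge_in_W[of d "map \<kappa> ms"] by (simp add: w_def tuples_def)
  qed (auto simp: lin_add[of _ X] lin_sc[of _ X] intro: W_add W_sc)
  then show "x \<in> W d k" using f by simp
next
  fix x :: "nat set \<Rightarrow> 'r" assume "x \<in> W d k"
  then show "x \<in> lin w ` fc X" using lin_w_sec[of x] sec_closed by (metis imageI)
qed

lemma E_coords: "coords (exterior_power Rc k M) {I. I \<subseteq> {..<d} \<and> card I = k} E.bar"
  unfolding coords_def W_eq_fc[symmetric] bij_betw_def
  using E.inj_bar E.bar_image lin_w_image E.bar_add E.bar_smult by (simp add: E_P)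

text \<open>Both sides are linear, so checking tuples suffices. The map \<open>B\<close> changes the
  coordinates, along \<phi> also the scalars, and \<open>A\<close> is the expected operator. It is
  applied with the identity over the p-adic numbers and with the embedding of p-adic integral
  coordinates.\<close>

lemma E_act:
  fixes B :: "(nat set \<Rightarrow> 'r) \<Rightarrow> 'z \<Rightarrow> 'k::comm_ring_1"
  assumes g: "g \<in> carrier G" and C: "C \<in> carrier (exterior_power Rc k M)"
    and B: "B 0 = 0" "\<And>x y. B (x + y) = B x + B y" "\<And>a x. B (sc a x) = sc (\<phi> a) (B x)"
    and A: "A 0 = 0" "\<And>x y. A (x + y) = A x + A y" "\<And>a x. A (sc a x) = sc a (A x)"
    and w: "\<And>ms. ms \<in> X \<Longrightarrow> B (w (map (act M g) ms)) = A (B (w ms))"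
  shows "B (E.bar (act (exterior_power Rc k M) g C)) = A (B (E.bar C))"
proof -
  obtain f where f: "f \<in> fc X" "C = E.cls f" using C by (auto simp: E_P[symmetric] E.carrier_P)
  have "B (lin (\<lambda>ms. w (map (act M g) ms)) f) = A (B (lin w f))"
    using f(1) by (induction rule: fc_induct) (auto simp: A B w lin_add[of _ X] lin_sc[of _ X])
  then show ?thesis
    using f g by (simp add: E_P[symmetric] E.act_P E.push_h_closed lin_push)
qed

lemma E_lattice: "lattice_module Rc G (exterior_power Rc k M)"
proof -
  have "finite {I :: nat set. I \<subseteq> {..<d} \<and> card I = k}" by (rule finite_subset[of _ "Pow {..<d}"]) auto
  moreover have g: "gmodule Rc G (exterior_power Rc k M)" using E.gmodule_P by (simp add: E_P)
  ultimately show ?thesis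
    unfolding lattice_module_def using coords_finite_basis[OF gmodule.axioms(1)[OF g] E_coords] by blast
qed

end

section \<open>Group actions and generation by transpositions\<close>

lemma gmodule_act_closed: "gmodule R G M \<Longrightarrow> g \<in> carrier G \<Longrightarrow> x \<in> carrier M \<Longrightarrow> act M g x \<in> carrier M"
  using group_action.element_image[of G "carrier M" "act M" g x] gmodule.axioms(2) by blast

lemma gmodule_act_comp:
  "gmodule R G M \<Longrightarrow> g \<in> carrier G \<Longrightarrow> h \<in> carrier G \<Longrightarrow> x \<in> carrier M \<Longrightarrow>
    act M (g \<otimes>\<^bsub>G\<^esub> h) x = act M g (act M h x)"
  using group_action.composition_rule[of G "carrier M" "act M" x g h] gmodule.axioms(2) by blast

lemma gmodule_act_one: "gmodule R G M \<Longrightarrow> x \<in> carrier M \<Longrightarrow> act M \<one>\<^bsub>G\<^esub> x = x"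
  using fun_cong[OF group_action.id_eq_one[OF gmodule.axioms(2)], of R G M x] by simp

lemma transpose_in_sym_group: "a \<in> {1..n} \<Longrightarrow> b \<in> {1..n} \<Longrightarrow> Transposition.transpose a b \<in> carrier (sym_group n)"
  unfolding sym_group_carrier by (rule permutes_swap_id)

text \<open>Every permutation of a finite set is a product of transpositions. No linearity is
  involved, so the two modules may have different scalars.\<close>

lemma equivariant_of_transpositions:
  assumes M: "gmodule R (sym_group n) M" and N: "gmodule R' (sym_group n) N"
    and f: "\<And>x. x \<in> carrier M \<Longrightarrow> f x \<in> carrier N"
    and t: "\<And>a b x. a \<in> {1..n} \<Longrightarrow> b \<in> {1..n} \<Longrightarrow> a \<noteq> b \<Longrightarrow> x \<in> carrier M \<Longrightarrow>
      f (act M (Transposition.transpose a b) x) = act N (Transposition.transpose a b) (f x)"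
    and g: "g \<in> carrier (sym_group n)" and x: "x \<in> carrier M"
  shows "f (act M g x) = act N g (f x)"
proof -
  have "g permutes {1..n}" using g by (simp add: sym_group_carrier)
  then have "\<forall>x\<in>carrier M. f (act M g x) = act N g (f x)"
    using finite_atLeastAtMost
  proof (induction rule: permutes_induct)
    case id
    show ?case using gmodule_act_one[OF M] gmodule_act_one[OF N] f by (simp add: sym_group_one id_def)
  next
    case (swap a b p)
    let ?t = "Transposition.transpose a b"
    have p: "p \<in> carrier (sym_group n)" using swap by (simp add: sym_group_carrier)
    have tt: "?t \<in> carrier (sym_group n)" using swap by (intro transpose_in_sym_group)
    show ?case
    proof
      fix x assume x: "x \<in> carrier M"
      have "act M (?t \<circ> p) x = act M ?t (act M p x)"
        using gmodule_act_comp[OF M tt p x] by (simp add: sym_group_mult)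
      moreover have "act N (?t \<circ> p) (f x) = act N ?t (act N p (f x))"
        using gmodule_act_comp[OF N tt p f[OF x]] by (simp add: sym_group_mult)
      moreover have "f (act M ?t (act M p x)) = act N ?t (f (act M p x))"
        using swap gmodule_act_closed[OF M p x] by (intro t) auto
      moreover have "f (act M p x) = act N p (f x)" using swap x by blast
      ultimately show "f (act M (?t \<circ> p) x) = act N (?t \<circ> p) (f x)" by simp
    qed
  qed
  then show ?thesis using x by blast
qed

section \<open>The natural Specht lattice and its sublattices\<close>

lemma push_permutes:
  assumes "\<sigma> permutes A"
  shows "push Rc \<sigma> f = (\<lambda>i. f (inv' \<sigma> i))"
proof
  fix i
  have "{x. f x \<noteq> 0 \<and> \<sigma> x = i} = (if f (inv' \<sigma> i) \<noteq> 0 then {inv' \<sigma> i} else {})"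
    using permutes_inverses[OF assms] by auto
  then show "push Rc \<sigma> f i = f (inv' \<sigma> i)" by (simp add: push_def finsum_class zero_class)
qed

text \<open>If \<open>t\<close> divides \<open>n\<close>, this lattice has the basis $f_0, t f_1, \dots, t f_{n-2}$.\<close>

definition sublat_set :: "nat \<Rightarrow> 'r::comm_ring_1 \<Rightarrow> (nat \<Rightarrow> 'r) set"
  where "sublat_set n t = {a \<in> fc {1..n}. (\<Sum>i\<in>{1..n}. a i) = 0 \<and> (\<forall>i\<in>{1..n}. \<forall>l\<in>{1..n}. t dvd a i - a l)}"

definition sublat :: "nat \<Rightarrow> 'r::comm_ring_1 \<Rightarrow> ('r, nat \<Rightarrow> 'r, nat \<Rightarrow> nat) gmodule"
  where "sublat n t = (natural_specht Rc n)\<lparr>carrier := sublat_set n t, act := \<lambda>\<sigma>. \<lambda>a\<in>sublat_set n t. push Rc \<sigma> a\<rparr>"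

lemma sublat_simps [simp]:
  "carrier (sublat n t) = sublat_set n t" "\<zero>\<^bsub>sublat n t\<^esub> = 0" "f \<oplus>\<^bsub>sublat n t\<^esub> g = f + g" "a \<odot>\<^bsub>sublat n t\<^esub> f = sc a f"
  "act (sublat n t) \<sigma> = (\<lambda>a\<in>sublat_set n t. push Rc \<sigma> a)"
  by (simp_all add: sublat_def natural_specht_def Let_def)

lemma sublat_one: "sublat n 1 = natural_specht Rc n"
  by (simp add: sublat_def natural_specht_def Let_def sublat_set_def finsum_class zero_class)

lemma sublat_set_add: "f \<in> sublat_set n t \<Longrightarrow> g \<in> sublat_set n t \<Longrightarrow> f + g \<in> sublat_set n t"
  unfolding sublat_set_def by (auto simp: plus_fun_apply sum.distrib add_diff_add intro: fc_add)

lemma sublat_set_sc: "f \<in> sublat_set n t \<Longrightarrow> sc a f \<in> sublat_set n t"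
  unfolding sublat_set_def by (auto simp: sc_apply sum_distrib_left[symmetric] right_diff_distrib[symmetric] intro: fc_sc)

lemma sublat_set_fc: "f \<in> sublat_set n t \<Longrightarrow> f \<in> fc {1..n}"
  by (simp add: sublat_set_def)

lemma sublat_set_zero: "0 \<in> sublat_set n t"
  by (simp add: sublat_set_def zero_fun_apply)

lemma sublat_set_push:
  assumes f: "f \<in> sublat_set n t" and \<sigma>: "\<sigma> permutes {1..n}"
  shows "push Rc \<sigma> f \<in> sublat_set n t"
proof -
  have \<sigma>i: "inv' \<sigma> permutes {1..n}" using \<sigma> by (rule permutes_inv)
  have "push Rc \<sigma> f \<in> fc {1..n}"
    using f permutes_in_image[OF \<sigma>] by (intro push_closed[of f "{1..n}"]) (auto simp: sublat_set_def)
  moreover have "(\<Sum>i\<in>{1..n}. f (inv' \<sigma> i)) = (\<Sum>i\<in>{1..n}. f i)"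
    using sum.permute[OF \<sigma>i, of f] by (simp add: comp_def)
  moreover have "inv' \<sigma> i \<in> {1..n}" if "i \<in> {1..n}" for i using permutes_in_image[OF \<sigma>i] that by blast
  ultimately show ?thesis using f by (auto simp: sublat_set_def push_permutes[OF \<sigma>])
qed

lemma gmodule_sublat: "gmodule (Rc :: 'r::comm_ring_1 ring) (sym_group n) (sublat n t)"
proof (rule gmoduleI)
  show "Module.module (Rc :: 'r ring) (sublat n t)"
  proof (rule moduleI)
    show "abelian_group (sublat n t)"
    proof (rule abelian_groupI)
      fix f assume "f \<in> carrier (sublat n t)"
      then show "\<exists>g\<in>carrier (sublat n t). g \<oplus>\<^bsub>sublat n t\<^esub> f = \<zero>\<^bsub>sublat n t\<^esub>"
        using sublat_set_sc[of f n t "- 1"] by (intro bexI[of _ "sc (- 1) f"]) auto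
    qed (auto simp: sublat_set_add sublat_set_zero ac_simps)
  qed (auto simp: cring_class sublat_set_sc sc_add_left sc_add_right class_simps)
  show "group (sym_group n)" by (rule sym_group_is_group)
next
  fix g h :: "nat \<Rightarrow> nat" and x :: "nat \<Rightarrow> 'r"
  assume g: "g \<in> carrier (sym_group n)" and h: "h \<in> carrier (sym_group n)" and x: "x \<in> carrier (sublat n t)"
  have gp: "g permutes {1..n}" and hp: "h permutes {1..n}" using g h by (simp_all add: sym_group_carrier)
  have xf: "x \<in> fc {1..n}" and xL: "x \<in> sublat_set n t" using x by (simp_all add: sublat_set_def)
  show "act (sublat n t) (g \<otimes>\<^bsub>sym_group n\<^esub> h) x = act (sublat n t) g (act (sublat n t) h x)"
    using xL sublat_set_push[OF xL hp] push_push[OF xf, of g h] by (simp add: sym_group_mult comp_def)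
next
  fix x :: "nat \<Rightarrow> 'r" assume x: "x \<in> carrier (sublat n t)"
  then show "act (sublat n t) \<one>\<^bsub>sym_group n\<^esub> x = x"
    using push_id[of x "{1..n}"] by (simp add: sym_group_one id_def sublat_set_def)
next
  fix g :: "nat \<Rightarrow> nat" and x y :: "nat \<Rightarrow> 'r"
  assume g: "g \<in> carrier (sym_group n)" and x: "x \<in> carrier (sublat n t)" and y: "y \<in> carrier (sublat n t)"
  then show "act (sublat n t) g (x \<oplus>\<^bsub>sublat n t\<^esub> y) = act (sublat n t) g x \<oplus>\<^bsub>sublat n t\<^esub> act (sublat n t) g y"
    using sublat_set_add[of x n t y] sublat_set_fc[of x n t] sublat_set_fc[of y n t] push_add[of x "{1..n}" y g] by simp
next
  fix g :: "nat \<Rightarrow> nat" and a :: 'r and x :: "nat \<Rightarrow> 'r"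
  assume g: "g \<in> carrier (sym_group n)" and x: "x \<in> carrier (sublat n t)"
  then show "act (sublat n t) g (a \<odot>\<^bsub>sublat n t\<^esub> x) = a \<odot>\<^bsub>sublat n t\<^esub> act (sublat n t) g x"
    using sublat_set_sc[of x n t a] sublat_set_fc[of x n t] push_sc[of x "{1..n}" g a] by simp
qed (auto simp: sym_group_carrier sublat_set_push)

text \<open>Coordinates in the basis f_0, ..., f_(d-1). The entry at position d = n - 1 is 1 in f_0
  and 0 in all other f_i, so it is the coefficient of f_0.\<close>

definition co :: "nat \<Rightarrow> (nat \<Rightarrow> 'r::comm_ring_1) \<Rightarrow> nat \<Rightarrow> 'r"
  where "co d x = (\<lambda>i. if i = 0 then x d else if i < d then x i - x d else 0)"

lemma co_linear: "co d (x + y) = co d x + co d y" "co d (x - y) = co d x - co d y" "co d (sc a x) = sc a (co d x)"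
  by (auto simp: co_def fun_algebra algebra_simps)

lemma co_bs:
  assumes "d \<ge> 2" "a \<in> {1..Suc d}"
  shows "co d (bs a) = cv d a"
  using assms by (auto simp: co_def cv_def bs_def fun_algebra)

text \<open>The entries at 1, ..., d are immediate from the coordinates; the one at n is recovered
  from the vanishing of the sum.\<close>

lemma dot_lf_co:
  fixes x :: "nat \<Rightarrow> 'r::comm_ring_1"
  assumes d: "d \<ge> 2" and sum: "(\<Sum>i\<in>{1..Suc d}. x i) = 0" and a: "a \<in> {1..Suc d}"
  shows "dot d (lf d a) (co d x) = x a"
proof -
  have e: "{..<d} = insert 0 {1..<d}" using d by auto
  have *: "dot d (lf d a) (co d x) = lf d a 0 * x d + (\<Sum>i\<in>{1..<d}. lf d a i * (x i - x d))"
    unfolding dot_def e by (auto simp: co_def intro!: sum.cong)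
  consider "a = Suc d" | "a = d" | "1 \<le> a" "a < d" using a by force
  then show ?thesis
  proof cases
    case 1
    have "{1..Suc d} = insert (Suc d) (insert d {1..<d})" using d by auto
    then have s: "x (Suc d) + (x d + (\<Sum>i\<in>{1..<d}. x i)) = 0" using sum by simp
    have "(\<Sum>i\<in>{1..<d}. lf d a i * (x i - x d)) = (\<Sum>i\<in>{1..<d}. x d - x i)"
      using 1 by (intro sum.cong) (auto simp: lf_def)
    also have "\<dots> = of_nat (d - 1) * x d - (\<Sum>i\<in>{1..<d}. x i)" by (simp add: sum_subtractf)
    finally have "dot d (lf d a) (co d x) = - x d - (\<Sum>i\<in>{1..<d}. x i)"
      unfolding * using 1 d by (simp add: lf_def of_nat_diff algebra_simps)
    also have "\<dots> = x (Suc d)"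
    proof -
      have "x (Suc d) = (x (Suc d) + (x d + (\<Sum>i\<in>{1..<d}. x i))) - x d - (\<Sum>i\<in>{1..<d}. x i)" by simp
      then show ?thesis unfolding s by simp
    qed
    finally show ?thesis using 1 by simp
  next
    case 2
    then have "(\<Sum>i\<in>{1..<d}. lf d a i * (x i - x d)) = 0" by (intro sum.neutral) (auto simp: lf_def)
    then show ?thesis unfolding * using 2 d by (simp add: lf_def)
  next
    case 3
    have "(\<Sum>i\<in>{1..<d}. lf d a i * (x i - x d)) = (\<Sum>i\<in>{1..<d}. if i = a then x a - x d else 0)"
      using 3 by (intro sum.cong) (auto simp: lf_def)
    then show ?thesis unfolding * using 3 d by (simp add: lf_def)
  qed
qed

text \<open>The transposition subtracts (x_a - x_b)(e_a - e_b). Reading this in coordinates gives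
  the reflection required by \<open>wedge_reflection\<close>.\<close>

lemma co_transpose:
  fixes x :: "nat \<Rightarrow> 'r::comm_ring_1"
  assumes d: "d \<ge> 2" and x: "x \<in> sublat_set (Suc d) t" and ab: "a \<in> {1..Suc d}" "b \<in> {1..Suc d}" "a \<noteq> b"
  shows "co d (push Rc (Transposition.transpose a b) x) = co d x - sc (dot d (rform d a b) (co d x)) (rvec d a b)"
proof -
  have p: "Transposition.transpose a b permutes {1..Suc d}" using ab by (intro permutes_swap_id)
  have sum: "(\<Sum>i\<in>{1..Suc d}. x i) = 0" using x by (simp add: sublat_set_def)
  have "push Rc (Transposition.transpose a b) x = x - sc (x a - x b) (bs a - bs b)"
    using ab(3) by (auto simp: push_permutes[OF p] inv_transpose_eq fun_algebra bs_def transpose_def)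
  moreover have "dot d (rform d a b) (co d x) = x a - x b"
    using dot_lf_co[OF d sum] ab by (simp add: rform_def dot_diff del: atLeastAtMost_iff)
  ultimately show ?thesis
    by (simp only: co_linear rvec_def co_bs[OF d ab(1)] co_bs[OF d ab(2)])
qed

text \<open>The coordinates other than the one of f_0 are differences of entries, hence divisible by
  t, and are divided by it. The choice in \<open>\<kappa>\<close> is unique because t is nonzero in
  a domain.\<close>

lemma coords_sublat:
  fixes t :: "'r::idom"
  assumes d: "d \<ge> 2" and t: "t \<noteq> 0" "t dvd of_nat (Suc d)"
  obtains \<kappa> where "coords (sublat (Suc d) t) {..<d} \<kappa>"
    "\<And>x i. x \<in> sublat_set (Suc d) t \<Longrightarrow> co d x i = (if i = 0 then 1 else t) * \<kappa> x i"
proof -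
  define \<kappa> where "\<kappa> x i = (SOME y. co d x i = (if i = 0 then 1 else t) * y)" for x i
  have ex: "\<exists>y. co d x i = (if i = 0 then 1 else t) * y" if x: "x \<in> sublat_set (Suc d) t" for x i
  proof (cases "i = 0 \<or> i \<ge> d")
    case True
    then show ?thesis by (cases "i = 0") (auto simp: co_def intro: exI[of _ 0])
  next
    case False
    then have "t dvd x i - x d" using x by (auto simp: sublat_set_def)
    then show ?thesis using False by (auto simp: co_def elim: dvdE)
  qed
  have \<kappa>: "co d x i = (if i = 0 then 1 else t) * \<kappa> x i" if "x \<in> sublat_set (Suc d) t" for x i
    unfolding \<kappa>_def using ex[OF that, of i] by (rule someI_ex)
  have \<kappa>u: "\<kappa> x = v" if "x \<in> sublat_set (Suc d) t" "\<And>i. co d x i = (if i = 0 then 1 else t) * v i" for x v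
  proof
    fix i show "\<kappa> x i = v i" using \<kappa>[OF that(1), of i] that(2)[of i] t(1) by (auto split: if_splits)
  qed
  have in_fc: "\<kappa> x \<in> fc {..<d}" if "x \<in> sublat_set (Suc d) t" for x
  proof -
    have "\<kappa> x i = 0" if "i \<ge> d" for i using \<kappa>[OF \<open>x \<in> sublat_set (Suc d) t\<close>, of i] that d t(1) by (auto simp: co_def split: if_splits)
    then have "{i. \<kappa> x i \<noteq> 0} \<subseteq> {..<d}" by (metis (mono_tags, lifting) lessThan_iff mem_Collect_eq not_le subsetI)
    then show ?thesis unfolding fc_def using finite_subset by blast
  qed
  have inj: "x = y" if x: "x \<in> sublat_set (Suc d) t" and y: "y \<in> sublat_set (Suc d) t" and eq: "\<kappa> x = \<kappa> y" for x y
  proof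
    have c: "co d x i = co d y i" for i using \<kappa>[OF x, of i] \<kappa>[OF y, of i] eq by simp
    have lt: "x i = y i" if "i \<in> {1..d}" for i
      using c[of i] c[of 0] that by (cases "i = d") (auto simp: co_def)
    have s: "{1..Suc d} = insert (Suc d) {1..d}" by auto
    have "x (Suc d) + (\<Sum>i\<in>{1..d}. x i) = 0" "y (Suc d) + (\<Sum>i\<in>{1..d}. y i) = 0"
      using x y unfolding sublat_set_def s by auto
    moreover have "(\<Sum>i\<in>{1..d}. x i) = (\<Sum>i\<in>{1..d}. y i)" using lt by (rule sum.cong[OF refl])
    ultimately have n: "x (Suc d) = y (Suc d)" by (metis add_right_cancel)
    fix i
    have "x i = 0" "y i = 0" if "i \<notin> {1..Suc d}" using x y that unfolding sublat_set_def fc_def by blast+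
    then show "x i = y i" using lt[of i] n by (cases "i \<in> {1..d}"; cases "i = Suc d") auto
  qed
  have surj: "\<exists>x\<in>sublat_set (Suc d) t. \<kappa> x = v" if v: "v \<in> fc {..<d}" for v
  proof -
    \<comment> \<open>These are the entries at 1, ..., d of v_0 f_0 plus the sum of the t v_i f_i;
      the last entry is then fixed by the zero sum.\<close>
    define f where "f i = (if i = d then v 0 else v 0 + t * v i)" for i
    define x where "x i = (if i \<in> {1..d} then f i else if i = Suc d then - (\<Sum>i\<in>{1..d}. f i) else 0)" for i
    have s: "{1..Suc d} = insert (Suc d) {1..d}" by auto
    have "(\<Sum>i\<in>{1..d}. x i) = (\<Sum>i\<in>{1..d}. f i)" by (intro sum.cong) (auto simp: x_def)
    then have sum: "(\<Sum>i\<in>{1..Suc d}. x i) = 0" unfolding s by (simp add: x_def)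
    have fin: "x \<in> fc {1..Suc d}"
    proof -
      have "{i. x i \<noteq> 0} \<subseteq> {1..Suc d}" by (auto simp: x_def)
      then show ?thesis unfolding fc_def using finite_subset by blast
    qed
    have dv: "t dvd x i - v 0" if "i \<in> {1..Suc d}" for i
    proof (cases "i = Suc d")
      case False
      then show ?thesis using that by (auto simp: x_def f_def)
    next
      case True
      have "t dvd (\<Sum>i\<in>{1..d}. f i - v 0)" by (intro dvd_sum) (auto simp: f_def)
      then have "t dvd (\<Sum>i\<in>{1..d}. f i) - of_nat d * v 0" by (simp add: sum_subtractf)
      moreover have "t dvd of_nat (Suc d) * v 0" using t(2) by (rule dvd_mult2)
      \<comment> \<open>Modulo t the last entry is -d v_0, which agrees with v_0 because t divides d
        + 1.\<close>
      ultimately have "t dvd - (((\<Sum>i\<in>{1..d}. f i) - of_nat d * v 0) + of_nat (Suc d) * v 0)"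
        unfolding dvd_minus_iff by (rule dvd_add)
      moreover have "- (((\<Sum>i\<in>{1..d}. f i) - of_nat d * v 0) + of_nat (Suc d) * v 0) = x i - v 0"
        using True by (simp add: x_def algebra_simps)
      ultimately show ?thesis by simp
    qed
    have "t dvd x i - x l" if "i \<in> {1..Suc d}" "l \<in> {1..Suc d}" for i l
      using dvd_diff[OF dv[OF that(1)] dv[OF that(2)]] by simp
    then have xL: "x \<in> sublat_set (Suc d) t" using sum fin unfolding sublat_set_def by blast
    have "co d x i = (if i = 0 then 1 else t) * v i" for i
    proof -
      have "v i = 0" if "i \<ge> d" using v that unfolding fc_def by auto
      then show ?thesis using d by (auto simp: co_def x_def f_def)
    qed
    then have "\<kappa> x = v" by (rule \<kappa>u[OF xL])
    then show ?thesis using xL by blast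
  qed
  have "coords (sublat (Suc d) t) {..<d} \<kappa>"
    unfolding coords_def
  proof (intro conjI ballI allI)
    show "bij_betw \<kappa> (carrier (sublat (Suc d) t)) (fc {..<d})"
      unfolding bij_betw_def inj_on_def using in_fc inj surj by (auto simp: image_iff) metis
  next
    fix x y assume "x \<in> carrier (sublat (Suc d) t)" "y \<in> carrier (sublat (Suc d) t)"
    then have xy: "x \<in> sublat_set (Suc d) t" "y \<in> sublat_set (Suc d) t" by simp_all
    have "\<kappa> (x + y) = \<kappa> x + \<kappa> y"
      by (rule \<kappa>u[OF sublat_set_add[OF xy]]) (simp add: co_linear plus_fun_apply \<kappa>[OF xy(1)] \<kappa>[OF xy(2)] distrib_left)
    then show "\<kappa> (x \<oplus>\<^bsub>sublat (Suc d) t\<^esub> y) = \<kappa> x + \<kappa> y" by simp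
  next
    fix a x assume "x \<in> carrier (sublat (Suc d) t)"
    then have x: "x \<in> sublat_set (Suc d) t" by simp
    have "\<kappa> (sc a x) = sc a (\<kappa> x)"
      by (rule \<kappa>u[OF sublat_set_sc[OF x]]) (simp add: co_linear sc_apply \<kappa>[OF x])
    then show "\<kappa> (a \<odot>\<^bsub>sublat (Suc d) t\<^esub> x) = sc a (\<kappa> x)" by simp
  qed
  then show ?thesis using that \<kappa> by blast
qed

section \<open>Degree one of the Fock space as the space of vectors\<close>

lemma wedge_single:
  fixes v :: "nat \<Rightarrow> 'a::comm_ring_1"
  shows "wedge d [v] I = (if \<exists>i<d. I = {i} then v (the_elem I) else 0)"
proof -
  have e: "wedge d [v] I = (\<Sum>i<d. if I = {i} then v i else 0)"
  proof -
    have c: "creation i (bs {}) = (bs {i} :: nat set \<Rightarrow> 'a)" for i by (simp add: creation_bs sg_def)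
    show ?thesis unfolding wedge_simps ext_mult_def sum_fun_apply c
      by (intro sum.cong) (auto simp: sc_apply bs_def)
  qed
  then show ?thesis
  proof (cases "\<exists>i<d. I = {i}")
    case True
    then obtain i where i: "i < d" "I = {i}" by blast
    then have "(\<Sum>j<d. if I = {j} then v j else 0) = (\<Sum>j<d. if j = i then v i else 0)"
      by (intro sum.cong) auto
    then show ?thesis using i \<open>wedge d [v] I = _\<close> by (simp del: wedge_simps)
  next
    case False
    then have "(\<Sum>j<d. if I = {j} then v j else 0) = 0" by (intro sum.neutral) auto
    then show ?thesis unfolding e if_not_P[OF False] .
  qed
qed

lemma wedge_single_apply: "i < d \<Longrightarrow> wedge d [v] {i} = v i"
  by (auto simp: wedge_single simp del: wedge_simps)

lemma wedge_single_inverse: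
  assumes "x \<in> W d 1"
  shows "wedge d [\<lambda>i. if i < d then x {i} else 0] = x"
proof
  fix I
  show "wedge d [\<lambda>i. if i < d then x {i} else 0] I = x I"
  proof (cases "\<exists>i<d. I = {i}")
    case True
    then show ?thesis by (auto simp: wedge_single simp del: wedge_simps)
  next
    case False
    then have "x I = 0" using W_D[OF assms, of I] by (auto simp: card_1_singleton_iff)
    then show ?thesis unfolding wedge_single if_not_P[OF False] by simp
  qed
qed

section \<open>Forms as lattices inside a module\<close>

text \<open>Realizes M inside the Fock space over the p-adic numbers, so that lattices over
  unrelated element types can be compared there. Equivariance is required in the form in which
  \<open>ops\<close> uses it.\<close>

definition emb :: "nat \<Rightarrow> nat \<Rightarrow> ('p::prime_card padic_int, 'm, nat \<Rightarrow> nat) gmodule \<Rightarrow>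
    ('m \<Rightarrow> nat set \<Rightarrow> 'p padic_int fract) \<Rightarrow> bool"
  where "emb d k M \<iota> \<longleftrightarrow>
    (\<forall>x\<in>carrier M. \<forall>y\<in>carrier M. \<iota> (x \<oplus>\<^bsub>M\<^esub> y) = \<iota> x + \<iota> y) \<and>
    (\<forall>a. \<forall>x\<in>carrier M. \<iota> (a \<odot>\<^bsub>M\<^esub> x) = sc (Zp_to_Qp a) (\<iota> x)) \<and>
    inj_on \<iota> (carrier M) \<and> \<iota> ` carrier M \<subseteq> W d k \<and>
    (\<forall>a\<in>{1..Suc d}. \<forall>b\<in>{1..Suc d}. \<forall>x\<in>carrier M. a \<noteq> b \<longrightarrow>
      \<iota> (act M (Transposition.transpose a b) x) = \<iota> x - Q d (rvec d a b) (rform d a b) (\<iota> x))"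

lemma emb_add: "emb d k M \<iota> \<Longrightarrow> x \<in> carrier M \<Longrightarrow> y \<in> carrier M \<Longrightarrow> \<iota> (x \<oplus>\<^bsub>M\<^esub> y) = \<iota> x + \<iota> y"
  and emb_smult: "emb d k M \<iota> \<Longrightarrow> x \<in> carrier M \<Longrightarrow> \<iota> (r \<odot>\<^bsub>M\<^esub> x) = sc (Zp_to_Qp r) (\<iota> x)"
  and emb_inj: "emb d k M \<iota> \<Longrightarrow> x \<in> carrier M \<Longrightarrow> y \<in> carrier M \<Longrightarrow> \<iota> x = \<iota> y \<Longrightarrow> x = y"
  and emb_W: "emb d k M \<iota> \<Longrightarrow> x \<in> carrier M \<Longrightarrow> \<iota> x \<in> W d k"
  and emb_act: "emb d k M \<iota> \<Longrightarrow> a \<in> {1..Suc d} \<Longrightarrow> b \<in> {1..Suc d} \<Longrightarrow> a \<noteq> b \<Longrightarrow> x \<in> carrier M \<Longrightarrow>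
    \<iota> (act M (Transposition.transpose a b) x) = \<iota> x - Q d (rvec d a b) (rform d a b) (\<iota> x)"
  unfolding emb_def by (blast dest: inj_onD)+

definition spans :: "nat \<Rightarrow> nat \<Rightarrow> (nat set \<Rightarrow> 'p::prime_card padic_int fract) set \<Rightarrow> bool"
  where "spans d k Y \<longleftrightarrow> (\<forall>v\<in>W d k. \<exists>b. b \<noteq> 0 \<and> sc (Zp_to_Qp b) v \<in> Y)"

text \<open>Separates the classification from the construction of V: the natural Specht module and
  the hook modules enter the later arguments only through such a map.\<close>

definition model :: "nat \<Rightarrow> nat \<Rightarrow> ('p::prime_card padic_int fract, 'v, nat \<Rightarrow> nat) gmodule \<Rightarrow>
    ('v \<Rightarrow> nat set \<Rightarrow> 'p padic_int fract) \<Rightarrow> bool"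
  where "model d k V \<Phi> \<longleftrightarrow> gmodule Qp (sym_group (Suc d)) V \<and> coords V {I. I \<subseteq> {..<d} \<and> card I = k} \<Phi> \<and>
    (\<forall>a\<in>{1..Suc d}. \<forall>b\<in>{1..Suc d}. \<forall>x\<in>carrier V. a \<noteq> b \<longrightarrow>
      \<Phi> (act V (Transposition.transpose a b) x) = \<Phi> x - Q d (rvec d a b) (rform d a b) (\<Phi> x))"

lemma Q_linear: "Q d \<alpha> \<phi> 0 = 0" "Q d \<alpha> \<phi> (x + y) = Q d \<alpha> \<phi> x + Q d \<alpha> \<phi> y" "Q d \<alpha> \<phi> (sc a x) = sc a (Q d \<alpha> \<phi> x)"
  by (simp_all add: Q_def)

lemma reflection_linear:
  "0 - Q d \<alpha> \<phi> 0 = 0" "(x + y) - Q d \<alpha> \<phi> (x + y) = (x - Q d \<alpha> \<phi> x) + (y - Q d \<alpha> \<phi> y)"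
  "sc a x - Q d \<alpha> \<phi> (sc a x) = sc a (x - Q d \<alpha> \<phi> x)"
  by (simp_all add: Q_linear sc_diff_right)

text \<open>The pure tensor of c and x is modelled by c times \<open>\<epsilon> x\<close>.
  Injectivity of \<open>\<epsilon>\<close> suffices for the kernel condition, since denominators can
  be cleared.\<close>

locale tensor =
  fixes G :: "'g monoid" and M :: "('p::prime_card padic_int, 'm, 'g) gmodule"
    and \<epsilon> :: "'m \<Rightarrow> 'z \<Rightarrow> 'p padic_int fract"
  assumes M: "gmodule Zp G M"
    and eps_add: "\<And>x y. x \<in> carrier M \<Longrightarrow> y \<in> carrier M \<Longrightarrow> \<epsilon> (x \<oplus>\<^bsub>M\<^esub> y) = \<epsilon> x + \<epsilon> y"
    and eps_smult: "\<And>a x. x \<in> carrier M \<Longrightarrow> \<epsilon> (a \<odot>\<^bsub>M\<^esub> x) = sc (Zp_to_Qp a) (\<epsilon> x)"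
    and eps_inj: "\<And>x y. x \<in> carrier M \<Longrightarrow> y \<in> carrier M \<Longrightarrow> \<epsilon> x = \<epsilon> y \<Longrightarrow> x = y"
begin

sublocale gmodule Zp G M by (rule M)

abbreviation "X \<equiv> (UNIV :: 'p padic_int fract set) \<times> carrier M"
abbreviation "S \<equiv> tensor_relations Zp Qp Zp_to_Qp M"

definition "w cx = sc (fst cx) (\<epsilon> (snd cx))"

lemma carrier_Qp: "carrier (Qp :: 'p padic_int fract ring) = UNIV"
  by (auto simp: carrier_class)

lemma smult_closed' [simp]: "x \<in> carrier M \<Longrightarrow> a \<odot>\<^bsub>M\<^esub> x \<in> carrier M"
  by (simp add: carrier_class)

lemma S_eq: "S = {bs (c + e, x) - (bs (c, x) + bs (e, x)) | c e x. x \<in> carrier M} \<union>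
    {bs (c, x \<oplus>\<^bsub>M\<^esub> y) - (bs (c, x) + bs (c, y)) | c x y. x \<in> carrier M \<and> y \<in> carrier M} \<union>
    {bs (c * Zp_to_Qp a, x) - bs (c, a \<odot>\<^bsub>M\<^esub> x) | c a x. x \<in> carrier M} \<union>
    {bs (e * c, x) - sc e (bs (c, x)) | c e x. x \<in> carrier M}"
proof -
  have m: "f \<ominus>\<^bsub>free_module Qp X\<^esub> g = f - g" if "f \<in> fc X" "g \<in> fc X" for f g :: "_ \<Rightarrow> 'p padic_int fract"
    using that by (rule free_module_minus)
  have s1: "{bs (c + e, x) \<ominus>\<^bsub>free_module Qp X\<^esub> (bs (c, x) + bs (e, x)) | c e x.
      c \<in> UNIV \<and> e \<in> UNIV \<and> x \<in> carrier M} =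
    {bs (c + e, x) - (bs (c, x) + bs (e, x)) :: _ \<Rightarrow> 'p padic_int fract | c e x. x \<in> carrier M}"
    by (intro Collect_cong ex_cong1) (auto simp: m fc_bs fc_add)
  have s2: "{bs (c, x \<oplus>\<^bsub>M\<^esub> y) \<ominus>\<^bsub>free_module Qp X\<^esub> (bs (c, x) + bs (c, y)) | c x y.
      c \<in> UNIV \<and> x \<in> carrier M \<and> y \<in> carrier M} =
    {bs (c, x \<oplus>\<^bsub>M\<^esub> y) - (bs (c, x) + bs (c, y)) :: _ \<Rightarrow> 'p padic_int fract | c x y. x \<in> carrier M \<and> y \<in> carrier M}"
    by (intro Collect_cong ex_cong1) (auto simp: m fc_bs fc_add)
  have s3: "{bs (c * Zp_to_Qp a, x) \<ominus>\<^bsub>free_module Qp X\<^esub> bs (c, a \<odot>\<^bsub>M\<^esub> x) | c a x.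
      c \<in> UNIV \<and> a \<in> carrier Zp \<and> x \<in> carrier M} =
    {bs (c * Zp_to_Qp a, x) - bs (c, a \<odot>\<^bsub>M\<^esub> x) :: _ \<Rightarrow> 'p padic_int fract | c a x. x \<in> carrier M}"
    by (intro Collect_cong ex_cong1) (auto simp: m fc_bs carrier_class)
  have s4: "{bs (e * c, x) \<ominus>\<^bsub>free_module Qp X\<^esub> sc e (bs (c, x)) | c e x.
      c \<in> UNIV \<and> e \<in> UNIV \<and> x \<in> carrier M} =
    {bs (e * c, x) - sc e (bs (c, x)) :: _ \<Rightarrow> 'p padic_int fract | c e x. x \<in> carrier M}"
    by (intro Collect_cong ex_cong1) (auto simp: m fc_bs fc_sc)
  show ?thesis
    unfolding tensor_relations_def Let_def free_gen_class free_module_simps carrier_Qp plus_class times_class s1 s2 s3 s4 ..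
qed

lemma S_sub: "S \<subseteq> fc X"
  unfolding S_eq by (auto intro!: fc_diff fc_add fc_sc fc_bs)

lemma lin_w_S: "s \<in> S \<Longrightarrow> lin w s = 0"
  unfolding S_eq
  by (auto simp: lin_diff[of _ X] lin_add[of _ X] lin_sc[of _ X] fc_add fc_sc fc_bs w_def
      eps_add eps_smult sc_add_left sc_add_right)

abbreviation "N \<equiv> rel_span X S"

lemmas N_simps = rel_span_sub[OF S_sub] rel_span_zero[OF S_sub] rel_span_add[OF S_sub]
  rel_span_sc[OF S_sub] rel_span_gen[OF S_sub] rel_span_neg[OF S_sub] rel_span_diff[OF S_sub]

lemma N_rel:
  shows N_add: "x \<in> carrier M \<Longrightarrow> y \<in> carrier M \<Longrightarrow> bs (c, x \<oplus>\<^bsub>M\<^esub> y) - (bs (c, x) + bs (c, y)) \<in> N"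
    and N_bal: "x \<in> carrier M \<Longrightarrow> bs (c * Zp_to_Qp a, x) - bs (c, a \<odot>\<^bsub>M\<^esub> x) \<in> N"
    and N_sc: "x \<in> carrier M \<Longrightarrow> bs (e * c, x) - sc e (bs (c, x)) \<in> N"
  by (rule subsetD[OF N_simps(5)]; unfold S_eq; blast)+

lemma N_zero: "bs (c, \<zero>\<^bsub>M\<^esub>) \<in> N"
proof -
  have "bs (0, \<zero>\<^bsub>M\<^esub>) \<in> N" using N_sc[of "\<zero>\<^bsub>M\<^esub>" 0 0] by simp
  moreover have "bs (0, \<zero>\<^bsub>M\<^esub>) - bs (c, \<zero>\<^bsub>M\<^esub>) \<in> N"
    using N_bal[of "\<zero>\<^bsub>M\<^esub>" c 0] smult_r_null[of 0] by (simp add: carrier_class)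
  ultimately have "bs (0, \<zero>\<^bsub>M\<^esub>) - (bs (0, \<zero>\<^bsub>M\<^esub>) - bs (c, \<zero>\<^bsub>M\<^esub>)) \<in> N" by (rule N_simps(7))
  then show ?thesis by simp
qed

lemma N_pure:
  assumes "x \<in> carrier M"
  shows "\<exists>b y. b \<noteq> 0 \<and> y \<in> carrier M \<and> bs (c, x) - bs (1 / Zp_to_Qp b, y) \<in> N"
proof -
  obtain a b where b: "b \<noteq> 0" "c = Zp_to_Qp a / Zp_to_Qp b" by (rule Qp_fraction)
  have "bs (1 / Zp_to_Qp b * Zp_to_Qp a, x) - bs (1 / Zp_to_Qp b, a \<odot>\<^bsub>M\<^esub> x) \<in> N"
    using assms by (rule N_bal)
  then show ?thesis using b assms by (intro exI[of _ b] exI[of _ "a \<odot>\<^bsub>M\<^esub> x"]) simp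
qed

text \<open>Extension to the fraction field is a localization: by common denominators, every sum of
  tensors is congruent to one pure tensor of the form 1/b and x.\<close>

lemma N_normal:
  assumes "f \<in> fc X"
  shows "\<exists>b x. b \<noteq> 0 \<and> x \<in> carrier M \<and> f - bs (1 / Zp_to_Qp b, x) \<in> N"
  using assms
proof (induction rule: fc_induct)
  case zero
  show ?case using N_simps(6)[OF N_zero[of "1 / Zp_to_Qp 1"]] by (intro exI[of _ 1] exI[of _ "\<zero>\<^bsub>M\<^esub>"]) simp
next
  case (gen cx)
  then show ?case using N_pure by (cases cx) auto
next
  case (add f g)
  then obtain b x b' x' where f: "b \<noteq> 0" "x \<in> carrier M" "f - bs (1 / Zp_to_Qp b, x) \<in> N"
    and g: "b' \<noteq> 0" "x' \<in> carrier M" "g - bs (1 / Zp_to_Qp b', x') \<in> N" by blast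
  let ?c = "1 / Zp_to_Qp (b * b')"
  have 1: "bs (1 / Zp_to_Qp b, x) - bs (?c, b' \<odot>\<^bsub>M\<^esub> x) \<in> N"
    using N_bal[OF f(2), of ?c b'] g(1) by simp
  have 2: "bs (1 / Zp_to_Qp b', x') - bs (?c, b \<odot>\<^bsub>M\<^esub> x') \<in> N"
    using N_bal[OF g(2), of ?c b] f(1) by simp
  have 3: "bs (?c, b' \<odot>\<^bsub>M\<^esub> x \<oplus>\<^bsub>M\<^esub> b \<odot>\<^bsub>M\<^esub> x') - (bs (?c, b' \<odot>\<^bsub>M\<^esub> x) + bs (?c, b \<odot>\<^bsub>M\<^esub> x')) \<in> N"
    using f g by (intro N_add) auto
  have "((f - bs (1 / Zp_to_Qp b, x)) + (g - bs (1 / Zp_to_Qp b', x'))) +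
      ((bs (1 / Zp_to_Qp b, x) - bs (?c, b' \<odot>\<^bsub>M\<^esub> x)) + (bs (1 / Zp_to_Qp b', x') - bs (?c, b \<odot>\<^bsub>M\<^esub> x'))) -
      (bs (?c, b' \<odot>\<^bsub>M\<^esub> x \<oplus>\<^bsub>M\<^esub> b \<odot>\<^bsub>M\<^esub> x') - (bs (?c, b' \<odot>\<^bsub>M\<^esub> x) + bs (?c, b \<odot>\<^bsub>M\<^esub> x'))) \<in> N"
    by (rule N_simps(7)[OF N_simps(3)[OF N_simps(3)[OF f(3) g(3)] N_simps(3)[OF 1 2]] 3])
  then have "f + g - bs (?c, b' \<odot>\<^bsub>M\<^esub> x \<oplus>\<^bsub>M\<^esub> b \<odot>\<^bsub>M\<^esub> x') \<in> N"
    by (rule back_subst[of "\<lambda>f. f \<in> N"]) (simp add: algebra_simps del: Zp_to_Qp_simps)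
  moreover have "b * b' \<noteq> 0" "b' \<odot>\<^bsub>M\<^esub> x \<oplus>\<^bsub>M\<^esub> b \<odot>\<^bsub>M\<^esub> x' \<in> carrier M" using f g by simp_all
  ultimately show ?case by blast
next
  case (sc a f)
  then obtain b x where f: "b \<noteq> 0" "x \<in> carrier M" "f - bs (1 / Zp_to_Qp b, x) \<in> N" by blast
  obtain b' y where y: "b' \<noteq> 0" "y \<in> carrier M" "bs (a * (1 / Zp_to_Qp b), x) - bs (1 / Zp_to_Qp b', y) \<in> N"
    using N_pure[OF f(2)] by blast
  have 1: "bs (a * (1 / Zp_to_Qp b), x) - sc a (bs (1 / Zp_to_Qp b, x)) \<in> N" using f(2) by (rule N_sc)
  have "sc a (f - bs (1 / Zp_to_Qp b, x)) - (bs (a * (1 / Zp_to_Qp b), x) - sc a (bs (1 / Zp_to_Qp b, x))) +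
      (bs (a * (1 / Zp_to_Qp b), x) - bs (1 / Zp_to_Qp b', y)) \<in> N"
    by (rule N_simps(3)[OF N_simps(7)[OF N_simps(4)[OF f(3)] 1] y(3)])
  then have "sc a f - bs (1 / Zp_to_Qp b', y) \<in> N" by (simp add: sc_diff_right)
  then show ?case using y by blast
qed

lemma lin_w_normal:
  assumes "f \<in> fc X" "x \<in> carrier M" "f - bs (c, x) \<in> N"
  shows "lin w f = sc c (\<epsilon> x)"
proof -
  have "lin w (f - bs (c, x)) = 0" by (rule rel_span_ker[OF S_sub lin_w_S assms(3)])
  then show ?thesis using assms by (simp add: lin_diff[of _ X] fc_bs w_def)
qed

text \<open>For the normal form 1/b and x, the vanishing of \<open>lin w f\<close> means
  \<open>\<epsilon> x\<close> = 0, hence x = 0, and a tensor with zero is a relation.\<close>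

lemma ker_w:
  assumes f: "f \<in> fc X" "lin w f = 0"
  shows "f \<in> N"
proof -
  obtain b x where b: "b \<noteq> 0" "x \<in> carrier M" "f - bs (1 / Zp_to_Qp b, x) \<in> N"
    using N_normal[OF f(1)] by blast
  have "sc (1 / Zp_to_Qp b) (\<epsilon> x) = 0" using lin_w_normal[OF f(1) b(2,3)] f(2) by simp
  then have "sc (Zp_to_Qp b) (sc (1 / Zp_to_Qp b) (\<epsilon> x)) = 0" by simp
  then have "\<epsilon> x = 0" using b(1) by simp
  moreover have "\<epsilon> \<zero>\<^bsub>M\<^esub> = 0" using eps_smult[of "\<zero>\<^bsub>M\<^esub>" 0] smult_r_null[of 0] by (simp add: carrier_class)
  ultimately have "x = \<zero>\<^bsub>M\<^esub>" using eps_inj[OF b(2)] by simp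
  then have "bs (1 / Zp_to_Qp b, x) \<in> N" using N_zero by (simp only:)
  then have "(f - bs (1 / Zp_to_Qp b, x)) + bs (1 / Zp_to_Qp b, x) \<in> N" by (rule N_simps(3)[OF b(3)])
  then show ?thesis by simp
qed

lemma act_in: "g \<in> carrier G \<Longrightarrow> x \<in> carrier M \<Longrightarrow> act M g x \<in> carrier M"
  using gmodule_act_closed[OF M] .

lemma push_S:
  assumes g: "g \<in> carrier G" and s: "s \<in> S"
  shows "push Rc (map_prod id (act M g)) s \<in> S"
proof -
  let ?p = "push Rc (map_prod id (act M g))"
  consider (1) c e x where "s = bs (c + e, x) - (bs (c, x) + bs (e, x))" "x \<in> carrier M"
    | (2) c x y where "s = bs (c, x \<oplus>\<^bsub>M\<^esub> y) - (bs (c, x) + bs (c, y))" "x \<in> carrier M" "y \<in> carrier M"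
    | (3) c a x where "s = bs (c * Zp_to_Qp a, x) - bs (c, a \<odot>\<^bsub>M\<^esub> x)" "x \<in> carrier M"
    | (4) c e x where "s = bs (e * c, x) - sc e (bs (c, x))" "x \<in> carrier M"
    using s unfolding S_eq by blast
  then show ?thesis
  proof cases
    case 1
    have "?p s = bs (c + e, act M g x) - (bs (c, act M g x) + bs (e, act M g x))"
      using 1 by (simp add: push_diff[of _ X] push_simps[of _ X] fc_add fc_bs)
    then show ?thesis unfolding S_eq using act_in[OF g 1(2)] by blast
  next
    case 2
    have "?p s = bs (c, act M g x \<oplus>\<^bsub>M\<^esub> act M g y) - (bs (c, act M g x) + bs (c, act M g y))"
      using 2 g by (simp add: push_diff[of _ X] push_simps[of _ X] fc_add fc_bs act_add)
    then show ?thesis unfolding S_eq using act_in[OF g] 2 by blast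
  next
    case 3
    have "?p s = bs (c * Zp_to_Qp a, act M g x) - bs (c, a \<odot>\<^bsub>M\<^esub> act M g x)"
      using 3 g by (simp add: push_diff[of _ X] push_simps[of _ X] fc_add fc_bs act_smult carrier_class)
    then show ?thesis unfolding S_eq using act_in[OF g 3(2)] by blast
  next
    case 4
    have "?p s = bs (e * c, act M g x) - sc e (bs (c, act M g x))"
      using 4 by (simp add: push_diff[of _ X] push_simps[of _ X] fc_sc fc_bs)
    then show ?thesis unfolding S_eq using act_in[OF g 4(2)] by blast
  qed
qed

sublocale T: presented X S "\<lambda>g. map_prod id (act M g)" G w
proof (rule presented.intro)
  show "group G" using group_hom by (simp add: group_hom_def)
  fix g g' cx assume g: "g \<in> carrier G" "g' \<in> carrier G" and cx: "cx \<in> X"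
  then show "map_prod id (act M (g \<otimes>\<^bsub>G\<^esub> g')) cx = map_prod id (act M g) (map_prod id (act M g') cx)"
    using gmodule_act_comp[OF M g] by (cases cx) auto
next
  fix cx assume "cx \<in> X"
  then show "map_prod id (act M \<one>\<^bsub>G\<^esub>) cx = cx" using gmodule_act_one[OF M] by (cases cx) auto
next
  fix g s assume "g \<in> carrier G" "s \<in> S"
  then show "push Rc (map_prod id (act M g)) s \<in> N" using push_S N_simps(5) by blast
qed (use S_sub lin_w_S ker_w act_in in auto)

lemma T_P: "T.P = extend_scalars Zp Qp Zp_to_Qp M"
  by (simp add: T.P_def extend_scalars_def carrier_Qp)

lemma bar_image: "T.bar ` carrier T.P = {v. \<exists>b\<noteq>0. \<exists>x\<in>carrier M. sc (Zp_to_Qp b) v = \<epsilon> x}"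
proof (intro equalityI subsetI)
  fix v assume "v \<in> T.bar ` carrier T.P"
  then obtain f where f: "f \<in> fc X" "v = lin w f" unfolding T.bar_image by blast
  obtain b x where b: "b \<noteq> 0" "x \<in> carrier M" "f - bs (1 / Zp_to_Qp b, x) \<in> N"
    using N_normal[OF f(1)] by blast
  have "sc (Zp_to_Qp b) v = \<epsilon> x" using lin_w_normal[OF f(1) b(2,3)] f(2) b(1) by simp
  then show "v \<in> {v. \<exists>b\<noteq>0. \<exists>x\<in>carrier M. sc (Zp_to_Qp b) v = \<epsilon> x}" using b by blast
next
  fix v assume "v \<in> {v. \<exists>b\<noteq>0. \<exists>x\<in>carrier M. sc (Zp_to_Qp b) v = \<epsilon> x}"
  then obtain b x where b: "b \<noteq> 0" "x \<in> carrier M" "sc (Zp_to_Qp b) v = \<epsilon> x" by blast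
  have "v = sc (1 / Zp_to_Qp b) (sc (Zp_to_Qp b) v)" using b(1) by simp
  also have "\<dots> = lin w (bs (1 / Zp_to_Qp b, x))" by (simp add: w_def b(3))
  finally show "v \<in> T.bar ` carrier T.P" unfolding T.bar_image using b(2) by (blast intro: fc_bs)
qed

end

text \<open>The extension of scalars is identified with the span of the image of
  \<open>\<iota>\<close> over the p-adic numbers, which is all of \<open>W d k\<close> by
  \<open>spans\<close>; the inverse of \<open>\<Phi>\<close> then leads to V.\<close>

lemma is_form_of_emb:
  fixes M :: "('p::prime_card padic_int, 'm, nat \<Rightarrow> nat) gmodule"
  assumes V: "model d k V \<Phi>" and lat: "lattice_module Zp (sym_group (Suc d)) M"
    and \<iota>: "emb d k M \<iota>" and sp: "spans d k (\<iota> ` carrier M)"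
  shows "is_form (Suc d) V M"
proof -
  let ?n = "Suc d" and ?T = "extend_scalars Zp Qp Zp_to_Qp M"
  interpret tensor "sym_group ?n" M \<iota>
    using lat emb_add[OF \<iota>] emb_smult[OF \<iota>] emb_inj[OF \<iota>] by (intro tensor.intro) (auto simp: lattice_module_def)
  have img: "T.bar ` carrier ?T = W d k"
  proof -
    have "{v. \<exists>b\<noteq>0. \<exists>x\<in>carrier M. sc (Zp_to_Qp b) v = \<iota> x} = W d k"
    proof (intro equalityI subsetI)
      fix v assume "v \<in> {v. \<exists>b\<noteq>0. \<exists>x\<in>carrier M. sc (Zp_to_Qp b) v = \<iota> x}"
      then obtain b x where b: "b \<noteq> 0" "x \<in> carrier M" "sc (Zp_to_Qp b) v = \<iota> x" by blast
      then have "v = sc (1 / Zp_to_Qp b) (\<iota> x)" by (simp flip: b(3))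
      then show "v \<in> W d k" using W_sc[OF emb_W[OF \<iota> b(2)]] by simp
    next
      fix v :: "nat set \<Rightarrow> 'p padic_int fract" assume "v \<in> W d k"
      then show "v \<in> {v. \<exists>b\<noteq>0. \<exists>x\<in>carrier M. sc (Zp_to_Qp b) v = \<iota> x}"
        using sp unfolding spans_def by blast
    qed
    then show ?thesis using bar_image by (simp add: T_P)
  qed
  have gT: "gmodule Qp (sym_group ?n) ?T" using T.gmodule_P by (simp add: T_P)
  have gV: "gmodule Qp (sym_group ?n) V" and c: "coords V {I. I \<subseteq> {..<d} \<and> card I = k} \<Phi>"
    using V by (simp_all add: model_def)
  have \<Phi>b: "bij_betw \<Phi> (carrier V) (W d k)" using c by (simp add: coords_def W_eq_fc)
  define \<Psi> where "\<Psi> = the_inv_into (carrier V) \<Phi>"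
  have \<Psi>b: "bij_betw \<Psi> (W d k) (carrier V)" unfolding \<Psi>_def by (rule bij_betw_the_inv_into[OF \<Phi>b])
  have \<Phi>\<Psi>: "\<Phi> (\<Psi> v) = v" if "v \<in> W d k" for v
    unfolding \<Psi>_def by (rule f_the_inv_into_f_bij_betw[OF \<Phi>b that])
  have \<Psi>u: "\<Psi> v = x" if "v \<in> W d k" "x \<in> carrier V" "\<Phi> x = v" for v x
    using \<Phi>b that unfolding \<Psi>_def by (metis bij_betw_def the_inv_into_f_f)
  have \<Psi>V: "\<Psi> v \<in> carrier V" if "v \<in> W d k" for v using \<Psi>b that by (auto simp: bij_betw_def)
  have barW: "T.bar C \<in> W d k" if "C \<in> carrier ?T" for C using img that by blast
  interpret V: Module.module "Qp :: 'p padic_int fract ring" V using gV by (rule gmodule.axioms(1))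
  let ?f = "\<lambda>C. \<Psi> (T.bar C)"
  have "bij_betw T.bar (carrier ?T) (W d k)" using T.inj_bar img by (simp add: bij_betw_def T_P)
  then have bij: "bij_betw ?f (carrier ?T) (carrier V)" using \<Psi>b by (rule bij_betw_trans[unfolded comp_def])
  have fV: "?f C \<in> carrier V" if "C \<in> carrier ?T" for C using \<Psi>V[OF barW[OF that]] .
  have add: "?f (C \<oplus>\<^bsub>?T\<^esub> D) = ?f C \<oplus>\<^bsub>V\<^esub> ?f D" if "C \<in> carrier ?T" "D \<in> carrier ?T" for C D
  proof (rule \<Psi>u)
    have e: "T.bar (C \<oplus>\<^bsub>?T\<^esub> D) = T.bar C + T.bar D" using T.bar_add that by (simp add: T_P)
    show "T.bar (C \<oplus>\<^bsub>?T\<^esub> D) \<in> W d k" unfolding e using that by (intro W_add barW)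
    show "\<Phi> (?f C \<oplus>\<^bsub>V\<^esub> ?f D) = T.bar (C \<oplus>\<^bsub>?T\<^esub> D)"
      unfolding e using that by (simp add: coords_add[OF c] fV \<Phi>\<Psi> barW)
  qed (use fV that in auto)
  have smult: "?f (a \<odot>\<^bsub>?T\<^esub> C) = a \<odot>\<^bsub>V\<^esub> ?f C" if "C \<in> carrier ?T" for a C
  proof (rule \<Psi>u)
    have e: "T.bar (a \<odot>\<^bsub>?T\<^esub> C) = sc a (T.bar C)" using T.bar_smult that by (simp add: T_P)
    show "T.bar (a \<odot>\<^bsub>?T\<^esub> C) \<in> W d k" unfolding e using that by (intro W_sc barW)
    show "\<Phi> (a \<odot>\<^bsub>V\<^esub> ?f C) = T.bar (a \<odot>\<^bsub>?T\<^esub> C)"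
      unfolding e using that by (simp add: coords_smult[OF c] fV \<Phi>\<Psi> barW)
  qed (use fV that in \<open>auto simp: carrier_class\<close>)
  have equi: "?f (act ?T g C) = act V g (?f C)" if "g \<in> carrier (sym_group ?n)" "C \<in> carrier ?T" for g C
  proof (rule equivariant_of_transpositions[OF gT gV fV _ that])
    fix a b C assume ab: "a \<in> {1..?n}" "b \<in> {1..?n}" "a \<noteq> b" and C: "C \<in> carrier ?T"
    let ?t = "Transposition.transpose a b"
    let ?R = "\<lambda>y. y - Q d (rvec d a b) (rform d a b) y"
    have tg: "?t \<in> carrier (sym_group ?n)" using ab by (intro transpose_in_sym_group)
    have e: "T.bar (act ?T ?t C) = ?R (T.bar C)"
    proof -
      obtain f where f: "f \<in> fc X" "C = T.cls f" using C by (auto simp: T_P[symmetric] T.carrier_P)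
      have "lin (\<lambda>cx. w (map_prod id (act M ?t) cx)) f = ?R (lin w f)"
        using f(1)
      proof (induction rule: fc_induct)
        case zero
        then show ?case by (simp add: Q_linear)
      next
        case (gen cx)
        obtain c x where cx: "cx = (c, x)" "x \<in> carrier M" using gen by (cases cx) auto
        have "w (map_prod id (act M ?t) cx) = sc c (?R (\<iota> x))"
          using emb_act[OF \<iota> ab cx(2)] by (simp add: w_def cx(1))
        also have "\<dots> = ?R (w cx)" by (simp add: w_def cx(1) Q_linear sc_diff_right)
        finally show ?case by (simp only: lin_bs)
      next
        case (add f g)
        then show ?case by (simp add: lin_add[of _ X] Q_linear)
      next
        case (sc a f)
        then show ?case by (simp add: lin_sc[of _ X] Q_linear sc_diff_right)
      qed
      then show ?thesis using f tg by (simp add: T_P[symmetric] T.act_P T.push_h_closed lin_push)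
    qed
    show "?f (act ?T ?t C) = act V ?t (?f C)"
    proof (rule \<Psi>u)
      show "T.bar (act ?T ?t C) \<in> W d k" using gmodule_act_closed[OF gT tg C] by (rule barW)
      show "act V ?t (?f C) \<in> carrier V" using gmodule_act_closed[OF gV tg fV[OF C]] .
      show "\<Phi> (act V ?t (?f C)) = T.bar (act ?T ?t C)"
        using V ab fV[OF C] unfolding e model_def by (simp add: \<Phi>\<Psi>[OF barW[OF C]])
    qed
  qed
  have "gmodule_iso Qp (sym_group ?n) ?T V"
    unfolding gmodule_iso_def
    by (rule exI[of _ ?f]) (use bij add smult equi in blast)
  then show ?thesis using lat by (simp add: is_form_def)
qed

text \<open>The converse of \<open>is_form_of_emb\<close>: x goes to its tensor with 1, then through
  the given isomorphism to V, and by \<open>\<Phi>\<close> into the Fock space.\<close>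

lemma emb_of_is_form:
  fixes M :: "('p::prime_card padic_int, 'm, nat \<Rightarrow> nat) gmodule"
  assumes V: "model d k V \<Phi>" and F: "is_form (Suc d) V M"
  obtains \<iota> where "emb d k M \<iota>" "spans d k (\<iota> ` carrier M)"
proof -
  let ?n = "Suc d" and ?T = "extend_scalars Zp Qp Zp_to_Qp M"
  have M: "gmodule Zp (sym_group ?n) M" using F by (simp add: is_form_def lattice_module_def)
  obtain B where B: "finite_basis Zp M B" using F by (auto simp: is_form_def lattice_module_def)
  obtain \<kappa> where \<kappa>: "coords M B \<kappa>" using finite_basis_coords[OF gmodule.axioms(1)[OF M] B] .
  \<comment> \<open>An embedding into the Fock space is only to be built, so the coordinates in a
    basis, read over the p-adic numbers, serve as the injective linear map.\<close>
  interpret tensor "sym_group ?n" M "\<lambda>x b. Zp_to_Qp (\<kappa> x b)"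
  proof (rule tensor.intro[OF M])
    fix x y assume xy: "x \<in> carrier M" "y \<in> carrier M" and eq: "(\<lambda>b. Zp_to_Qp (\<kappa> x b)) = (\<lambda>b. Zp_to_Qp (\<kappa> y b))"
    have "\<kappa> x = \<kappa> y"
    proof
      fix b show "\<kappa> x b = \<kappa> y b" using fun_cong[OF eq, of b] by simp
    qed
    then show "x = y" using coords_inj[OF \<kappa> xy] by simp
  qed (auto simp: coords_add[OF \<kappa>] coords_smult[OF \<kappa>] fun_algebra)
  obtain F where bij: "bij_betw F (carrier ?T) (carrier V)"
    and Fadd: "\<And>C D. C \<in> carrier ?T \<Longrightarrow> D \<in> carrier ?T \<Longrightarrow> F (C \<oplus>\<^bsub>?T\<^esub> D) = F C \<oplus>\<^bsub>V\<^esub> F D"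
    and Fsc: "\<And>a C. C \<in> carrier ?T \<Longrightarrow> F (a \<odot>\<^bsub>?T\<^esub> C) = a \<odot>\<^bsub>V\<^esub> F C"
    and Fact: "\<And>g C. g \<in> carrier (sym_group ?n) \<Longrightarrow> C \<in> carrier ?T \<Longrightarrow> F (act ?T g C) = act V g (F C)"
    using F by (auto simp: is_form_def gmodule_iso_def carrier_class)
  have c: "coords V {I. I \<subseteq> {..<d} \<and> card I = k} \<Phi>"
    using V by (simp add: model_def)
  define e where "e x = T.cls (bs (1, x))" for x
  have bX: "bs (c, x) \<in> fc X" if "x \<in> carrier M" for c :: "'p padic_int fract" and x using that by (intro fc_bs) auto
  have eT: "e x \<in> carrier ?T" if "x \<in> carrier M" for x
    unfolding e_def T_P[symmetric] T.carrier_P using bX[OF that] by (rule imageI)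
  have FV: "F C \<in> carrier V" if "C \<in> carrier ?T" for C using bij that by (auto simp: bij_betw_def)
  define \<iota> where "\<iota> x = \<Phi> (F (e x))" for x
  have e_add: "e (x \<oplus>\<^bsub>M\<^esub> y) = e x \<oplus>\<^bsub>?T\<^esub> e y" if "x \<in> carrier M" "y \<in> carrier M" for x y
  proof -
    have b: "bs (1, x) \<in> fc X" "bs (1, y) \<in> fc X" "bs (1, x \<oplus>\<^bsub>M\<^esub> y) \<in> fc X"
      using that by (auto intro!: bX)
    have "lin w (bs (1, x \<oplus>\<^bsub>M\<^esub> y)) = lin w (bs (1, x) + bs (1, y))"
      unfolding lin_add[OF b(1,2)] using that by (simp add: w_def eps_add)
    then show ?thesis
      unfolding e_def T_P[symmetric] T.add_P[OF b(1,2)] T.cls_eq_iff[OF b(3) fc_add[OF b(1,2)]] .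
  qed
  have e_sc: "e (a \<odot>\<^bsub>M\<^esub> x) = Zp_to_Qp a \<odot>\<^bsub>?T\<^esub> e x" if "x \<in> carrier M" for a x
  proof -
    have b: "bs (1, x) \<in> fc X" "bs (1, a \<odot>\<^bsub>M\<^esub> x) \<in> fc X"
      using that by (auto intro!: bX)
    have "lin w (bs (1, a \<odot>\<^bsub>M\<^esub> x)) = lin w (sc (Zp_to_Qp a) (bs (1, x)))"
      unfolding lin_sc[OF b(1)] using that by (simp add: w_def eps_smult)
    then show ?thesis
      unfolding e_def T_P[symmetric] T.smult_P[OF b(1)] T.cls_eq_iff[OF b(2) fc_sc[OF b(1)]] .
  qed
  have e_inj: "x = y" if "x \<in> carrier M" "y \<in> carrier M" "e x = e y" for x y
  proof -
    have "lin w (bs (1, x)) = lin w (bs (1, y))"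
      using that(3) unfolding e_def T.cls_eq_iff[OF bX[OF that(1)] bX[OF that(2)]] .
    then show ?thesis by (intro eps_inj[OF that(1,2)]) (simp add: w_def)
  qed
  have e_act: "e (act M g x) = act ?T g (e x)" if "g \<in> carrier (sym_group ?n)" "x \<in> carrier M" for g x
    unfolding e_def T_P[symmetric] T.act_P[OF that(1) bX[OF that(2)]] by simp
  have "emb d k M \<iota>"
    unfolding emb_def
  proof (intro conjI ballI allI impI)
    show "inj_on \<iota> (carrier M)"
    proof (rule inj_onI)
      fix x y assume xy: "x \<in> carrier M" "y \<in> carrier M" "\<iota> x = \<iota> y"
      then have "F (e x) = F (e y)" unfolding \<iota>_def using coords_inj[OF c FV[OF eT] FV[OF eT]] by blast
      then have "e x = e y" using bij eT xy unfolding bij_betw_def by (metis inj_onD)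
      then show "x = y" using e_inj xy by blast
    qed
    show "\<iota> ` carrier M \<subseteq> W d k"
      unfolding W_eq_fc \<iota>_def using coords_in[OF c] FV eT by blast
  next
    fix x y assume "x \<in> carrier M" "y \<in> carrier M"
    then show "\<iota> (x \<oplus>\<^bsub>M\<^esub> y) = \<iota> x + \<iota> y"
      unfolding \<iota>_def by (simp add: e_add Fadd eT coords_add[OF c] FV)
  next
    fix a x assume "x \<in> carrier M"
    then show "\<iota> (a \<odot>\<^bsub>M\<^esub> x) = sc (Zp_to_Qp a) (\<iota> x)"
      unfolding \<iota>_def by (simp add: e_sc Fsc eT coords_smult[OF c] FV)
  next
    fix a b x assume ab: "a \<in> {1..?n}" "b \<in> {1..?n}" and x: "x \<in> carrier M" and ne: "a \<noteq> b"
    have "\<iota> (act M (Transposition.transpose a b) x) = \<Phi> (act V (Transposition.transpose a b) (F (e x)))"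
      unfolding \<iota>_def using e_act[OF transpose_in_sym_group[OF ab] x] Fact[OF transpose_in_sym_group[OF ab] eT[OF x]] by simp
    also have "\<dots> = \<iota> x - Q d (rvec d a b) (rform d a b) (\<iota> x)"
      using V ab ne FV[OF eT[OF x]] unfolding model_def \<iota>_def by blast
    finally show "\<iota> (act M (Transposition.transpose a b) x) = \<iota> x - Q d (rvec d a b) (rform d a b) (\<iota> x)" .
  qed
  moreover have "spans d k (\<iota> ` carrier M)"
    unfolding spans_def
  proof
    fix v :: "nat set \<Rightarrow> 'p padic_int fract" assume "v \<in> W d k"
    then obtain y where y: "y \<in> carrier V" "v = \<Phi> y" using coords_surj[OF c] by (auto simp: W_eq_fc)
    then obtain C where C: "C \<in> carrier ?T" "y = F C" using bij by (auto simp: bij_betw_def)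
    have Cp: "C \<in> carrier T.P" using C(1) by (simp only: T_P)
    then have "T.bar C \<in> T.bar ` carrier T.P" by (rule imageI)
    then obtain b x where b: "b \<noteq> 0" "x \<in> carrier M" "sc (Zp_to_Qp b) (T.bar C) = (\<lambda>b. Zp_to_Qp (\<kappa> x b))"
      unfolding bar_image by blast
    have "T.bar (Zp_to_Qp b \<odot>\<^bsub>T.P\<^esub> C) = T.bar (e x)"
      unfolding T.bar_smult[OF Cp] e_def T.bar_cls[OF bX[OF b(2)]] b(3) by (simp add: w_def)
    moreover have "Zp_to_Qp b \<odot>\<^bsub>T.P\<^esub> C \<in> carrier T.P"
      by (rule Module.module.smult_closed[OF gmodule.axioms(1)[OF T.gmodule_P] carrier_class Cp])
    ultimately have "Zp_to_Qp b \<odot>\<^bsub>?T\<^esub> C = e x"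
      using inj_onD[OF T.inj_bar] eT[OF b(2)] unfolding T_P by blast
    then have "sc (Zp_to_Qp b) v = \<iota> x"
      using Fsc[OF C(1), of "Zp_to_Qp b"] coords_smult[OF c y(1), of "Zp_to_Qp b"] by (simp add: y C \<iota>_def)
    then show "\<exists>b. b \<noteq> 0 \<and> sc (Zp_to_Qp b) v \<in> \<iota> ` carrier M" using b by blast
  qed
  ultimately show ?thesis using that by blast
qed

section \<open>Isomorphism types of forms\<close>

lemma common_denominator:
  fixes f :: "'i \<Rightarrow> 'p::prime_card padic_int fract"
  assumes "finite A"
  obtains a where "a \<noteq> 0" "\<And>i. i \<in> A \<Longrightarrow> \<exists>r. Zp_to_Qp a * f i = Zp_to_Qp r"
proof -
  have "\<exists>a. a \<noteq> 0 \<and> (\<forall>i\<in>A. \<exists>r. Zp_to_Qp a * f i = Zp_to_Qp r)"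
    using assms
  proof (induction A rule: finite_induct)
    case empty
    show ?case by (intro exI[of _ 1]) simp
  next
    case (insert i A)
    then obtain a where a: "a \<noteq> 0" "\<And>i. i \<in> A \<Longrightarrow> \<exists>r. Zp_to_Qp a * f i = Zp_to_Qp r" by blast
    obtain r b where b: "b \<noteq> 0" "f i = Zp_to_Qp r / Zp_to_Qp b" by (rule Qp_fraction)
    have "\<exists>r. Zp_to_Qp (a * b) * f j = Zp_to_Qp r" if j: "j \<in> insert i A" for j
    proof (cases "j = i")
      case True
      then show ?thesis using b by (intro exI[of _ "a * r"]) simp
    next
      case False
      then obtain s where "Zp_to_Qp a * f j = Zp_to_Qp s" using a(2) j by blast
      then have "Zp_to_Qp (a * b) * f j = Zp_to_Qp (b * s)" by (simp add: ac_simps)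
      then show ?thesis by blast
    qed
    then show ?case using a(1) b(1) by (intro exI[of _ "a * b"]) simp
  qed
  then show ?thesis using that by blast
qed

lemma finite_idx: "finite {I :: nat set. I \<subseteq> {..<d} \<and> card I = k}"
  by (rule finite_subset[of _ "Pow {..<d}"]) auto

lemma stdlat_I:
  assumes "x \<in> W d k" "\<And>I. I \<subseteq> {..<d} \<Longrightarrow> card I = k \<Longrightarrow> \<exists>r. x I = c * Zp_to_Qp (r * (if 0 \<in> I then 1 else t))"
  shows "x \<in> stdlat d k c t"
  unfolding stdlat_def
proof (intro CollectI conjI allI)
  fix I show "\<exists>r. x I = c * Zp_to_Qp (r * (if 0 \<in> I then 1 else t))"
  proof (cases "x I = 0")
    case True
    then show ?thesis by (intro exI[of _ 0]) simp
  next
    case False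
    then show ?thesis using W_D[OF assms(1)] assms(2) by blast
  qed
qed (rule assms(1))

lemma spans_stdlat:
  assumes "c \<noteq> 0" "t \<noteq> 0"
  shows "spans d k (stdlat d k c t)"
  unfolding spans_def
proof
  fix v :: "nat set \<Rightarrow> 'a padic_int fract" assume v: "v \<in> W d k"
  obtain a where a: "a \<noteq> 0" "\<And>I. I \<in> {I. I \<subseteq> {..<d} \<and> card I = k} \<Longrightarrow> \<exists>r. Zp_to_Qp a * (v I / c) = Zp_to_Qp r"
    using common_denominator[OF finite_idx, of d k "\<lambda>I. v I / c"] by blast
  \<comment> \<open>Here \<open>a\<close> clears the denominators of v/c, and the factor t makes the
    coordinates at sets without 0 divisible by t.\<close>
  have "sc (Zp_to_Qp (a * t)) v \<in> stdlat d k c t"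
  proof (rule stdlat_I)
    fix I assume "I \<subseteq> {..<d}" "card I = k"
    then obtain r where r: "Zp_to_Qp a * (v I / c) = Zp_to_Qp r" using a(2) by blast
    have "sc (Zp_to_Qp (a * t)) v I = c * Zp_to_Qp t * (Zp_to_Qp a * (v I / c))"
      using assms(1) by (simp add: sc_apply)
    also have "\<dots> = c * Zp_to_Qp (r * (if 0 \<in> I then t else 1) * (if 0 \<in> I then 1 else t))"
      unfolding r by simp
    finally show "\<exists>r. sc (Zp_to_Qp (a * t)) v I = c * Zp_to_Qp (r * (if 0 \<in> I then 1 else t))" by blast
  qed (use v in \<open>rule W_sc\<close>)
  then show "\<exists>b. b \<noteq> 0 \<and> sc (Zp_to_Qp b) v \<in> stdlat d k c t" using a(1) assms(2) by (intro exI[of _ "a * t"]) simp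
qed

lemma stdlat_unit_sub:
  assumes "w dvd 1"
  shows "stdlat d k c t \<subseteq> stdlat d k c (w * t)"
proof
  fix x assume x: "x \<in> stdlat d k c t"
  obtain w' where w': "1 = w * w'" using assms by (auto elim: dvdE)
  show "x \<in> stdlat d k c (w * t)"
  proof (rule stdlat_I[OF stdlat_W[OF x]])
    fix I
    obtain r where r: "x I = c * Zp_to_Qp (r * (if 0 \<in> I then 1 else t))" using stdlat_D[OF x] by blast
    have "r * t = r * (w * w') * t" unfolding w'[symmetric] by simp
    also have "\<dots> = r * w' * (w * t)" by (simp add: ac_simps)
    finally have "x I = c * Zp_to_Qp ((if 0 \<in> I then r else r * w') * (if 0 \<in> I then 1 else w * t))"
      unfolding r by (simp del: Zp_to_Qp_simps)
    then show "\<exists>r. x I = c * Zp_to_Qp (r * (if 0 \<in> I then 1 else w * t))" by blast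
  qed
qed

lemma stdlat_unit:
  assumes "w dvd 1"
  shows "stdlat d k c (w * t) = stdlat d k c t"
proof
  obtain w' where w': "1 = w * w'" using assms by (auto elim: dvdE)
  then have "w' dvd 1" by (metis dvd_triv_right)
  then have "stdlat d k c (w * t) \<subseteq> stdlat d k c (w' * (w * t))" by (rule stdlat_unit_sub)
  also have "w' * (w * t) = (w * w') * t" by (simp add: ac_simps)
  finally show "stdlat d k c (w * t) \<subseteq> stdlat d k c t" by (simp flip: w')
qed (rule stdlat_unit_sub[OF assms])

lemma stdlat_rescale:
  assumes "c \<noteq> 0"
  shows "sc (c' / c) ` stdlat d k c t \<subseteq> stdlat d k c' t"
proof
  fix y assume "y \<in> sc (c' / c) ` stdlat d k c t"
  then obtain x where x: "x \<in> stdlat d k c t" "y = sc (c' / c) x" by blast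
  show "y \<in> stdlat d k c' t"
    unfolding x(2)
  proof (rule stdlat_I[OF W_sc[OF stdlat_W[OF x(1)]]])
    fix I
    obtain r where "x I = c * Zp_to_Qp (r * (if 0 \<in> I then 1 else t))" using stdlat_D[OF x(1)] by blast
    then show "\<exists>r. sc (c' / c) x I = c' * Zp_to_Qp (r * (if 0 \<in> I then 1 else t))"
      using assms by (intro exI[of _ r]) (simp add: sc_apply)
  qed
qed

text \<open>The factor \<open>c\<close> is left open because multiplication by a nonzero p-adic
  number is an equivariant isomorphism; only \<open>t\<close> can matter.\<close>

definition ltype :: "nat \<Rightarrow> nat \<Rightarrow> 'p::prime_card padic_int \<Rightarrow> ('p padic_int, 'm, nat \<Rightarrow> nat) gmodule \<Rightarrow> bool"
  where "ltype d k t M \<longleftrightarrow> lattice_module Zp (sym_group (Suc d)) M \<and>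
    (\<exists>\<iota> c. c \<noteq> 0 \<and> emb d k M \<iota> \<and> \<iota> ` carrier M = stdlat d k c t)"

lemma is_form_of_ltype:
  assumes "model d k V \<Phi>" "ltype d k t M" "t \<noteq> 0"
  shows "is_form (Suc d) V M"
proof -
  obtain \<iota> c where "c \<noteq> 0" "emb d k M \<iota>" "\<iota> ` carrier M = stdlat d k c t" using assms(2) by (auto simp: ltype_def)
  moreover from this have "spans d k (\<iota> ` carrier M)" using spans_stdlat assms(3) by simp
  ultimately show ?thesis
    using assms(2) is_form_of_emb[OF assms(1), of M \<iota>] by (simp add: ltype_def)
qed

lemma emb_finsum:
  assumes M: "Module.module Zp M" and \<iota>: "emb d k M \<iota>" and "finite A" "u \<in> A \<rightarrow> carrier M"
  shows "\<iota> (finsum M u A) = (\<Sum>b\<in>A. \<iota> (u b))"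
proof -
  interpret Module.module Zp M by (rule M)
  have z: "\<iota> \<zero>\<^bsub>M\<^esub> = 0" using emb_smult[OF \<iota>, of "\<zero>\<^bsub>M\<^esub>" 0] smult_r_null[of 0] by (simp add: carrier_class)
  show ?thesis
    using assms(3,4)
  proof (induction A rule: finite_induct)
    case (insert b A)
    then show ?case by (simp add: emb_add[OF \<iota>] Pi_iff)
  qed (simp add: z)
qed

text \<open>Finitely many generators have a common denominator at each coordinate, and integral
  combinations do not enlarge it.\<close>

lemma emb_bounded:
  fixes M :: "('p::prime_card padic_int, 'm, nat \<Rightarrow> nat) gmodule"
  assumes lat: "lattice_module Zp G M" and \<iota>: "emb d k M \<iota>"
  shows "\<exists>a. a \<noteq> 0 \<and> (\<forall>x\<in>\<iota> ` carrier M. \<exists>r. Zp_to_Qp a * x I = Zp_to_Qp r)"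
proof -
  have M: "Module.module Zp M" using lat gmodule.axioms(1) by (auto simp: lattice_module_def)
  interpret Module.module Zp M by (rule M)
  obtain B where fb: "finite_basis Zp M B" using lat by (auto simp: lattice_module_def)
  have B: "finite B" "B \<subseteq> carrier M"
    and ex: "\<And>x. x \<in> carrier M \<Longrightarrow> \<exists>!c. c \<in> B \<rightarrow>\<^sub>E carrier Zp \<and> x = (\<Oplus>\<^bsub>M\<^esub>b\<in>B. c b \<odot>\<^bsub>M\<^esub> b)"
    using fb by (auto simp: finite_basis_def)
  obtain a where a: "a \<noteq> 0" "\<And>b. b \<in> B \<Longrightarrow> \<exists>r. Zp_to_Qp a * \<iota> b I = Zp_to_Qp r"
    using common_denominator[OF B(1), of "\<lambda>b. \<iota> b I"] by blast
  then obtain r where r: "\<And>b. b \<in> B \<Longrightarrow> Zp_to_Qp a * \<iota> b I = Zp_to_Qp (r b)" by metis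
  have "\<exists>s. Zp_to_Qp a * \<iota> x I = Zp_to_Qp s" if x: "x \<in> carrier M" for x
  proof -
    obtain c where c: "x = (\<Oplus>\<^bsub>M\<^esub>b\<in>B. c b \<odot>\<^bsub>M\<^esub> b)" using ex1_implies_ex[OF ex[OF x]] by blast
    have "\<iota> x = (\<Sum>b\<in>B. \<iota> (c b \<odot>\<^bsub>M\<^esub> b))"
      unfolding c using B by (intro emb_finsum[OF M \<iota>]) (auto simp: carrier_class)
    also have "\<dots> = (\<Sum>b\<in>B. sc (Zp_to_Qp (c b)) (\<iota> b))"
      using B(2) by (intro sum.cong refl emb_smult[OF \<iota>]) auto
    finally have "Zp_to_Qp a * \<iota> x I = (\<Sum>b\<in>B. Zp_to_Qp (c b) * (Zp_to_Qp a * \<iota> b I))"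
      by (simp add: sum_fun_apply sc_apply sum_distrib_left ac_simps)
    also have "\<dots> = (\<Sum>b\<in>B. Zp_to_Qp (c b * r b))" by (intro sum.cong) (simp_all add: r)
    finally have "Zp_to_Qp a * \<iota> x I = Zp_to_Qp (\<Sum>b\<in>B. c b * r b)" by (simp only: Zp_to_Qp_sum)
    then show ?thesis by blast
  qed
  then show ?thesis using a(1) by blast
qed

context
  fixes M :: "('p::prime_card padic_int, 'm, nat \<Rightarrow> nat) gmodule" and d k \<iota>
  assumes gM: "gmodule Zp (sym_group (Suc d)) M" and \<iota>: "emb d k M \<iota>"
begin

lemma emb_image_add: "x \<in> \<iota> ` carrier M \<Longrightarrow> y \<in> \<iota> ` carrier M \<Longrightarrow> x + y \<in> \<iota> ` carrier M"
proof -
  interpret Module.module Zp M using gM by (rule gmodule.axioms(1))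
  show "x \<in> \<iota> ` carrier M \<Longrightarrow> y \<in> \<iota> ` carrier M \<Longrightarrow> x + y \<in> \<iota> ` carrier M"
    by (auto simp flip: emb_add[OF \<iota>])
qed

lemma emb_image_sc: "x \<in> \<iota> ` carrier M \<Longrightarrow> sc (Zp_to_Qp r) x \<in> \<iota> ` carrier M"
proof -
  interpret Module.module Zp M using gM by (rule gmodule.axioms(1))
  show "x \<in> \<iota> ` carrier M \<Longrightarrow> sc (Zp_to_Qp r) x \<in> \<iota> ` carrier M"
    by (auto simp: carrier_class simp flip: emb_smult[OF \<iota>])
qed

lemma emb_image_Q:
  assumes ab: "a \<in> {1..Suc d}" "b \<in> {1..Suc d}" "a \<noteq> b" and x: "x \<in> \<iota> ` carrier M"
  shows "Q d (rvec d a b) (rform d a b) x \<in> \<iota> ` carrier M"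
proof -
  obtain m where m: "m \<in> carrier M" "x = \<iota> m" using x by blast
  let ?s = "act M (Transposition.transpose a b) m"
  have s: "?s \<in> carrier M" by (rule gmodule_act_closed[OF gM transpose_in_sym_group[OF ab(1,2)] m(1)])
  have "Q d (rvec d a b) (rform d a b) x = x + sc (Zp_to_Qp (- 1)) (\<iota> ?s)"
    using emb_act[OF \<iota> ab m(1)] by (simp add: m(2))
  then show ?thesis using emb_image_add[OF x emb_image_sc[where r = "- 1", OF imageI[OF s]]] by simp
qed

end

text \<open>The isomorphism is multiplication by c'/c between the two images in the Fock
  space.\<close>

lemma ltype_iso:
  assumes M: "ltype d k t M" and N: "ltype d k t N"
  shows "gmodule_iso Zp (sym_group (Suc d)) M N"
proof -
  obtain \<iota> c where \<iota>: "c \<noteq> 0" "emb d k M \<iota>" "\<iota> ` carrier M = stdlat d k c t" using M by (auto simp: ltype_def)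
  obtain \<iota>' c' where \<iota>': "c' \<noteq> 0" "emb d k N \<iota>'" "\<iota>' ` carrier N = stdlat d k c' t" using N by (auto simp: ltype_def)
  have gM: "gmodule Zp (sym_group (Suc d)) M" and gN: "gmodule Zp (sym_group (Suc d)) N"
    using M N by (auto simp: ltype_def lattice_module_def)
  interpret M: Module.module Zp M using gM by (rule gmodule.axioms(1))
  interpret N: Module.module Zp N using gN by (rule gmodule.axioms(1))
  define f where "f x = the_inv_into (carrier N) \<iota>' (sc (c' / c) (\<iota> x))" for x
  have inj: "inj_on \<iota>' (carrier N)" using \<iota>'(2) by (simp add: emb_def)
  have mem: "sc (c' / c) (\<iota> x) \<in> \<iota>' ` carrier N" if "x \<in> carrier M" for x
    using stdlat_rescale[OF \<iota>(1)] \<iota>(3) \<iota>'(3) that by blast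
  have fN: "f x \<in> carrier N" and f: "\<iota>' (f x) = sc (c' / c) (\<iota> x)" if "x \<in> carrier M" for x
    unfolding f_def using the_inv_into_into[OF inj mem[OF that]] f_the_inv_into_f[OF inj mem[OF that]] by auto
  have fu: "f x = y" if "x \<in> carrier M" "y \<in> carrier N" "\<iota>' y = sc (c' / c) (\<iota> x)" for x y
    using emb_inj[OF \<iota>'(2) fN[OF that(1)] that(2)] f[OF that(1)] that(3) by simp
  have bij: "bij_betw f (carrier M) (carrier N)"
  proof (rule bij_betwI')
    fix x y assume xy: "x \<in> carrier M" "y \<in> carrier M"
    show "f x = f y \<longleftrightarrow> x = y"
    proof
      assume "f x = f y"
      then have "sc (c / c') (sc (c' / c) (\<iota> x)) = sc (c / c') (sc (c' / c) (\<iota> y))" using f xy by metis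
      then have "\<iota> x = \<iota> y" using \<iota>(1) \<iota>'(1) by simp
      then show "x = y" using emb_inj[OF \<iota>(2) xy] by simp
    qed simp
  next
    fix y assume y: "y \<in> carrier N"
    then have "sc (c / c') (\<iota>' y) \<in> \<iota> ` carrier M" using stdlat_rescale[OF \<iota>'(1)] \<iota>(3) \<iota>'(3) by blast
    then obtain x where x: "x \<in> carrier M" "\<iota> x = sc (c / c') (\<iota>' y)" by auto
    have "f x = y" by (rule fu[OF x(1) y]) (use \<iota>(1) \<iota>'(1) x(2) in simp)
    then show "\<exists>x\<in>carrier M. y = f x" using x(1) by blast
  qed (rule fN)
  have add: "f (x \<oplus>\<^bsub>M\<^esub> y) = f x \<oplus>\<^bsub>N\<^esub> f y" if "x \<in> carrier M" "y \<in> carrier M" for x y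
    using that fN by (intro fu) (simp_all add: emb_add[OF \<iota>(2)] emb_add[OF \<iota>'(2)] f sc_add_right)
  have smult: "f (a \<odot>\<^bsub>M\<^esub> x) = a \<odot>\<^bsub>N\<^esub> f x" if "x \<in> carrier M" for a x
    using that fN by (intro fu) (simp_all add: emb_smult[OF \<iota>(2)] emb_smult[OF \<iota>'(2)] f carrier_class mult.commute)
  have act: "f (act M g x) = act N g (f x)" if "g \<in> carrier (sym_group (Suc d))" "x \<in> carrier M" for g x
  proof (rule equivariant_of_transpositions[OF gM gN fN _ that])
    fix a b x assume ab: "a \<in> {1..Suc d}" "b \<in> {1..Suc d}" "a \<noteq> b" and x: "x \<in> carrier M"
    note tg = transpose_in_sym_group[OF ab(1,2)]
    show "f (act M (Transposition.transpose a b) x) = act N (Transposition.transpose a b) (f x)"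
    proof (rule fu)
      show "\<iota>' (act N (Transposition.transpose a b) (f x)) = sc (c' / c) (\<iota> (act M (Transposition.transpose a b) x))"
        using emb_act[OF \<iota>(2) ab x] emb_act[OF \<iota>'(2) ab fN[OF x]] by (simp add: f[OF x] Q_linear sc_diff_right)
    qed (rule gmodule_act_closed[OF gM tg x], rule gmodule_act_closed[OF gN tg fN[OF x]])
  qed
  show ?thesis
    unfolding gmodule_iso_def by (rule exI[of _ f]) (use bij add smult act in blast)
qed

lemma gmodule_iso_sym:
  assumes gM: "gmodule R G M" and iso: "gmodule_iso R G M N"
  shows "gmodule_iso R G N M"
proof -
  interpret Module.module R M using gM by (rule gmodule.axioms(1))
  obtain f where f: "bij_betw f (carrier M) (carrier N)"
    "\<And>x y. x \<in> carrier M \<Longrightarrow> y \<in> carrier M \<Longrightarrow> f (x \<oplus>\<^bsub>M\<^esub> y) = f x \<oplus>\<^bsub>N\<^esub> f y"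
    "\<And>a x. a \<in> carrier R \<Longrightarrow> x \<in> carrier M \<Longrightarrow> f (a \<odot>\<^bsub>M\<^esub> x) = a \<odot>\<^bsub>N\<^esub> f x"
    "\<And>g x. g \<in> carrier G \<Longrightarrow> x \<in> carrier M \<Longrightarrow> f (act M g x) = act N g (f x)"
    using iso unfolding gmodule_iso_def by blast
  define h where "h = the_inv_into (carrier M) f"
  have h: "bij_betw h (carrier N) (carrier M)" unfolding h_def by (rule bij_betw_the_inv_into[OF f(1)])
  have hM: "h y \<in> carrier M" and fh: "f (h y) = y" if "y \<in> carrier N" for y
    using h that f_the_inv_into_f_bij_betw[OF f(1) that] by (auto simp: bij_betw_def h_def)
  have hf: "h (f x) = x" if "x \<in> carrier M" for x
    using f(1) that unfolding h_def bij_betw_def by (simp add: the_inv_into_f_f)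
  have "h (x \<oplus>\<^bsub>N\<^esub> y) = h x \<oplus>\<^bsub>M\<^esub> h y" if "x \<in> carrier N" "y \<in> carrier N" for x y
    using f(2)[OF hM hM, of x y] hf[of "h x \<oplus>\<^bsub>M\<^esub> h y"] fh hM that by simp
  moreover have "h (a \<odot>\<^bsub>N\<^esub> x) = a \<odot>\<^bsub>M\<^esub> h x" if "a \<in> carrier R" "x \<in> carrier N" for a x
    using f(3)[OF that(1) hM[OF that(2)]] hf[of "a \<odot>\<^bsub>M\<^esub> h x"] fh hM that by simp
  moreover have "h (act N g x) = act M g (h x)" if "g \<in> carrier G" "x \<in> carrier N" for g x
    using f(4)[OF that(1) hM[OF that(2)]] hf[OF gmodule_act_closed[OF gM that(1) hM[OF that(2)]]] fh[OF that(2)] by simp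
  ultimately show ?thesis unfolding gmodule_iso_def using h by blast
qed

text \<open>Moved into the Fock space, the isomorphism becomes a map \<open>h\<close> of standard
  lattices. The generators of \<open>ops\<close> are 1 minus a transposition, so \<open>h\<close>
  commutes with all of \<open>ops\<close> and \<open>stable_lattice_invariant\<close>
  applies.\<close>

lemma ltype_dvd:
  fixes M :: "('p::prime_card padic_int, 'm, nat \<Rightarrow> nat) gmodule"
  assumes d: "d \<ge> 2" and k: "1 \<le> k" "k < d" and two: "(2 :: 'p padic_int) dvd 1"
    and M: "ltype d k t M" and N: "ltype d k t' N" and iso: "gmodule_iso Zp (sym_group (Suc d)) M N"
  shows "t' dvd t"
proof -
  obtain \<iota> c where \<iota>: "c \<noteq> 0" "emb d k M \<iota>" "\<iota> ` carrier M = stdlat d k c t" using M by (auto simp: ltype_def)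
  obtain \<iota>' c' where \<iota>': "c' \<noteq> 0" "emb d k N \<iota>'" "\<iota>' ` carrier N = stdlat d k c' t'" using N by (auto simp: ltype_def)
  have gM: "gmodule Zp (sym_group (Suc d)) M" using M by (auto simp: ltype_def lattice_module_def)
  interpret M: Module.module Zp M using gM by (rule gmodule.axioms(1))
  obtain f where f: "bij_betw f (carrier M) (carrier N)"
    "\<And>x y. x \<in> carrier M \<Longrightarrow> y \<in> carrier M \<Longrightarrow> f (x \<oplus>\<^bsub>M\<^esub> y) = f x \<oplus>\<^bsub>N\<^esub> f y"
    "\<And>a x. x \<in> carrier M \<Longrightarrow> f (a \<odot>\<^bsub>M\<^esub> x) = a \<odot>\<^bsub>N\<^esub> f x"
    "\<And>g x. g \<in> carrier (sym_group (Suc d)) \<Longrightarrow> x \<in> carrier M \<Longrightarrow> f (act M g x) = act N g (f x)"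
    using iso unfolding gmodule_iso_def by (auto simp: carrier_class)
  have fN: "f x \<in> carrier N" if "x \<in> carrier M" for x using f(1) that by (auto simp: bij_betw_def)
  have inj: "inj_on \<iota> (carrier M)" using \<iota>(2) by (simp add: emb_def)
  define h where "h y = \<iota>' (f (the_inv_into (carrier M) \<iota> y))" for y
  have h: "h (\<iota> x) = \<iota>' (f x)" if "x \<in> carrier M" for x
    using that by (simp add: h_def the_inv_into_f_f[OF inj])
  have surj: "h ` stdlat d k c t = stdlat d k c' t'"
  proof -
    have "h ` stdlat d k c t = (\<lambda>x. \<iota>' (f x)) ` carrier M" unfolding \<iota>(3)[symmetric] image_image by (rule image_cong) (auto simp: h)
    also have "\<dots> = \<iota>' ` carrier N" using f(1) unfolding bij_betw_def by (simp flip: image_image)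
    finally show ?thesis by (simp add: \<iota>')
  qed
  have hadd: "h (x + y) = h x + h y" if x: "x \<in> stdlat d k c t" and y: "y \<in> stdlat d k c t" for x y
  proof -
    obtain m m' where m: "m \<in> carrier M" "x = \<iota> m" "m' \<in> carrier M" "y = \<iota> m'"
      using x y unfolding \<iota>(3)[symmetric] by blast
    then show ?thesis
      using h[of "m \<oplus>\<^bsub>M\<^esub> m'"] by (simp add: emb_add[OF \<iota>(2)] f h emb_add[OF \<iota>'(2)] fN)
  qed
  have hsc: "h (sc (Zp_to_Qp r) x) = sc (Zp_to_Qp r) (h x)" if x: "x \<in> stdlat d k c t" for r x
  proof -
    obtain m where m: "m \<in> carrier M" "x = \<iota> m" using x unfolding \<iota>(3)[symmetric] by blast
    then show ?thesis
      using h[of "r \<odot>\<^bsub>M\<^esub> m"] by (simp add: emb_smult[OF \<iota>(2)] f h emb_smult[OF \<iota>'(2)] fN carrier_class)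
  qed
  have hQ: "h (Q d (rvec d a b) (rform d a b) x) = Q d (rvec d a b) (rform d a b) (h x)"
    if ab: "a \<in> {1..Suc d}" "b \<in> {1..Suc d}" "a \<noteq> b" and x: "x \<in> stdlat d k c t" for a b x
  proof -
    obtain m where m: "m \<in> carrier M" "x = \<iota> m" using x unfolding \<iota>(3)[symmetric] by blast
    let ?s = "act M (Transposition.transpose a b) m"
    note tg = transpose_in_sym_group[OF ab(1,2)]
    have s: "?s \<in> carrier M" by (rule gmodule_act_closed[OF gM tg m(1)])
    then have "\<iota> ?s \<in> stdlat d k c t" using \<iota>(3) by blast
    moreover have "Q d (rvec d a b) (rform d a b) x \<in> stdlat d k c t"
      using emb_image_Q[OF gM \<iota>(2) ab] x unfolding \<iota>(3) .
    \<comment> \<open>All three vectors lie in the lattice, so additivity of \<open>h\<close>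
      carries equivariance under the transposition over to \<open>Q\<close>.\<close>
    moreover have "x = \<iota> ?s + Q d (rvec d a b) (rform d a b) x"
      using emb_act[OF \<iota>(2) ab m(1)] m(2) by simp
    ultimately have "h x = h (\<iota> ?s) + h (Q d (rvec d a b) (rform d a b) x)" using hadd by metis
    moreover have "h (\<iota> ?s) = h x - Q d (rvec d a b) (rform d a b) (h x)"
      using emb_act[OF \<iota>'(2) ab fN[OF m(1)]] h[OF s] h[OF m(1)] f(4)[OF tg m(1)] m(2) by simp
    ultimately show ?thesis by (simp add: algebra_simps)
  qed
  have cl: "x + y \<in> stdlat d k c t" "sc (Zp_to_Qp r) x \<in> stdlat d k c t"
    if "x \<in> stdlat d k c t" "y \<in> stdlat d k c t" for x y r
    using that emb_image_add[OF gM \<iota>(2)] emb_image_sc[OF gM \<iota>(2)] unfolding \<iota>(3) by blast+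
  have clQ: "Q d (rvec d a b) (rform d a b) x \<in> stdlat d k c t"
    if "a \<in> {1..Suc d}" "b \<in> {1..Suc d}" "a \<noteq> b" "x \<in> stdlat d k c t" for a b x
    using emb_image_Q[OF gM \<iota>(2) that(1-3)] that(4) unfolding \<iota>(3) .
  show ?thesis
  proof (rule stable_lattice_invariant[OF d k two surj \<iota>'(1) hsc])
    fix A :: "(nat set \<Rightarrow> 'p padic_int fract) \<Rightarrow> nat set \<Rightarrow> 'p padic_int fract" and x
    assume A: "A \<in> ops d" and x: "x \<in> stdlat d k c t"
    show "h (A x) = A (h x)"
      by (rule ops_commute[OF A cl(1) cl(2)[OF _ x] clQ hadd hsc hQ x])
  qed
qed

lemma ltype_transfer:
  assumes M: "ltype d k t M" and iso: "gmodule_iso Zp (sym_group (Suc d)) M N"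
    and lat: "lattice_module Zp (sym_group (Suc d)) N"
  shows "ltype d k t N"
proof -
  obtain \<iota> c where \<iota>: "c \<noteq> 0" "emb d k M \<iota>" "\<iota> ` carrier M = stdlat d k c t" using M by (auto simp: ltype_def)
  have gM: "gmodule Zp (sym_group (Suc d)) M" using M by (auto simp: ltype_def lattice_module_def)
  obtain f where f: "bij_betw f (carrier N) (carrier M)"
    "\<And>x y. x \<in> carrier N \<Longrightarrow> y \<in> carrier N \<Longrightarrow> f (x \<oplus>\<^bsub>N\<^esub> y) = f x \<oplus>\<^bsub>M\<^esub> f y"
    "\<And>a x. x \<in> carrier N \<Longrightarrow> f (a \<odot>\<^bsub>N\<^esub> x) = a \<odot>\<^bsub>M\<^esub> f x"
    "\<And>g x. g \<in> carrier (sym_group (Suc d)) \<Longrightarrow> x \<in> carrier N \<Longrightarrow> f (act N g x) = act M g (f x)"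
    using gmodule_iso_sym[OF gM iso] unfolding gmodule_iso_def by (auto simp: carrier_class)
  have fM: "f x \<in> carrier M" if "x \<in> carrier N" for x using f(1) that by (auto simp: bij_betw_def)
  have "emb d k N (\<lambda>x. \<iota> (f x))"
    unfolding emb_def
  proof (intro conjI ballI allI impI)
    show "inj_on (\<lambda>x. \<iota> (f x)) (carrier N)"
      using comp_inj_on[of f "carrier N" \<iota>] f(1) \<iota>(2) by (simp add: bij_betw_def emb_def comp_def)
    show "(\<lambda>x. \<iota> (f x)) ` carrier N \<subseteq> W d k" using fM emb_W[OF \<iota>(2)] by blast
    show "\<iota> (f (act N (Transposition.transpose a b) x)) = \<iota> (f x) - Q d (rvec d a b) (rform d a b) (\<iota> (f x))"
      if "a \<in> {1..Suc d}" "b \<in> {1..Suc d}" "x \<in> carrier N" "a \<noteq> b" for a b x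
      using emb_act[OF \<iota>(2) that(1,2,4) fM[OF that(3)]] f(4)[OF transpose_in_sym_group[OF that(1,2)] that(3)] by simp
  qed (simp_all add: f fM emb_add[OF \<iota>(2)] emb_smult[OF \<iota>(2)])
  moreover have "(\<lambda>x. \<iota> (f x)) ` carrier N = stdlat d k c t"
    using f(1) \<iota>(3) unfolding bij_betw_def by (simp flip: image_image)
  ultimately show ?thesis unfolding ltype_def using lat \<iota>(1) by blast
qed

section \<open>Models of the Specht modules and lattices of every type\<close>

lemma rvec_support:
  assumes "a \<in> {1..Suc d}" "b \<in> {1..Suc d}" "i \<ge> d" "d \<ge> 2"
  shows "rvec d a b i = 0"
  using assms by (auto simp: rvec_def cv_def fun_algebra)

lemma coords_natural:
  assumes d: "d \<ge> 2"
  shows "coords (natural_specht (Rc :: 'r::idom ring) (Suc d)) {..<d} (co d)"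
proof -
  obtain \<kappa> where \<kappa>: "coords (sublat (Suc d) (1 :: 'r)) {..<d} \<kappa>"
    "\<And>x i. x \<in> sublat_set (Suc d) (1 :: 'r) \<Longrightarrow> co d x i = (if i = 0 then 1 else 1) * \<kappa> x i"
    by (rule coords_sublat[OF d, of "1 :: 'r"]) auto
  have eq: "\<kappa> x = co d x" if "x \<in> carrier (sublat (Suc d) (1 :: 'r))" for x
  proof
    fix i show "\<kappa> x i = co d x i" using \<kappa>(2)[of x i] that by simp
  qed
  have "bij_betw (co d) (carrier (sublat (Suc d) (1 :: 'r))) (fc {..<d})"
    using \<kappa>(1) bij_betw_cong[of "carrier (sublat (Suc d) (1 :: 'r))" \<kappa> "co d" "fc {..<d}"] eq
    by (simp add: coords_def)
  then show ?thesis unfolding coords_def sublat_one[symmetric] by (simp add: co_linear)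
qed

lemma co_act_natural:
  assumes d: "d \<ge> 2" and x: "x \<in> carrier (natural_specht (Rc :: 'r::idom ring) (Suc d))"
    and ab: "a \<in> {1..Suc d}" "b \<in> {1..Suc d}" "a \<noteq> b"
  shows "co d (act (natural_specht Rc (Suc d)) (Transposition.transpose a b) x) =
    co d x - sc (dot d (rform d a b) (co d x)) (rvec d a b)"
  using co_transpose[OF d _ ab, of x 1] x unfolding sublat_one[symmetric] by simp

text \<open>The coordinates of the natural module induce those of its exterior power, and
  \<open>wedge_reflection\<close> computes the transpositions there.\<close>

lemma model_hook:
  assumes d2: "d \<ge> 2"
  obtains \<Phi> where "model d k (hook_specht (Qp :: 'p::prime_card padic_int fract ring) (Suc d) k) \<Phi>"
proof -
  let ?V = "natural_specht (Qp :: 'p padic_int fract ring) (Suc d)"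
  interpret ext_power "sym_group (Suc d)" ?V d k "co d"
  proof (rule ext_power.intro)
    show "gmodule Qp (sym_group (Suc d)) ?V" unfolding sublat_one[symmetric] by (rule gmodule_sublat)
  qed (use coords_natural[OF d2] d2 in auto)
  have "model d k (exterior_power Qp k ?V) E.bar"
    unfolding model_def
  proof (intro conjI ballI impI)
    show "gmodule Qp (sym_group (Suc d)) (exterior_power Qp k ?V)" using E.gmodule_P by (simp add: E_P)
    show "coords (exterior_power Qp k ?V) {I. I \<subseteq> {..<d} \<and> card I = k} E.bar" by (rule E_coords)
    fix a b C assume ab: "a \<in> {1..Suc d}" "b \<in> {1..Suc d}" and C: "C \<in> carrier (exterior_power Qp k ?V)" and ne: "a \<noteq> b"
    let ?t = "Transposition.transpose a b"
    have "(\<lambda>x. x) (E.bar (act (exterior_power Qp k ?V) ?t C)) = E.bar C - Q d (rvec d a b) (rform d a b) (E.bar C)"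
    proof (rule E_act[OF transpose_in_sym_group[OF ab] C, where \<phi> = "\<lambda>a. a"])
      fix ms assume ms: "ms \<in> X"
      have "map (co d) (map (act ?V ?t) ms) = map (\<lambda>v. v - sc (dot d (rform d a b) v) (rvec d a b)) (map (co d) ms)"
        using ms co_act_natural[OF d2 _ ab ne] by (auto simp: tuples_def subset_iff)
      then show "w (map (act ?V ?t) ms) = w ms - Q d (rvec d a b) (rform d a b) (w ms)"
        unfolding w_def Q_def by (simp only: wedge_reflection)
    qed (simp_all only: reflection_linear)
    then show "E.bar (act (exterior_power Qp k ?V) ?t C) = E.bar C - Q d (rvec d a b) (rform d a b) (E.bar C)" .
  qed
  then show ?thesis using that by (simp add: hook_specht_def)
qed

lemma wedge_single_bij: "bij_betw (\<lambda>v. wedge d [v]) (fc {..<d}) (W d 1)"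
proof (rule bij_betwI')
  fix v v' :: "nat \<Rightarrow> 'a" assume v: "v \<in> fc {..<d}" "v' \<in> fc {..<d}"
  show "wedge d [v] = wedge d [v'] \<longleftrightarrow> v = v'"
  proof
    assume eq: "wedge d [v] = wedge d [v']"
    show "v = v'"
    proof
      fix i
      show "v i = v' i"
      proof (cases "i < d")
        case True
        then show ?thesis using wedge_single_apply[of i d v] wedge_single_apply[of i d v'] eq by metis
      next
        case False
        then have "v i = 0" "v' i = 0" using v unfolding fc_def by auto
        then show ?thesis by simp
      qed
    qed
  qed simp
next
  fix v :: "nat \<Rightarrow> 'a"
  show "wedge d [v] \<in> W d 1" using wedge_in_W[of d "[v]"] by simp
next
  fix x :: "nat set \<Rightarrow> 'a" assume x: "x \<in> W d 1"
  have "{i. (if i < d then x {i} else 0) \<noteq> 0} \<subseteq> {..<d}" by auto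
  then have "(\<lambda>i. if i < d then x {i} else 0) \<in> fc {..<d}" unfolding fc_def using finite_subset by blast
  then show "\<exists>v\<in>fc {..<d}. x = wedge d [v]" using wedge_single_inverse[OF x] by metis
qed

lemma wedge_single_linear: "wedge d [v + v'] = wedge d [v] + wedge d [v']" "wedge d [sc a v] = sc a (wedge d [v])"
  by (simp_all add: ext_mult_linear_left)

lemma wedge_single_reflection:
  "wedge d [v - sc (dot d \<phi> v) \<alpha>] = wedge d [v] - Q d \<alpha> \<phi> (wedge d [v])"
  using wedge_reflection[of d \<phi> \<alpha> "[v]"] by (simp add: Q_def)

text \<open>The natural Specht module is not literally its own first exterior power, so degree one
  gets a separate model by single wedges.\<close>

lemma model_natural:
  assumes d: "d \<ge> 2"
  shows "model d 1 (natural_specht (Qp :: 'p::prime_card padic_int fract ring) (Suc d)) (\<lambda>x. wedge d [co d x])"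
proof -
  let ?V = "natural_specht (Qp :: 'p padic_int fract ring) (Suc d)"
  have c: "coords ?V {..<d} (co d)" by (rule coords_natural[OF d])
  then have b: "bij_betw (co d) (carrier ?V) (fc {..<d})" by (simp add: coords_def)
  show ?thesis
    unfolding model_def
  proof (intro conjI ballI impI)
    show "gmodule Qp (sym_group (Suc d)) ?V" unfolding sublat_one[symmetric] by (rule gmodule_sublat)
    show "coords ?V {I. I \<subseteq> {..<d} \<and> card I = 1} (\<lambda>x. wedge d [co d x])"
      unfolding coords_def W_eq_fc[symmetric]
    proof (intro conjI ballI allI)
      show "bij_betw (\<lambda>x. wedge d [co d x]) (carrier ?V) (W d 1)"
        using bij_betw_trans[OF b wedge_single_bij] unfolding comp_def .
    qed (simp_all only: coords_add[OF c] coords_smult[OF c] wedge_single_linear)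
    show "wedge d [co d (act ?V (Transposition.transpose a b) x)] =
        wedge d [co d x] - Q d (rvec d a b) (rform d a b) (wedge d [co d x])"
      if "a \<in> {1..Suc d}" "b \<in> {1..Suc d}" "x \<in> carrier ?V" "a \<noteq> b" for a b x
      unfolding co_act_natural[OF d that(3,1,2,4)] by (rule wedge_single_reflection)
  qed
qed

lemma stdlat_wedge_single:
  fixes t :: "'p::prime_card padic_int"
  shows "(\<lambda>v. wedge d [\<lambda>i. c * Zp_to_Qp ((if i = 0 then 1 else t) * v i)]) ` fc {..<d} = stdlat d 1 c t"
proof (intro equalityI subsetI)
  fix y assume "y \<in> (\<lambda>v. wedge d [\<lambda>i. c * Zp_to_Qp ((if i = 0 then 1 else t) * v i)]) ` fc {..<d}"
  then obtain v where y: "y = wedge d [\<lambda>i. c * Zp_to_Qp ((if i = 0 then 1 else t) * v i)]" by blast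
  show "y \<in> stdlat d 1 c t"
  proof (rule stdlat_I)
    show "y \<in> W d 1" using wedge_in_W[of d "[\<lambda>i. c * Zp_to_Qp ((if i = 0 then 1 else t) * v i)]"]
      by (simp add: y)
    fix I :: "nat set" assume "I \<subseteq> {..<d}" "card I = 1"
    then obtain i where i: "I = {i}" "i < d" by (auto simp: card_1_singleton_iff)
    have "y I = c * Zp_to_Qp (v i * (if 0 \<in> I then 1 else t))"
      unfolding y i(1) wedge_single_apply[OF i(2)] by (auto simp: mult.commute)
    then show "\<exists>r. y I = c * Zp_to_Qp (r * (if 0 \<in> I then 1 else t))" by blast
  qed
next
  fix y assume y: "y \<in> stdlat d 1 c t"
  have "\<forall>i. \<exists>r. y {i} = c * Zp_to_Qp (r * (if 0 \<in> {i} then 1 else t))" using stdlat_D[OF y] by blast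
  then obtain r where r: "\<And>i. y {i} = c * Zp_to_Qp (r i * (if 0 \<in> {i} then 1 else t))" by metis
  define v where "v i = (if i < d then r i else 0)" for i
  have "{i. v i \<noteq> 0} \<subseteq> {..<d}" by (auto simp: v_def)
  then have v: "v \<in> fc {..<d}" unfolding fc_def using finite_subset by blast
  have e: "(\<lambda>i. c * Zp_to_Qp ((if i = 0 then 1 else t) * v i)) = (\<lambda>i. if i < d then y {i} else 0)"
    by (auto simp: fun_eq_iff v_def r ac_simps)
  have "y = wedge d [\<lambda>i. c * Zp_to_Qp ((if i = 0 then 1 else t) * v i)]"
    unfolding e using wedge_single_inverse[OF stdlat_W[OF y]] by (rule sym)
  then show "y \<in> (\<lambda>v. wedge d [\<lambda>i. c * Zp_to_Qp ((if i = 0 then 1 else t) * v i)]) ` fc {..<d}" using v by blast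
qed

lemma Zp_to_Qp_cv: "Zp_to_Qp (cv d a i) = cv d a i" and Zp_to_Qp_lf: "Zp_to_Qp (lf d a i) = lf d a i"
  by (auto simp: cv_def lf_def zero_fun_apply)

text \<open>These sublattices of the natural Specht lattice realize the types that actually occur;
  the inclusion itself is the embedding, with scale 1.\<close>

lemma ltype_sublat:
  fixes t :: "'p::prime_card padic_int"
  assumes d: "d \<ge> 2" and t: "t \<noteq> 0" "t dvd of_nat (Suc d)"
  shows "ltype d 1 t (sublat (Suc d) t)"
proof -
  obtain \<kappa> where \<kappa>: "coords (sublat (Suc d) t) {..<d} \<kappa>"
    "\<And>x i. x \<in> sublat_set (Suc d) t \<Longrightarrow> co d x i = (if i = 0 then 1 else t) * \<kappa> x i"
    using coords_sublat[OF d t] by blast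
  have g: "gmodule Zp (sym_group (Suc d)) (sublat (Suc d) t)" by (rule gmodule_sublat)
  have lat: "lattice_module Zp (sym_group (Suc d)) (sublat (Suc d) t)"
    unfolding lattice_module_def using g coords_finite_basis[OF gmodule.axioms(1)[OF g] \<kappa>(1)] by blast
  define z where "z x = (\<lambda>i. Zp_to_Qp (co d x i))" for x :: "nat \<Rightarrow> 'p padic_int"
  define \<iota> where "\<iota> x = wedge d [z x]" for x :: "nat \<Rightarrow> 'p padic_int"
  have z_add: "z (x + y) = z x + z y" and z_sc: "z (sc a x) = sc (Zp_to_Qp a) (z x)" for x y a
    by (simp_all add: z_def co_linear fun_algebra)
  have zk: "z x = (\<lambda>i. 1 * Zp_to_Qp ((if i = 0 then 1 else t) * \<kappa> x i))" if "x \<in> sublat_set (Suc d) t" for x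
    by (simp add: z_def \<kappa>(2)[OF that])
  have zinj: "x = y" if xy: "x \<in> sublat_set (Suc d) t" "y \<in> sublat_set (Suc d) t" and eq: "z x = z y" for x y
  proof -
    have "\<kappa> x = \<kappa> y"
    proof
      fix i
      have "(if i = 0 then 1 else t) * \<kappa> x i = (if i = 0 then 1 else t) * \<kappa> y i"
        using fun_cong[OF eq, of i] unfolding z_def Zp_to_Qp_eq_iff \<kappa>(2)[OF xy(1)] \<kappa>(2)[OF xy(2)] .
      then show "\<kappa> x i = \<kappa> y i" using t(1) by (auto split: if_splits)
    qed
    then show ?thesis using coords_inj[OF \<kappa>(1), of x y] xy by simp
  qed
  have zfc: "z x \<in> fc {..<d}" for x
  proof -
    have "{i. z x i \<noteq> 0} \<subseteq> {..<d}" using d by (auto simp: z_def co_def split: if_splits)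
    then show ?thesis unfolding fc_def using finite_subset by blast
  qed
  have "emb d 1 (sublat (Suc d) t) \<iota>"
    unfolding emb_def
  proof (intro conjI ballI allI impI)
    show "inj_on \<iota> (carrier (sublat (Suc d) t))"
    proof (rule inj_onI)
      fix x y assume xy: "x \<in> carrier (sublat (Suc d) t)" "y \<in> carrier (sublat (Suc d) t)" and "\<iota> x = \<iota> y"
      then have "z x = z y" using wedge_single_bij[where ?'a = "'p padic_int fract"] zfc unfolding \<iota>_def bij_betw_def by (metis inj_onD)
      then show "x = y" using zinj xy by simp
    qed
    show "\<iota> ` carrier (sublat (Suc d) t) \<subseteq> W d 1" using wedge_in_W[of d "[z x]" for x] by (auto simp: \<iota>_def simp del: wedge_simps)
    fix a b x assume ab: "a \<in> {1..Suc d}" "b \<in> {1..Suc d}" and x: "x \<in> carrier (sublat (Suc d) t)" and ne: "a \<noteq> b"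
    have xL: "x \<in> sublat_set (Suc d) t" using x by simp
    have "z (push Rc (Transposition.transpose a b) x) = z x - sc (dot d (rform d a b) (z x)) (rvec d a b)"
      unfolding z_def co_transpose[OF d xL ab ne]
      by (auto simp: fun_algebra dot_def Zp_to_Qp_sum rform_def rvec_def Zp_to_Qp_cv Zp_to_Qp_lf)
    then show "\<iota> (act (sublat (Suc d) t) (Transposition.transpose a b) x) = \<iota> x - Q d (rvec d a b) (rform d a b) (\<iota> x)"
      using xL wedge_single_reflection[of d "z x" "rform d a b" "rvec d a b"] by (simp add: \<iota>_def del: wedge_simps)
  qed (simp_all only: sublat_simps z_add z_sc \<iota>_def wedge_single_linear)
  moreover have "\<iota> ` carrier (sublat (Suc d) t) = stdlat d 1 1 t"
  proof -
    have "\<iota> ` carrier (sublat (Suc d) t) = (\<lambda>v. wedge d [\<lambda>i. 1 * Zp_to_Qp ((if i = 0 then 1 else t) * v i)]) ` \<kappa> ` carrier (sublat (Suc d) t)"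
      unfolding image_image by (rule image_cong) (simp_all only: \<iota>_def sublat_simps zk)
    also have "\<kappa> ` carrier (sublat (Suc d) t) = fc {..<d}" using \<kappa>(1) by (simp add: coords_def bij_betw_def)
    finally show ?thesis by (simp only: stdlat_wedge_single)
  qed
  ultimately show ?thesis
    unfolding ltype_def using lat by (intro conjI exI[of _ \<iota>] exI[of _ 1]) simp_all
qed

text \<open>Identify M with the span of c f_0 and the c t f_i. In its k-th exterior power a product
  carries c^k t^(k-1) if it contains f_0 and c^k t^k if not. Up to the common factor this is again a
  standard lattice with the same t.\<close>

lemma ltype_exterior_power:
  fixes M :: "('p::prime_card padic_int, 'm, nat \<Rightarrow> nat) gmodule"
  assumes d2: "d \<ge> 2" and k: "1 \<le> k" and t: "t \<noteq> 0" and tM: "ltype d 1 t M"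
  shows "ltype d k t (exterior_power Zp k M)"
proof -
  obtain \<iota> c where \<iota>: "c \<noteq> 0" "emb d 1 M \<iota>" "\<iota> ` carrier M = stdlat d 1 c t" using tM by (auto simp: ltype_def)
  have gM: "gmodule Zp (sym_group (Suc d)) M" using tM by (auto simp: ltype_def lattice_module_def)
  \<comment> \<open>The scales of the basis c f_0, c t f_1, ..., c t f_(d-1); \<open>sq\<close>
    turns integral coordinates in it into coordinates in the basis of the f_i.\<close>
  define l where "l i = c * Zp_to_Qp (if i = 0 then 1 else t)" for i :: nat
  have l0: "l i \<noteq> 0" for i using \<iota>(1) t by (simp add: l_def)
  define sq where "sq v = (\<lambda>i. l i * Zp_to_Qp (v i))" for v :: "nat \<Rightarrow> 'p padic_int"
  have sq_linear: "sq (v + v') = sq v + sq v'" "sq (sc a v) = sc (Zp_to_Qp a) (sq v)" for v v' a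
    by (simp_all add: sq_def fun_algebra algebra_simps)
  have sq_fc: "sq v \<in> fc {..<d}" if "v \<in> fc {..<d}" for v
  proof -
    have "{i. sq v i \<noteq> 0} \<subseteq> {i. v i \<noteq> 0}" by (auto simp: sq_def)
    then show ?thesis using that unfolding fc_def by (blast intro: finite_subset)
  qed
  have sq_inj: "v = v'" if "sq v = sq v'" for v v'
  proof
    fix i show "v i = v' i" using fun_cong[OF that, of i] l0 by (simp add: sq_def)
  qed
  have img: "(\<lambda>v. wedge d [sq v]) ` fc {..<d} = stdlat d 1 c t"
  proof -
    have "sq v = (\<lambda>i. c * Zp_to_Qp ((if i = 0 then 1 else t) * v i))" for v by (simp add: sq_def l_def mult.assoc)
    then show ?thesis using stdlat_wedge_single[of d c t] by (simp only:)
  qed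
  have winj: "v = v'" if "v \<in> fc {..<d}" "v' \<in> fc {..<d}" "wedge d [v] = wedge d [v']"
    for v v' :: "nat \<Rightarrow> 'p padic_int fract"
    using wedge_single_bij[of d, where ?'a = "'p padic_int fract"] that unfolding bij_betw_def by (blast dest: inj_onD)
  have "\<forall>x\<in>carrier M. \<exists>v. v \<in> fc {..<d} \<and> \<iota> x = wedge d [sq v]"
    using \<iota>(3) img by blast
  then obtain \<kappa> where kap: "\<And>x. x \<in> carrier M \<Longrightarrow> \<kappa> x \<in> fc {..<d}" "\<And>x. x \<in> carrier M \<Longrightarrow> \<iota> x = wedge d [sq (\<kappa> x)]"
    by metis
  have kapu: "\<kappa> x = v" if "x \<in> carrier M" "v \<in> fc {..<d}" "\<iota> x = wedge d [sq v]" for x v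
    using kap[OF that(1)] that by (intro sq_inj winj sq_fc) auto
  interpret Module.module Zp M using gM by (rule gmodule.axioms(1))
  have coordsM: "coords M {..<d} \<kappa>"
    unfolding coords_def
  proof (intro conjI ballI allI)
    show "bij_betw \<kappa> (carrier M) (fc {..<d})"
    proof (rule bij_betwI')
      fix x y assume "x \<in> carrier M" "y \<in> carrier M"
      then show "\<kappa> x = \<kappa> y \<longleftrightarrow> x = y" using kap(2) emb_inj[OF \<iota>(2)] by metis
    next
      fix v :: "nat \<Rightarrow> 'p padic_int" assume v: "v \<in> fc {..<d}"
      then have "wedge d [sq v] \<in> \<iota> ` carrier M" using img \<iota>(3) by blast
      then obtain x where "x \<in> carrier M" "\<iota> x = wedge d [sq v]" by (metis imageE)
      then show "\<exists>x\<in>carrier M. v = \<kappa> x" using kapu[OF _ v] by metis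
    qed (rule kap(1))
  next
    fix x y assume xy: "x \<in> carrier M" "y \<in> carrier M"
    have "\<iota> (x \<oplus>\<^bsub>M\<^esub> y) = wedge d [sq (\<kappa> x + \<kappa> y)]"
      unfolding emb_add[OF \<iota>(2) xy] kap(2)[OF xy(1)] kap(2)[OF xy(2)] sq_linear wedge_single_linear ..
    then show "\<kappa> (x \<oplus>\<^bsub>M\<^esub> y) = \<kappa> x + \<kappa> y"
      using xy by (intro kapu fc_add kap(1)) auto
  next
    fix a x assume x: "x \<in> carrier M"
    have "\<iota> (a \<odot>\<^bsub>M\<^esub> x) = wedge d [sq (sc a (\<kappa> x))]"
      unfolding emb_smult[OF \<iota>(2) x] kap(2)[OF x] sq_linear wedge_single_linear ..
    then show "\<kappa> (a \<odot>\<^bsub>M\<^esub> x) = sc a (\<kappa> x)"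
      using x by (intro kapu fc_sc kap(1)) (auto simp: carrier_class)
  qed
  interpret ext_power "sym_group (Suc d)" M d k \<kappa>
    by (rule ext_power.intro[OF gM coordsM]) (use d2 in simp)
  let ?E = "exterior_power Zp k M"
  \<comment> \<open>On exterior powers, the change from the scaled basis to the f_i is the dilation
    by \<open>l\<close>.\<close>
  define B where "B y = dilate l (\<lambda>I. Zp_to_Qp (y I))" for y :: "nat set \<Rightarrow> 'p padic_int"
  have B_linear: "B 0 = 0" "B (x + y) = B x + B y" "B (sc a x) = sc (Zp_to_Qp a) (B x)" for x y a
    by (simp_all add: B_def dilate_def fun_algebra algebra_simps)
  have Bw: "B (w ms) = wedge d (map (\<lambda>x. sq (\<kappa> x)) ms)" for ms
  proof -
    have "(\<lambda>I. Zp_to_Qp (wedge d (map \<kappa> ms) I)) = wedge d (map (\<lambda>v i. Zp_to_Qp (v i)) (map \<kappa> ms))"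
      by (rule wedge_hom) simp_all
    then have "B (w ms) = dilate l (wedge d (map (\<lambda>v i. Zp_to_Qp (v i)) (map \<kappa> ms)))"
      by (simp only: B_def w_def)
    also have "\<dots> = wedge d (map (\<lambda>v i. l i * v i) (map (\<lambda>v i. Zp_to_Qp (v i)) (map \<kappa> ms)))"
      by (rule wedge_dilate[symmetric])
    finally show ?thesis by (simp add: sq_def comp_def)
  qed
  \<comment> \<open>The embedding knows the reflection only on single wedges; injectivity in degree
    one brings it back to coordinate vectors, provided both sides are supported below
    \<open>d\<close>.\<close>
  have reflect: "sq (\<kappa> (act M (Transposition.transpose a b) x)) =
      sq (\<kappa> x) - sc (dot d (rform d a b) (sq (\<kappa> x))) (rvec d a b)"
    if ab: "a \<in> {1..Suc d}" "b \<in> {1..Suc d}" "a \<noteq> b" and x: "x \<in> carrier M" for a b x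
  proof (rule winj)
    let ?s = "act M (Transposition.transpose a b) x"
    have s: "?s \<in> carrier M" by (rule gmodule_act_closed[OF gM transpose_in_sym_group[OF ab(1,2)] x])
    show "sq (\<kappa> ?s) \<in> fc {..<d}" by (rule sq_fc[OF kap(1)[OF s]])
    have "{i. rvec d a b i \<noteq> (0 :: 'p padic_int fract)} \<subseteq> {..<d}"
      using rvec_support[OF ab(1,2) _ d2] by (metis (mono_tags, lifting) lessThan_iff mem_Collect_eq not_le subsetI)
    then have "rvec d a b \<in> (fc {..<d} :: (nat \<Rightarrow> 'p padic_int fract) set)"
      unfolding fc_def using finite_subset by blast
    then show "sq (\<kappa> x) - sc (dot d (rform d a b) (sq (\<kappa> x))) (rvec d a b) \<in> fc {..<d}"
      by (intro fc_diff fc_sc sq_fc kap(1) x)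
    show "wedge d [sq (\<kappa> ?s)] = wedge d [sq (\<kappa> x) - sc (dot d (rform d a b) (sq (\<kappa> x))) (rvec d a b)]"
      unfolding wedge_single_reflection kap(2)[OF s, symmetric] kap(2)[OF x, symmetric] by (rule emb_act[OF \<iota>(2) ab x])
  qed
  have barW: "E.bar C \<in> W d k" if "C \<in> carrier ?E" for C
    using coords_in[OF E_coords that] by (simp add: W_eq_fc)
  \<comment> \<open>At most one factor of the product lacks t, namely the one at 0, so t^(k-1) can
    always be split off; this needs k \<ge> 1.\<close>
  have prodl: "(\<Prod>i\<in>I. l i) = c ^ k * Zp_to_Qp t ^ (k - 1) * Zp_to_Qp (if 0 \<in> I then 1 else t)"
    if I: "I \<subseteq> {..<d}" "card I = k" for I
  proof -
    have fin: "finite I" using I(1) finite_subset by blast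
    have "(\<Prod>i\<in>I. l i) = c ^ k * (\<Prod>i\<in>I. Zp_to_Qp (if i = 0 then 1 else t))"
      unfolding l_def by (simp add: prod.distrib I)
    also have "(\<Prod>i\<in>I. Zp_to_Qp (if i = 0 then 1 else t)) = (\<Prod>i\<in>I - {0}. Zp_to_Qp t)"
      using fin by (intro prod.mono_neutral_cong_right) auto
    also have "\<dots> = Zp_to_Qp t ^ card (I - {0})" by simp
    also have "\<dots> = Zp_to_Qp t ^ (k - 1) * Zp_to_Qp (if 0 \<in> I then 1 else t)"
    proof (cases "0 \<in> I")
      case True
      then show ?thesis using fin I by simp
    next
      case False
      have "Zp_to_Qp t ^ k = Zp_to_Qp t ^ (k - 1) * Zp_to_Qp t" using k by (metis One_nat_def Suc_pred le_eq_less_or_eq less_le_trans power_Suc2 zero_less_one)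
      then show ?thesis using False I by simp
    qed
    finally show ?thesis by (simp add: mult.assoc)
  qed
  have Binj: "x = y" if "x \<in> W d k" "y \<in> W d k" "B x = B y" for x y
  proof
    fix I
    show "x I = y I"
    proof (cases "finite I")
      case True
      then have "(\<Prod>i\<in>I. l i) \<noteq> 0" using l0 by simp
      then show ?thesis using fun_cong[OF that(3), of I] by (simp add: B_def dilate_def)
    next
      case False
      then have "x I = 0" "y I = 0" using W_D[OF that(1), of I] W_D[OF that(2), of I] finite_subset by blast+
      then show ?thesis by simp
    qed
  qed
  let ?c = "c ^ k * Zp_to_Qp t ^ (k - 1)"
  have Bimg: "B ` W d k = stdlat d k ?c t"
  proof (intro equalityI subsetI)
    fix y assume "y \<in> B ` W d k"
    then obtain x where x: "x \<in> W d k" "y = B x" by blast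
    show "y \<in> stdlat d k ?c t"
    proof (rule stdlat_I)
      show "y \<in> W d k" unfolding W_def
      proof (intro CollectI allI impI)
        fix I assume "y I \<noteq> 0"
        then have "x I \<noteq> 0" by (auto simp: x(2) B_def dilate_def)
        then show "I \<subseteq> {..<d} \<and> card I = k" by (rule W_D[OF x(1)])
      qed
      fix I assume I: "I \<subseteq> {..<d}" "card I = k"
      have "y I = ?c * Zp_to_Qp (x I * (if 0 \<in> I then 1 else t))"
        unfolding x(2) B_def dilate_def prodl[OF I] by (simp add: ac_simps)
      then show "\<exists>r. y I = ?c * Zp_to_Qp (r * (if 0 \<in> I then 1 else t))" by blast
    qed
  next
    fix y assume y: "y \<in> stdlat d k ?c t"
    have "\<forall>I. \<exists>r. y I = ?c * Zp_to_Qp (r * (if 0 \<in> I then 1 else t))" using stdlat_D[OF y] by blast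
    then obtain r where r: "\<And>I. y I = ?c * Zp_to_Qp (r I * (if 0 \<in> I then 1 else t))" by metis
    define x where "x I = (if I \<subseteq> {..<d} \<and> card I = k then r I else 0)" for I
    have x: "x \<in> W d k" by (auto simp: W_def x_def)
    have "y = B x"
    proof
      fix I show "y I = B x I"
      proof (cases "I \<subseteq> {..<d} \<and> card I = k")
        case True
        then show ?thesis unfolding r B_def dilate_def using prodl[of I] by (simp add: x_def ac_simps)
      next
        case False
        then have "y I = 0" using W_D[OF stdlat_W[OF y], of I] by blast
        moreover have "x I = 0" unfolding x_def using False by (rule if_not_P)
        ultimately show ?thesis by (simp add: B_def dilate_def)
      qed
    qed
    then show "y \<in> B ` W d k" using x by blast
  qed
  have barimg: "E.bar ` carrier ?E = W d k"
    using E_coords unfolding coords_def W_eq_fc[symmetric] bij_betw_def by blast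
  have "emb d k ?E (\<lambda>C. B (E.bar C))"
    unfolding emb_def
  proof (intro conjI ballI allI impI)
    show "inj_on (\<lambda>C. B (E.bar C)) (carrier ?E)"
      using Binj barW coords_inj[OF E_coords] by (intro inj_onI) blast
    show "(\<lambda>C. B (E.bar C)) ` carrier ?E \<subseteq> W d k"
      using barW Bimg stdlat_W by blast
    fix a b C assume ab: "a \<in> {1..Suc d}" "b \<in> {1..Suc d}" and C: "C \<in> carrier ?E" and ne: "a \<noteq> b"
    let ?t = "Transposition.transpose a b"
    show "B (E.bar (act ?E ?t C)) = B (E.bar C) - Q d (rvec d a b) (rform d a b) (B (E.bar C))"
    proof (rule E_act[OF transpose_in_sym_group[OF ab] C, where \<phi> = Zp_to_Qp and
          A = "\<lambda>y. y - Q d (rvec d a b) (rform d a b) y"])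
      fix ms assume ms: "ms \<in> X"
      have "map (\<lambda>x. sq (\<kappa> x)) (map (act M ?t) ms) =
          map (\<lambda>v. v - sc (dot d (rform d a b) v) (rvec d a b)) (map (\<lambda>x. sq (\<kappa> x)) ms)"
        using ms reflect[OF ab ne] by (auto simp: tuples_def subset_iff)
      then show "B (w (map (act M ?t) ms)) = B (w ms) - Q d (rvec d a b) (rform d a b) (B (w ms))"
        unfolding Bw Q_def by (simp only: wedge_reflection)
    qed (simp_all only: reflection_linear B_linear)
  qed (simp_all add: coords_add[OF E_coords] coords_smult[OF E_coords] B_linear)
  moreover have "(\<lambda>C. B (E.bar C)) ` carrier ?E = stdlat d k ?c t"
    using barimg Bimg by (simp flip: image_image)
  moreover have "?c \<noteq> 0" using \<iota>(1) t by simp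
  ultimately show ?thesis unfolding ltype_def using E_lattice by blast
qed

text \<open>Here n = d + 1 and \<open>v\<close> is the p-adic valuation of n.\<close>

locale hook_lattices =
  fixes d :: nat and u :: "'p::prime_card padic_int" and v :: nat
  assumes d: "d \<ge> 2" and two: "(2 :: 'p padic_int) dvd 1"
    and u: "u dvd 1" "of_nat (Suc d) = u * of_nat CARD('p) ^ v"
begin

abbreviation q :: "'p padic_int" where "q \<equiv> of_nat CARD('p)"

text \<open>A form embeds as a stable lattice, hence is standard with t dividing n. The unit part of
  t does not change the standard lattice, so only the exponent of p remains.\<close>

lemma ltype_of_is_form:
  fixes M :: "('p padic_int, 'm, nat \<Rightarrow> nat) gmodule"
  assumes k: "1 \<le> k" "k < d" and V: "model d k V \<Phi>" and F: "is_form (Suc d) V M"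
  obtains j where "j \<le> v" "ltype d k (q ^ j) M"
proof -
  obtain \<iota> where \<iota>: "emb d k M \<iota>" "spans d k (\<iota> ` carrier M)" using emb_of_is_form[OF V F] .
  have lat: "lattice_module Zp (sym_group (Suc d)) M" using F by (simp add: is_form_def)
  then have gM: "gmodule Zp (sym_group (Suc d)) M" by (simp add: lattice_module_def)
  have "\<exists>c t. c \<noteq> 0 \<and> t dvd of_nat (Suc d) \<and> \<iota> ` carrier M = stdlat d k c t"
  proof (rule stable_lattice[OF d k two, of "\<iota> ` carrier M"])
    show "\<iota> ` carrier M \<subseteq> W d k" using emb_W[OF \<iota>(1)] by blast
    show "\<exists>a. a \<noteq> 0 \<and> sc (Zp_to_Qp a) (bs I) \<in> \<iota> ` carrier M" if "I \<subseteq> {..<d}" "card I = k" for I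
      using \<iota>(2) bs_in_W[OF that] unfolding spans_def by blast
    show "\<exists>a. a \<noteq> 0 \<and> (\<forall>x\<in>\<iota> ` carrier M. \<exists>r. Zp_to_Qp a * x I = Zp_to_Qp r)" for I
      by (rule emb_bounded[OF lat \<iota>(1)])
    show "x + y \<in> \<iota> ` carrier M" if "x \<in> \<iota> ` carrier M" "y \<in> \<iota> ` carrier M" for x y
      by (rule emb_image_add[OF gM \<iota>(1) that])
    show "sc (Zp_to_Qp r) x \<in> \<iota> ` carrier M" if "x \<in> \<iota> ` carrier M" for r x
      by (rule emb_image_sc[OF gM \<iota>(1) that])
    show "Q d (rvec d a b) (rform d a b) x \<in> \<iota> ` carrier M"
      if "a \<in> {1..Suc d}" "b \<in> {1..Suc d}" "a \<noteq> b" "x \<in> \<iota> ` carrier M" for a b x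
      by (rule emb_image_Q[OF gM \<iota>(1) that])
    show "\<exists>c t. c \<noteq> 0 \<and> t dvd of_nat (Suc d) \<and> \<iota> ` carrier M = stdlat d k c t"
      if "c \<noteq> 0" "t dvd of_nat (Suc d)" "\<iota> ` carrier M = stdlat d k c t" for c t
      using that by (intro exI conjI)
  qed
  then obtain c t where c: "c \<noteq> 0" "t dvd of_nat (Suc d)" "\<iota> ` carrier M = stdlat d k c t"
    by (elim exE conjE)
  have "t dvd u * q ^ v" using c(2) unfolding u(2) .
  then obtain w j where w: "w dvd 1" "j \<le> v" "t = w * q ^ j"
    by (rule padic_divisor[OF u(1)])
  have "\<iota> ` carrier M = stdlat d k c (q ^ j)"
    unfolding c(3) w(3) by (rule stdlat_unit[OF w(1)])
  then have "ltype d k (q ^ j) M"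
    unfolding ltype_def using lat c(1) \<iota>(1) by (intro conjI exI[of _ \<iota>] exI[of _ c])
  then show ?thesis using that w(2) by blast
qed

lemma q_power_dvd:
  assumes "j \<le> v"
  shows "q ^ j dvd of_nat (Suc d)"
  unfolding u(2) using assms by (intro dvd_mult le_imp_power_dvd)

lemma ltype_unique:
  fixes M :: "('p padic_int, 'm, nat \<Rightarrow> nat) gmodule" and N :: "('p padic_int, 'n, nat \<Rightarrow> nat) gmodule"
  assumes k: "1 \<le> k" "k < d" and M: "ltype d k (q ^ i) M" and N: "ltype d k (q ^ j) N"
    and iso: "gmodule_iso Zp (sym_group (Suc d)) M N"
  shows "i = j"
proof -
  have gM: "gmodule Zp (sym_group (Suc d)) M" using M by (auto simp: ltype_def lattice_module_def)
  have "q ^ j dvd 1 * q ^ i" using ltype_dvd[OF d k two M N iso] by simp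
  then have "j \<le> i" by (intro padic_power_dvd[of 1]) simp_all
  moreover have "q ^ i dvd 1 * q ^ j" using ltype_dvd[OF d k two N M gmodule_iso_sym[OF gM iso]] by simp
  then have "i \<le> j" by (intro padic_power_dvd[of 1]) simp_all
  ultimately show ?thesis by simp
qed

text \<open>The exponents 0, ..., v index the classes bijectively, which gives v + 1 of them. The
  hypothesis \<open>ex\<close> asks for realizations over the universal element type, where the
  classes are counted.\<close>

lemma form_classes_eq:
  fixes V :: "('p padic_int fract, 'v, nat \<Rightarrow> nat) gmodule"
  assumes k: "1 \<le> k" "k < d" and V: "model d k V \<Phi>"
    and ex: "\<And>j. j \<le> v \<Longrightarrow> \<exists>M :: ('p padic_int, nat \<Rightarrow> 'p padic_int, nat \<Rightarrow> nat) gmodule. ltype d k (q ^ j) M"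
  shows "finite (form_classes (Suc d) V) \<and> card (form_classes (Suc d) V) = Suc v"
proof -
  let ?C = "\<lambda>j. {M :: ('p padic_int, nat \<Rightarrow> 'p padic_int, nat \<Rightarrow> nat) gmodule. ltype d k (q ^ j) M}"
  let ?R = "{(M, N). is_form (Suc d) V M \<and> is_form (Suc d) V N \<and> gmodule_iso Zp (sym_group (Suc d)) M N}
    :: (('p padic_int, nat \<Rightarrow> 'p padic_int, nat \<Rightarrow> nat) gmodule \<times> ('p padic_int, nat \<Rightarrow> 'p padic_int, nat \<Rightarrow> nat) gmodule) set"
  have form: "is_form (Suc d) V M" if "ltype d k (q ^ j) M" for M :: "('p padic_int, nat \<Rightarrow> 'p padic_int, nat \<Rightarrow> nat) gmodule" and j
    by (rule is_form_of_ltype[OF V that]) (simp add: padic_of_nat_nonzero)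
  have cls: "?R `` {M} = ?C j" if M: "ltype d k (q ^ j) M" for M :: "('p padic_int, nat \<Rightarrow> 'p padic_int, nat \<Rightarrow> nat) gmodule" and j
  proof (intro equalityI subsetI)
    fix N :: "('p padic_int, nat \<Rightarrow> 'p padic_int, nat \<Rightarrow> nat) gmodule" assume "N \<in> ?R `` {M}"
    then have N: "is_form (Suc d) V N" "gmodule_iso Zp (sym_group (Suc d)) M N" by auto
    obtain i where i: "i \<le> v" "ltype d k (q ^ i) N" by (rule ltype_of_is_form[OF k V N(1)])
    then show "N \<in> ?C j" using ltype_unique[OF k M i(2) N(2)] by simp
  next
    fix N :: "('p padic_int, nat \<Rightarrow> 'p padic_int, nat \<Rightarrow> nat) gmodule" assume "N \<in> ?C j"
    then show "N \<in> ?R `` {M}" using form M ltype_iso[OF M] by auto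
  qed
  have "form_classes (Suc d) V = ?C ` {..v}"
    unfolding form_classes_def quotient_def
  proof (intro equalityI subsetI)
    fix K assume "K \<in> (\<Union>M\<in>{M. is_form (Suc d) V M}. {?R `` {M}})"
    then obtain M where M: "is_form (Suc d) V M" "K = ?R `` {M}" by blast
    obtain j where j: "j \<le> v" "ltype d k (q ^ j) M" by (rule ltype_of_is_form[OF k V M(1)])
    then show "K \<in> ?C ` {..v}" using cls[OF j(2)] M(2) by blast
  next
    fix K assume "K \<in> ?C ` {..v}"
    then obtain j where j: "j \<le> v" "K = ?C j" by blast
    obtain M :: "('p padic_int, nat \<Rightarrow> 'p padic_int, nat \<Rightarrow> nat) gmodule" where M: "ltype d k (q ^ j) M"
      using ex[OF j(1)] by blast
    show "K \<in> (\<Union>M\<in>{M. is_form (Suc d) V M}. {?R `` {M}})"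
      using form[OF M] cls[OF M] j(2) by blast
  qed
  moreover have "inj_on ?C {..v}"
  proof (rule inj_onI)
    fix i j assume ij: "i \<in> {..v}" "j \<in> {..v}" "?C i = ?C j"
    obtain M :: "('p padic_int, nat \<Rightarrow> 'p padic_int, nat \<Rightarrow> nat) gmodule" where M: "ltype d k (q ^ i) M"
      using ex[of i] ij(1) by auto
    then have M': "ltype d k (q ^ j) M" using ij(3) by blast
    show "i = j" by (rule ltype_unique[OF k M M' ltype_iso[OF M M]])
  qed
  ultimately show ?thesis by (simp add: card_image)
qed

lemma ltype_natural_exists:
  "j \<le> v \<Longrightarrow> ltype d 1 (q ^ j) (sublat (Suc d) (q ^ j))"
  by (rule ltype_sublat[OF d _ q_power_dvd]) (simp_all add: padic_of_nat_nonzero)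

lemma ltype_ext:
  fixes M :: "('p padic_int, 'm, nat \<Rightarrow> nat) gmodule"
  shows "1 \<le> k \<Longrightarrow> ltype d 1 (q ^ j) M \<Longrightarrow> ltype d k (q ^ j) (exterior_power Zp k M)"
  by (rule ltype_exterior_power[OF d]) (simp_all add: padic_of_nat_nonzero)

text \<open>The elements of an exterior power are cosets, so a coordinate copy is needed to reach
  the universal element type.\<close>

lemma ltype_hook_exists:
  assumes "1 \<le> k" "j \<le> v"
  shows "\<exists>M :: ('p padic_int, nat \<Rightarrow> 'p padic_int, nat \<Rightarrow> nat) gmodule. ltype d k (q ^ j) M"
proof -
  let ?E = "exterior_power Zp k (sublat (Suc d) (q ^ j))"
  have E: "ltype d k (q ^ j) ?E" by (rule ltype_ext[OF assms(1) ltype_natural_exists[OF assms(2)]])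
  then have "lattice_module Zp (sym_group (Suc d)) ?E" by (simp add: ltype_def)
  then obtain M :: "('p padic_int, nat \<Rightarrow> 'p padic_int, nat \<Rightarrow> nat) gmodule"
    where M: "lattice_module Zp (sym_group (Suc d)) M" "gmodule_iso Zp (sym_group (Suc d)) ?E M"
    using lattice_coordinate_copy by blast
  then show ?thesis using ltype_transfer[OF E] by blast
qed

text \<open>The exponent j is a complete invariant both in degree one and in degree k, with the same
  range, and the exterior power keeps it.\<close>

lemma representatives_exterior_power:
  fixes Ls :: "('p padic_int, 'm, nat \<Rightarrow> nat) gmodule list"
  assumes k: "1 \<le> k" "k < d" and V: "model d 1 V \<Phi>" and V': "model d k V' \<Phi>'"
    and Ls: "form_representatives TYPE(nat \<Rightarrow> 'p padic_int) (Suc d) V Ls"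
  shows "form_representatives TYPE('b) (Suc d) V' (map (exterior_power Zp k) Ls)"
proof -
  have k1: "1 \<le> (1::nat)" "1 < d" using d by simp_all
  have tL: "\<exists>j\<le>v. ltype d 1 (q ^ j) X" if "X \<in> set Ls" for X
  proof -
    have "is_form (Suc d) V X" using Ls that unfolding form_representatives_def by blast
    then obtain j where "j \<le> v" "ltype d 1 (q ^ j) X" by (rule ltype_of_is_form[OF k1 V])
    then show ?thesis by blast
  qed
  show ?thesis
    unfolding form_representatives_def
  proof (intro conjI allI impI ballI)
    fix E assume "E \<in> set (map (exterior_power Zp k) Ls)"
    then obtain X where X: "X \<in> set Ls" "E = exterior_power Zp k X" by auto
    obtain j where "j \<le> v" "ltype d 1 (q ^ j) X" using tL[OF X(1)] by blast
    then have "ltype d k (q ^ j) E" unfolding X(2) by (intro ltype_ext k(1))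
    then show "is_form (Suc d) V' E" by (rule is_form_of_ltype[OF V']) (simp add: padic_of_nat_nonzero)
  next
    fix i j assume ij: "i < length (map (exterior_power Zp k) Ls)" "j < length (map (exterior_power Zp k) Ls)"
      and iso: "gmodule_iso Zp (sym_group (Suc d)) (map (exterior_power Zp k) Ls ! i) (map (exterior_power Zp k) Ls ! j)"
    have ij': "i < length Ls" "j < length Ls" using ij by simp_all
    obtain a where a: "ltype d 1 (q ^ a) (Ls ! i)" using tL[OF nth_mem[OF ij'(1)]] by blast
    obtain b where b: "ltype d 1 (q ^ b) (Ls ! j)" using tL[OF nth_mem[OF ij'(2)]] by blast
    have "gmodule_iso Zp (sym_group (Suc d)) (exterior_power Zp k (Ls ! i)) (exterior_power Zp k (Ls ! j))"
      using iso ij' by simp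
    then have "a = b" by (rule ltype_unique[OF k ltype_ext[OF k(1) a] ltype_ext[OF k(1) b]])
    then have "gmodule_iso Zp (sym_group (Suc d)) (Ls ! i) (Ls ! j)" using ltype_iso[OF a] b by simp
    then show "i = j" using Ls ij' unfolding form_representatives_def by blast
  next
    fix M :: "('p padic_int, 'b, nat \<Rightarrow> nat) gmodule" assume "is_form (Suc d) V' M"
    then obtain j where j: "j \<le> v" "ltype d k (q ^ j) M" by (rule ltype_of_is_form[OF k V'])
    let ?sublat = "sublat (Suc d) (q ^ j)"
    have tl: "ltype d 1 (q ^ j) ?sublat" by (rule ltype_natural_exists[OF j(1)])
    \<comment> \<open>The sublattice has the universal element type, so the completeness of
      \<open>Ls\<close>, which speaks of that type only, applies to it although M has another
      type.\<close>
    have "is_form (Suc d) V ?sublat" by (rule is_form_of_ltype[OF V tl]) (simp add: padic_of_nat_nonzero)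
    then obtain X where X: "X \<in> set Ls" "gmodule_iso Zp (sym_group (Suc d)) ?sublat X"
      using Ls unfolding form_representatives_def by blast
    obtain i where i: "ltype d 1 (q ^ i) X" using tL[OF X(1)] by blast
    then have "j = i" by (intro ltype_unique[OF k1 tl i X(2)])
    then have "ltype d k (q ^ j) (exterior_power Zp k X)" using ltype_ext[OF k(1) i] by simp
    then have "gmodule_iso Zp (sym_group (Suc d)) M (exterior_power Zp k X)" by (rule ltype_iso[OF j(2)])
    then show "\<exists>E\<in>set (map (exterior_power Zp k) Ls). gmodule_iso Zp (sym_group (Suc d)) M E" using X(1) by auto
  qed
qed

end

theorem theorem6p1:
  fixes n k :: nat
  assumes "n \<ge> 3" and "k \<in> {1..n - 2}" and "CARD('p::prime_card) \<ge> 3"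
  shows "(\<forall>Ls :: ('p padic_int, 'm, nat \<Rightarrow> nat) gmodule list.
      form_representatives TYPE(nat \<Rightarrow> 'p padic_int) n (natural_specht Qp n) Ls \<longrightarrow>
      form_representatives TYPE('b) n (hook_specht Qp n k) (map (exterior_power Zp k) Ls)) \<and>
    finite (form_classes n (natural_specht (Qp :: 'p padic_int fract ring) n)) \<and>
    finite (form_classes n (hook_specht (Qp :: 'p padic_int fract ring) n k)) \<and>
    card (form_classes n (natural_specht (Qp :: 'p padic_int fract ring) n)) =
      card (form_classes n (hook_specht (Qp :: 'p padic_int fract ring) n k))"
proof -
  define d where "d = n - 1"
  have n: "n = Suc d" and d: "d \<ge> 2" and k: "1 \<le> k" "k < d" and k1: "1 \<le> (1::nat)" "1 < d"
    using assms(1,2) by (auto simp: d_def)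
  have two: "(2 :: 'p padic_int) dvd 1" by (rule padic_two_unit[OF assms(3)])
  obtain u :: "'p padic_int" and v where u: "u dvd 1" "of_nat (Suc d) = u * of_nat CARD('p) ^ v"
    using padic_factor[of "of_nat (Suc d) :: 'p padic_int"] padic_of_nat_nonzero[of "Suc d", where ?'p = 'p] by blast
  interpret hook_lattices d u v by (rule hook_lattices.intro[OF d two u])
  have V: "model d 1 (natural_specht (Qp :: 'p padic_int fract ring) n) (\<lambda>x. wedge d [co d x])"
    unfolding n by (rule model_natural[OF d])
  obtain \<Phi> where V': "model d k (hook_specht (Qp :: 'p padic_int fract ring) n k) \<Phi>"
    unfolding n by (rule model_hook[OF d])
  have "finite (form_classes n (natural_specht (Qp :: 'p padic_int fract ring) n)) \<and>
      card (form_classes n (natural_specht (Qp :: 'p padic_int fract ring) n)) = Suc v"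
    using form_classes_eq[OF k1 V] ltype_natural_exists unfolding n by blast
  moreover have "finite (form_classes n (hook_specht (Qp :: 'p padic_int fract ring) n k)) \<and>
      card (form_classes n (hook_specht (Qp :: 'p padic_int fract ring) n k)) = Suc v"
    using form_classes_eq[OF k V'] ltype_hook_exists[OF k(1)] unfolding n by blast
  moreover have "form_representatives TYPE('b) n (hook_specht Qp n k) (map (exterior_power Zp k) Ls)"
    if "form_representatives TYPE(nat \<Rightarrow> 'p padic_int) n (natural_specht Qp n) Ls"
    for Ls :: "('p padic_int, 'm, nat \<Rightarrow> nat) gmodule list"
    using representatives_exterior_power[OF k V V'] that unfolding n .
  ultimately show ?thesis by simp
qed

end
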